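(* Let $G$ be a Lie group acting smoothly and properly on a smooth manifold $M$, and let $R=M/G$ be the orbit space, equipped with the quotient topology and the differential structure $C^\infty(R)$. Let $n\geq 1$ and let $f:R\to\mathbb{R}^n$ be a continuous function. Then for any $\epsilon>0$ there exists $g\in C^\infty(R;\mathbb{R}^n)$ such that $$|g(y)-f(y)|<\epsilon\quad\text{for all } y\in R,$$ and, moreover, $g$ is homotopic to $f$.
   Context: Smooth manifolds are Hausdorff and second countable. Let $\rho:M\to R=M/G$ be the canonical projection (orbit map). $R$ carries the quotient topology: $V\subseteq R$ is open iff $\rho^{-1}(V)$ is open in $M$. The differential structure (the set of smooth real-valued functions) on $R$ is $$C^\infty(R)=\{h:R\to\mathbb{R}\mid \rho^*h=h\circ\rho\in C^\infty(M)\}.$$ $C^\infty(R;\mathbb{R}^n)$ denotes the set of maps $g=(g_1,\dots,g_n):R\to\mathbb{R}^n$ that are smooth, i.e. $g_i\in C^\infty(R)$ for each $i$. $|\cdot|$ is the Euclidean norm on $\mathbb{R}^n$. Homotopic means homotopic through continuous maps $R\to\mathbb{R}^n$. *)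

theory Defs
  imports "HOL-Analysis.Analysis" "HOL-Algebra.Group_Action"
begin

section \<open>Smoothness on open subsets of Euclidean space\<close>

text \<open>
  The $m$-dimensional model space is the library's \<^const>\<open>Euclidean_space\<close> \<open>m\<close>, i.e. the
  sequences \<open>x :: nat \<Rightarrow> real\<close> with \<open>x i = 0\<close> for \<open>i \<ge> m\<close>. A type of class
  \<^class>\<open>euclidean_space\<close> would exclude dimension 0, hence all discrete Lie groups.
  All predicates below are meant for sets \<open>U\<close> that are open in \<open>Euclidean_space m\<close>; then
  \<open>x(i := t)\<close> with \<open>i < m\<close> lies in \<open>U\<close> for \<open>t\<close> near \<open>x i\<close>, and the derivative
  at \<open>x i\<close> is the \<open>i\<close>-th partial derivative.
\<close>

fun Ck_on :: "nat \<Rightarrow> nat \<Rightarrow> (nat \<Rightarrow> real) set \<Rightarrow> ((nat \<Rightarrow> real) \<Rightarrow> real) \<Rightarrow> bool" where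
  "Ck_on m 0 U f \<longleftrightarrow> continuous_on U f"
| "Ck_on m (Suc k) U f \<longleftrightarrow> continuous_on U f \<and>
     (\<forall>i<m. \<exists>f'. (\<forall>x\<in>U. ((\<lambda>t. f (x(i := t))) has_real_derivative f' x) (at (x i))) \<and>
                 Ck_on m k U f')"

definition smooth_on :: "nat \<Rightarrow> (nat \<Rightarrow> real) set \<Rightarrow> ((nat \<Rightarrow> real) \<Rightarrow> real) \<Rightarrow> bool" where
  "smooth_on m U f \<longleftrightarrow> (\<forall>k. Ck_on m k U f)"

definition smooth_vec_on ::
    "nat \<Rightarrow> nat \<Rightarrow> (nat \<Rightarrow> real) set \<Rightarrow> ((nat \<Rightarrow> real) \<Rightarrow> (nat \<Rightarrow> real)) \<Rightarrow> bool" where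
  "smooth_vec_on m n U F \<longleftrightarrow> (\<forall>j<n. smooth_on m U (\<lambda>x. F x j))"


section \<open>Smooth manifolds and smooth maps\<close>

type_synonym 'a chart = "'a set \<times> ('a \<Rightarrow> nat \<Rightarrow> real)"

text \<open>The smooth structure is given by an arbitrary, not necessarily maximal, smooth atlas.\<close>

record 'a mfd =
  mtop :: "'a topology"
  mdim :: nat
  matlas :: "'a chart set"

definition is_chart :: "'a topology \<Rightarrow> nat \<Rightarrow> 'a set \<Rightarrow> ('a \<Rightarrow> nat \<Rightarrow> real) \<Rightarrow> bool" where
  "is_chart X m U \<phi> \<longleftrightarrow>
     openin X U \<and> openin (Euclidean_space m) (\<phi> ` U) \<and>
     homeomorphic_map (subtopology X U) (subtopology (Euclidean_space m) (\<phi> ` U)) \<phi>"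

definition smooth_manifold :: "'a mfd \<Rightarrow> bool" where
  "smooth_manifold M \<longleftrightarrow>
     Hausdorff_space (mtop M) \<and> second_countable (mtop M) \<and>
     (\<forall>(U, \<phi>) \<in> matlas M. is_chart (mtop M) (mdim M) U \<phi>) \<and>
     (\<Union>(U, \<phi>) \<in> matlas M. U) = topspace (mtop M) \<and>
     (\<forall>(U, \<phi>) \<in> matlas M. \<forall>(V, \<psi>) \<in> matlas M.
        smooth_vec_on (mdim M) (mdim M) (\<phi> ` (U \<inter> V)) (\<psi> \<circ> inv_into U \<phi>))"

definition smooth_functions :: "'a mfd \<Rightarrow> ('a \<Rightarrow> real) set" where
  "smooth_functions M =
     {h. \<forall>(U, \<phi>) \<in> matlas M. smooth_on (mdim M) (\<phi> ` U) (h \<circ> inv_into U \<phi>)}"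

definition smooth_map :: "'a mfd \<Rightarrow> 'b mfd \<Rightarrow> ('a \<Rightarrow> 'b) \<Rightarrow> bool" where
  "smooth_map M N F \<longleftrightarrow>
     continuous_map (mtop M) (mtop N) F \<and>
     (\<forall>(U, \<phi>) \<in> matlas M. \<forall>(V, \<psi>) \<in> matlas N.
        smooth_vec_on (mdim M) (mdim N) (\<phi> ` (U \<inter> F -` V)) (\<psi> \<circ> F \<circ> inv_into U \<phi>))"

text \<open>The product chart lists the \<open>m\<close> coordinates of \<open>\<phi>\<close> first, followed by those of \<open>\<psi>\<close>.\<close>

definition prod_chart ::
    "nat \<Rightarrow> ('a \<Rightarrow> nat \<Rightarrow> real) \<Rightarrow> ('b \<Rightarrow> nat \<Rightarrow> real) \<Rightarrow> 'a \<times> 'b \<Rightarrow> nat \<Rightarrow> real" where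
  "prod_chart m \<phi> \<psi> = (\<lambda>(x, y) i. if i < m then \<phi> x i else \<psi> y (i - m))"

definition prod_mfd :: "'a mfd \<Rightarrow> 'b mfd \<Rightarrow> ('a \<times> 'b) mfd" where
  "prod_mfd M N =
     \<lparr> mtop = prod_topology (mtop M) (mtop N),
       mdim = mdim M + mdim N,
       matlas = {(U \<times> V, prod_chart (mdim M) \<phi> \<psi>) | U \<phi> V \<psi>.
                   (U, \<phi>) \<in> matlas M \<and> (V, \<psi>) \<in> matlas N} \<rparr>"


section \<open>Lie groups, smooth proper actions and orbit spaces\<close>

definition lie_group :: "('g, 'z) monoid_scheme \<Rightarrow> 'g mfd \<Rightarrow> bool" where
  "lie_group G S \<longleftrightarrow>
     group G \<and> smooth_manifold S \<and> carrier G = topspace (mtop S) \<and>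
     smooth_map (prod_mfd S S) S (\<lambda>(a, b). a \<otimes>\<^bsub>G\<^esub> b) \<and>
     smooth_map S S (\<lambda>a. inv\<^bsub>G\<^esub> a)"

definition smooth_action ::
    "('g, 'z) monoid_scheme \<Rightarrow> 'g mfd \<Rightarrow> 'a mfd \<Rightarrow> ('g \<Rightarrow> 'a \<Rightarrow> 'a) \<Rightarrow> bool" where
  "smooth_action G S M \<alpha> \<longleftrightarrow>
     group_action G (topspace (mtop M)) \<alpha> \<and>
     smooth_map (prod_mfd S M) M (\<lambda>(a, x). \<alpha> a x)"

text \<open>
  The library's \<^const>\<open>proper_map\<close> (closed with compact fibres) agrees, for a continuous map into
  a locally compact Hausdorff space such as \<open>M \<times> M\<close>, with compactness of preimages of compact sets.
\<close>

definition proper_action :: "'g mfd \<Rightarrow> 'a mfd \<Rightarrow> ('g \<Rightarrow> 'a \<Rightarrow> 'a) \<Rightarrow> bool" where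
  "proper_action S M \<alpha> \<longleftrightarrow>
     proper_map (prod_topology (mtop S) (mtop M)) (prod_topology (mtop M) (mtop M))
       (\<lambda>(a, x). (x, \<alpha> a x))"

text \<open>The points of $M/G$ are the orbits, and the orbit map is \<open>orbit G \<alpha>\<close>.\<close>

definition orbit_space ::
    "('g, 'z) monoid_scheme \<Rightarrow> 'a mfd \<Rightarrow> ('g \<Rightarrow> 'a \<Rightarrow> 'a) \<Rightarrow> 'a set topology" where
  "orbit_space G M \<alpha> =
     topology (\<lambda>V. V \<subseteq> orbits G (topspace (mtop M)) \<alpha> \<and>
                   openin (mtop M) {x \<in> topspace (mtop M). orbit G \<alpha> x \<in> V})"

lemma openin_orbit_space:
  "openin (orbit_space G M \<alpha>) V \<longleftrightarrow>
     V \<subseteq> orbits G (topspace (mtop M)) \<alpha> \<and>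
     openin (mtop M) {x \<in> topspace (mtop M). orbit G \<alpha> x \<in> V}"
proof -
  let ?X = "mtop M"
  let ?pre = "\<lambda>V. {x \<in> topspace ?X. orbit G \<alpha> x \<in> V}"
  have "istopology (\<lambda>V. V \<subseteq> orbits G (topspace ?X) \<alpha> \<and> openin ?X (?pre V))"
    unfolding istopology_def
  proof (intro conjI allI impI)
    fix S T assume "S \<subseteq> orbits G (topspace ?X) \<alpha> \<and> openin ?X (?pre S)"
      and "T \<subseteq> orbits G (topspace ?X) \<alpha> \<and> openin ?X (?pre T)"
    moreover have "?pre (S \<inter> T) = ?pre S \<inter> ?pre T" by auto
    ultimately show "S \<inter> T \<subseteq> orbits G (topspace ?X) \<alpha>" "openin ?X (?pre (S \<inter> T))" by auto
  next
    fix K assume K: "\<forall>S\<in>K. S \<subseteq> orbits G (topspace ?X) \<alpha> \<and> openin ?X (?pre S)"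
    then show "\<Union>K \<subseteq> orbits G (topspace ?X) \<alpha>" by auto
    have "?pre (\<Union>K) = (\<Union>S\<in>K. ?pre S)" by auto
    with K show "openin ?X (?pre (\<Union>K))" by auto
  qed
  then show ?thesis
    by (simp add: orbit_space_def topology_inverse')
qed

lemma topspace_orbit_space [simp]:
  "topspace (orbit_space G M \<alpha>) = orbits G (topspace (mtop M)) \<alpha>"
proof
  show "topspace (orbit_space G M \<alpha>) \<subseteq> orbits G (topspace (mtop M)) \<alpha>"
    using openin_orbit_space openin_topspace by blast
  have "{x \<in> topspace (mtop M). orbit G \<alpha> x \<in> orbits G (topspace (mtop M)) \<alpha>} = topspace (mtop M)"
    by (auto simp: orbits_def)
  then have "openin (orbit_space G M \<alpha>) (orbits G (topspace (mtop M)) \<alpha>)"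
    by (simp add: openin_orbit_space)
  then show "orbits G (topspace (mtop M)) \<alpha> \<subseteq> topspace (orbit_space G M \<alpha>)"
    by (rule openin_subset)
qed

lemma quotient_map_orbit: "quotient_map (mtop M) (orbit_space G M \<alpha>) (orbit G \<alpha>)"
  by (auto simp: quotient_map_def openin_orbit_space orbits_def)

text \<open>
  Elements of $C^\infty(R)$ are represented by functions on the whole type of sets; their values
  outside the set of orbits play no role, and similarly for functions on a manifold.
\<close>

definition orbit_smooth_functions ::
    "('g, 'z) monoid_scheme \<Rightarrow> 'a mfd \<Rightarrow> ('g \<Rightarrow> 'a \<Rightarrow> 'a) \<Rightarrow> ('a set \<Rightarrow> real) set" where
  "orbit_smooth_functions G M \<alpha> = {h. h \<circ> orbit G \<alpha> \<in> smooth_functions M}"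

definition orbit_smooth_vec_functions ::
    "('g, 'z) monoid_scheme \<Rightarrow> 'a mfd \<Rightarrow> ('g \<Rightarrow> 'a \<Rightarrow> 'a) \<Rightarrow> ('a set \<Rightarrow> real ^ 'n) set" where
  "orbit_smooth_vec_functions G M \<alpha> = {g. \<forall>i. (\<lambda>y. g y $ i) \<in> orbit_smooth_functions G M \<alpha>}"

end

theory Submission
  imports Defs
begin

text \<open>
  Averaging a bump function \<open>\<phi>\<close> on \<open>M\<close> over \<open>G\<close>, i.e. \<open>h x = I (\<lambda>a. \<phi> (\<alpha> a x))\<close> for a right
  invariant Haar integral \<open>I\<close>, gives an invariant function supported in a prescribed invariant open
  set. Properness of the action puts the supports of the integrands, for \<open>x\<close> in a compact set, into
  one compact subset of \<open>G\<close>; there difference quotients converge uniformly, so positivity of \<open>I\<close>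
  alone justifies differentiation under the integral. Hence no smooth density is needed, and \<open>I\<close> is
  obtained by Weil's covering argument. Countably many such \<open>h\<close>, supported in sets on which
  \<open>f \<circ> orbit G \<alpha>\<close> oscillates by less than \<open>\<epsilon>\<close>, yield an invariant partition of unity
  and thereby \<open>g\<close>; the homotopy is the straight line.
\<close>

section \<open>Calculus with iterated partial derivatives\<close>

text \<open>Right invariance is the side that suits a left action: \<open>h (\<alpha> b x)\<close>
  is the integral of \<open>u x (a \<otimes> b)\<close> in \<open>a\<close>, where
  \<open>u x a = \<phi> (\<alpha> a x)\<close>. The obstacle is that smoothness asks for all
  iterated partial derivatives, whereas \<open>I\<close> is known only as a positive linear
  functional on compactly supported continuous functions, without a measure or dominated
  convergence. What has to survive each differentiation is therefore joint continuity in the group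
  element and the coordinates, together with a compact set of group elements off which the integrand
  vanishes for all nearby points. The tube lemma turns joint continuity into uniformity over this
  set, and a compactly supported majorant of its indicator turns uniformity into an estimate for
  \<open>I\<close>. Covering numbers are subadditive for every comparison function, but additive
  only in the limit of shrinking support; this is where left uniform continuity enters. The
  invariant open sets come from the datum itself: preimages of balls under
  \<open>f \<circ> orbit G \<alpha>\<close> are unions of orbits.\<close>

lemma Euclidean_space_eq: "Euclidean_space m = top_of_set {x. \<forall>i\<ge>m. x i = 0}"
  by (simp add: Euclidean_space_def euclidean_product_topology)

lemma openin_Euclidean_space_iff:
  "openin (Euclidean_space m) U \<longleftrightarrow> (\<exists>T. open T \<and> U = {x. \<forall>i\<ge>m. x i = 0} \<inter> T)"
  by (simp add: Euclidean_space_eq openin_open)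

lemma openin_Euclidean_spaceD: "openin (Euclidean_space m) U \<Longrightarrow> x \<in> U \<Longrightarrow> i \<ge> m \<Longrightarrow> x i = 0"
  by (auto simp: openin_Euclidean_space_iff)

lemma tendsto_fun_iff:
  fixes f :: "'a \<Rightarrow> 'i \<Rightarrow> 'b::topological_space"
  shows "(f \<longlongrightarrow> l) F \<longleftrightarrow> (\<forall>i. ((\<lambda>x. f x i) \<longlongrightarrow> l i) F)"
  using limitin_componentwise[of "\<lambda>_. euclidean" UNIV f l F]
  by (simp add: euclidean_product_topology)

text \<open>Derivatives are two-sided and see points \<open>x(i := t)\<close> on both sides of
  \<open>x i\<close>. Keeping these points in \<open>U\<close> makes derivatives depend only on the
  values on \<open>U\<close>.\<close>

lemma eventually_coord_update:
  assumes "openin (Euclidean_space m) U" "x \<in> U" "i < m"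
  shows "eventually (\<lambda>t. x(i := t) \<in> U) (nhds (x i))"
proof -
  obtain T where T: "open T" "U = {x. \<forall>i\<ge>m. x i = 0} \<inter> T"
    using assms openin_Euclidean_space_iff by auto
  have "((\<lambda>t. x(i := t)) \<longlongrightarrow> x) (nhds (x i))"
    unfolding tendsto_fun_iff
  proof
    fix j show "((\<lambda>t. (x(i := t)) j) \<longlongrightarrow> x j) (nhds (x i))"
      by (cases "j = i") (simp_all add: filterlim_ident)
  qed
  then have "eventually (\<lambda>t. x(i := t) \<in> T) (nhds (x i))"
    using T assms(2) topological_tendstoD by blast
  then show ?thesis
    by (rule eventually_mono) (use T assms in auto)
qed

section \<open>Restriction, congruence and locality of C^k functions\<close>

lemma Ck_on_imp_continuous_on: "Ck_on m k U f \<Longrightarrow> continuous_on U f"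
  by (cases k) auto

lemma Ck_on_SucE:
  assumes "Ck_on m (Suc k) U f" "i < m"
  obtains f' where "\<And>x. x \<in> U \<Longrightarrow> ((\<lambda>t. f (x(i := t))) has_real_derivative f' x) (at (x i))"
    "Ck_on m k U f'"
  using assms unfolding Ck_on.simps by blast

lemma Ck_on_SucI:
  assumes "continuous_on U f"
    and "\<And>i. i < m \<Longrightarrow> \<exists>f'. (\<forall>x\<in>U. ((\<lambda>t. f (x(i := t))) has_real_derivative f' x) (at (x i))) \<and> Ck_on m k U f'"
  shows "Ck_on m (Suc k) U f"
  using assms by simp

lemma Ck_on_subset: "Ck_on m k U f \<Longrightarrow> V \<subseteq> U \<Longrightarrow> Ck_on m k V f"
proof (induction k arbitrary: f)
  case 0
  then show ?case using continuous_on_subset by auto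
next
  case (Suc k)
  show ?case unfolding Ck_on.simps
  proof (intro conjI allI impI)
    show "continuous_on V f" using Suc.prems continuous_on_subset by auto
    fix i assume "i < m"
    then obtain f' where "\<forall>x\<in>U. ((\<lambda>t. f (x(i := t))) has_real_derivative f' x) (at (x i))" "Ck_on m k U f'"
      using Suc.prems by auto
    then show "\<exists>f'. (\<forall>x\<in>V. ((\<lambda>t. f (x(i := t))) has_real_derivative f' x) (at (x i))) \<and> Ck_on m k V f'"
      using Suc.IH Suc.prems(2) by blast
  qed
qed

lemma Ck_on_SucD: "Ck_on m (Suc k) U f \<Longrightarrow> Ck_on m k U f"
proof (induction k arbitrary: f)
  case (Suc k)
  show ?case
  proof (rule Ck_on_SucI)
    show "continuous_on U f" using Suc.prems by (rule Ck_on_imp_continuous_on)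
    fix i assume "i < m"
    then obtain f' where "\<And>x. x \<in> U \<Longrightarrow> ((\<lambda>t. f (x(i := t))) has_real_derivative f' x) (at (x i))"
      "Ck_on m (Suc k) U f'"
      using Ck_on_SucE[OF Suc.prems] by blast
    then show "\<exists>f'. (\<forall>x\<in>U. ((\<lambda>t. f (x(i := t))) has_real_derivative f' x) (at (x i))) \<and> Ck_on m k U f'"
      using Suc.IH by blast
  qed
qed auto

lemma Ck_on_cong:
  assumes U: "openin (Euclidean_space m) U" and "\<And>x. x \<in> U \<Longrightarrow> f x = g x" and "Ck_on m k U f"
  shows "Ck_on m k U g"
proof (cases k)
  case 0
  then show ?thesis using assms(2,3) continuous_on_cong by force
next
  case (Suc k')
  have "continuous_on U g"
    using assms(2,3) Ck_on_imp_continuous_on continuous_on_cong by metis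
  moreover have "((\<lambda>t. g (x(i := t))) has_real_derivative d) (at (x i))"
    if "x \<in> U" "i < m" "((\<lambda>t. f (x(i := t))) has_real_derivative d) (at (x i))" for x i d
  proof -
    have "eventually (\<lambda>t. f (x(i := t)) = g (x(i := t))) (nhds (x i))"
      using eventually_coord_update[OF U that(1,2)] by (rule eventually_mono) (use assms(2) in auto)
    from DERIV_cong_ev[OF refl this refl] show ?thesis using that(3) by simp
  qed
  ultimately show ?thesis
    using assms(3) unfolding Suc Ck_on.simps by meson
qed

text \<open>Arbitrary where the partial derivative does not exist.\<close>

definition pd :: "nat \<Rightarrow> ((nat \<Rightarrow> real) \<Rightarrow> real) \<Rightarrow> (nat \<Rightarrow> real) \<Rightarrow> real" where
  "pd i f x = deriv (\<lambda>t. f (x(i := t))) (x i)"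

lemma pd_eqI: "((\<lambda>t. f (x(i := t))) has_real_derivative d) (at (x i)) \<Longrightarrow> pd i f x = d"
  unfolding pd_def by (rule DERIV_imp_deriv)

lemma pd_cong:
  assumes "openin (Euclidean_space m) U" "\<And>x. x \<in> U \<Longrightarrow> f x = g x" "x \<in> U" "i < m"
  shows "pd i f x = pd i g x"
proof -
  have "eventually (\<lambda>t. f (x(i := t)) = g (x(i := t))) (nhds (x i))"
    using eventually_coord_update[OF assms(1,3,4)] by (rule eventually_mono) (use assms(2) in auto)
  then show ?thesis unfolding pd_def by (rule deriv_cong_ev) simp
qed

text \<open>The existential derivative is made canonical. With \<open>pd\<close> in place of a
  witness, derivatives found on different neighbourhoods, or for different parameters, are the same
  function and can be glued.\<close>

lemma Ck_on_Suc_pd: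
  assumes U: "openin (Euclidean_space m) U"
  shows "Ck_on m (Suc k) U f \<longleftrightarrow> continuous_on U f \<and>
    (\<forall>i<m. (\<forall>x\<in>U. ((\<lambda>t. f (x(i := t))) has_real_derivative pd i f x) (at (x i))) \<and> Ck_on m k U (pd i f))"
    (is "?L \<longleftrightarrow> ?R")
proof
  assume L: ?L
  show ?R
  proof (intro conjI allI impI)
    show "continuous_on U f" using L by simp
    fix i assume "i < m"
    then obtain f' where f': "\<forall>x\<in>U. ((\<lambda>t. f (x(i := t))) has_real_derivative f' x) (at (x i))" "Ck_on m k U f'"
      using L by auto
    then have e: "\<And>x. x \<in> U \<Longrightarrow> f' x = pd i f x" using pd_eqI by metis
    then show "\<forall>x\<in>U. ((\<lambda>t. f (x(i := t))) has_real_derivative pd i f x) (at (x i))"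
      using f' by auto
    show "Ck_on m k U (pd i f)" using Ck_on_cong[OF U e f'(2)] .
  qed
qed auto

lemma Ck_on_local:
  assumes "openin (Euclidean_space m) U"
    and "\<And>x. x \<in> U \<Longrightarrow> \<exists>N. openin (Euclidean_space m) N \<and> x \<in> N \<and> N \<subseteq> U \<and> Ck_on m k N f"
  shows "Ck_on m k U f"
  using assms(2)
proof (induction k arbitrary: f)
  case 0
  show ?case unfolding Ck_on.simps continuous_on_eq_continuous_within
  proof
    fix x assume "x \<in> U"
    then obtain N where N: "openin (Euclidean_space m) N" "x \<in> N" "N \<subseteq> U" "continuous_on N f"
      using 0[OF \<open>x \<in> U\<close>] unfolding Ck_on.simps by blast
    obtain T where T: "open T" "N = {x. \<forall>i\<ge>m. x i = 0} \<inter> T"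
      using N(1) openin_Euclidean_space_iff by auto
    \<comment> \<open>\<open>N\<close> is cut out of \<open>U\<close> by the open set
      \<open>T\<close>, so both sets induce the same filter at \<open>x\<close>.\<close>
    have "U \<inter> T - {x} = N \<inter> T - {x}"
    proof -
      have "\<And>y. y \<in> U \<Longrightarrow> \<forall>i\<ge>m. y i = 0" using openin_Euclidean_spaceD[OF assms(1)] by blast
      then show ?thesis using T(2) N(3) by auto
    qed
    then have "at x within U = at x within N"
      using at_within_nhd[of x T U N] T N(2) by auto
    then show "continuous (at x within U) f"
      using N continuous_on_eq_continuous_within by (metis continuous_within)
  qed
next
  case (Suc k)
  \<comment> \<open>The induction hypothesis at lower order supplies the continuity of
    \<open>f\<close>.\<close>
  have "Ck_on m k U f"
  proof (rule Suc.IH)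
    fix x assume "x \<in> U"
    then obtain N where N: "openin (Euclidean_space m) N" "x \<in> N" "N \<subseteq> U" "Ck_on m (Suc k) N f"
      using Suc.prems[of x] by blast
    then show "\<exists>N. openin (Euclidean_space m) N \<and> x \<in> N \<and> N \<subseteq> U \<and> Ck_on m k N f"
      using Ck_on_SucD[OF N(4)] by blast
  qed
  then have "continuous_on U f"
    by (rule Ck_on_imp_continuous_on)
  moreover have "((\<lambda>t. f (x(i := t))) has_real_derivative pd i f x) (at (x i))" if "i < m" "x \<in> U" for i x
  proof -
    obtain N where "openin (Euclidean_space m) N" "x \<in> N" "Ck_on m (Suc k) N f"
      using Suc.prems[OF \<open>x \<in> U\<close>] by blast
    then show ?thesis using Ck_on_Suc_pd[of m N k f] \<open>i < m\<close> by blast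
  qed
  moreover have "Ck_on m k U (pd i f)" if "i < m" for i
  proof (rule Suc.IH)
    fix x assume "x \<in> U"
    then obtain N where "openin (Euclidean_space m) N" "x \<in> N" "N \<subseteq> U" "Ck_on m (Suc k) N f"
      using Suc.prems[of x] by blast
    then show "\<exists>N. openin (Euclidean_space m) N \<and> x \<in> N \<and> N \<subseteq> U \<and> Ck_on m k N (pd i f)"
      using Ck_on_Suc_pd[of m N k f] that by blast
  qed
  ultimately show ?case using Ck_on_Suc_pd[OF assms(1)] by auto
qed

section \<open>Algebra of C^k functions\<close>

lemma Ck_on_const [simp]: "Ck_on m k U (\<lambda>x. c)"
proof (induction k arbitrary: c)
  case (Suc k)
  have "\<exists>f'. (\<forall>x\<in>U. ((\<lambda>t. c) has_real_derivative f' x) (at (x i))) \<and> Ck_on m k U f'" for i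
    by (intro exI[of _ "\<lambda>x. 0"] conjI ballI Suc.IH) auto
  then show ?case by auto
qed auto

lemma Ck_on_coord [simp]: "Ck_on m k U (\<lambda>x. x j)"
proof (cases k)
  case (Suc k)
  have "\<exists>f'. (\<forall>x\<in>U. ((\<lambda>t. (x(i := t)) j) has_real_derivative f' x) (at (x i))) \<and> Ck_on m k U f'" for i
    by (intro exI[of _ "\<lambda>x. if i = j then 1 else 0"] conjI ballI Ck_on_const) auto
  then show ?thesis unfolding Suc by (auto intro: continuous_on_product_coordinates continuous_on_subset)
qed (auto intro: continuous_on_product_coordinates continuous_on_subset)

lemma Ck_on_add: "Ck_on m k U f \<Longrightarrow> Ck_on m k U g \<Longrightarrow> Ck_on m k U (\<lambda>x. f x + g x)"
proof (induction k arbitrary: f g)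
  case (Suc k)
  have "\<exists>h. (\<forall>x\<in>U. ((\<lambda>t. f (x(i := t)) + g (x(i := t))) has_real_derivative h x) (at (x i))) \<and> Ck_on m k U h"
    if i: "i < m" for i
  proof -
    obtain f' where "\<And>x. x \<in> U \<Longrightarrow> ((\<lambda>t. f (x(i := t))) has_real_derivative f' x) (at (x i))" "Ck_on m k U f'"
      using Ck_on_SucE[OF Suc.prems(1) i] by blast
    moreover obtain g' where
      "\<And>x. x \<in> U \<Longrightarrow> ((\<lambda>t. g (x(i := t))) has_real_derivative g' x) (at (x i))" "Ck_on m k U g'"
      using Ck_on_SucE[OF Suc.prems(2) i] by blast
    ultimately show ?thesis
      by (intro exI[of _ "\<lambda>x. f' x + g' x"] conjI ballI Suc.IH DERIV_add) auto
  qed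
  then show ?case
    using Suc.prems[THEN Ck_on_imp_continuous_on] by (intro Ck_on_SucI continuous_on_add)
qed (auto intro: continuous_on_add)

lemma Ck_on_mult: "Ck_on m k U f \<Longrightarrow> Ck_on m k U g \<Longrightarrow> Ck_on m k U (\<lambda>x. f x * g x)"
proof (induction k arbitrary: f g)
  case (Suc k)
  have "\<exists>h. (\<forall>x\<in>U. ((\<lambda>t. f (x(i := t)) * g (x(i := t))) has_real_derivative h x) (at (x i))) \<and> Ck_on m k U h"
    if i: "i < m" for i
  proof -
    obtain f' where f': "\<And>x. x \<in> U \<Longrightarrow> ((\<lambda>t. f (x(i := t))) has_real_derivative f' x) (at (x i))" "Ck_on m k U f'"
      using Ck_on_SucE[OF Suc.prems(1) i] by blast
    obtain g' where g': "\<And>x. x \<in> U \<Longrightarrow> ((\<lambda>t. g (x(i := t))) has_real_derivative g' x) (at (x i))" "Ck_on m k U g'"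
      using Ck_on_SucE[OF Suc.prems(2) i] by blast
    have "((\<lambda>t. f (x(i := t)) * g (x(i := t))) has_real_derivative f' x * g x + g' x * f x) (at (x i))"
      if "x \<in> U" for x
      using DERIV_mult[OF f'(1)[OF that] g'(1)[OF that]] by simp
    then show ?thesis
      using Suc.prems f' g'
      by (intro exI[of _ "\<lambda>x. f' x * g x + g' x * f x"] conjI ballI Suc.IH Ck_on_add)
         (auto simp del: Ck_on.simps intro: Ck_on_SucD)
  qed
  then show ?case
    using Suc.prems[THEN Ck_on_imp_continuous_on] by (intro Ck_on_SucI continuous_on_mult)
qed (auto intro: continuous_on_mult)

lemma Ck_on_sum: "(\<And>j. j \<in> J \<Longrightarrow> Ck_on m k U (f j)) \<Longrightarrow> Ck_on m k U (\<lambda>x. \<Sum>j\<in>J. f j x)"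
  by (induction J rule: infinite_finite_induct) (auto intro: Ck_on_add)

lemma Ck_on_prod: "(\<And>j. j \<in> J \<Longrightarrow> Ck_on m k U (f j)) \<Longrightarrow> Ck_on m k U (\<lambda>x. \<Prod>j\<in>J. f j x)"
  by (induction J rule: infinite_finite_induct) (auto intro: Ck_on_mult)

text \<open>A one-variable smooth function is given here by the sequence \<open>e\<close> of its derivatives.\<close>

lemma Ck_on_compose_deriv_seq:
  assumes e: "\<And>n s. s \<in> D \<Longrightarrow> (e n has_real_derivative e (Suc n) s) (at s)"
    and "f ` U \<subseteq> D" and "Ck_on m k U f"
  shows "Ck_on m k U (\<lambda>x. e n (f x))"
  using assms(3)
proof (induction k arbitrary: n)
  case 0
  have "continuous_on D (e n)"
    using e DERIV_isCont by (meson continuous_at_imp_continuous_on)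
  then show ?case using 0 assms(2) continuous_on_compose2 by fastforce
next
  case (Suc k)
  have "continuous_on D (e n)"
    using e DERIV_isCont by (meson continuous_at_imp_continuous_on)
  then have "continuous_on U (\<lambda>x. e n (f x))"
    using Suc.prems assms(2) continuous_on_compose2 by fastforce
  moreover have "\<exists>h. (\<forall>x\<in>U. ((\<lambda>t. e n (f (x(i := t)))) has_real_derivative h x) (at (x i))) \<and> Ck_on m k U h"
    if i: "i < m" for i
  proof -
    obtain f' where *: "\<And>x. x \<in> U \<Longrightarrow> ((\<lambda>t. f (x(i := t))) has_real_derivative f' x) (at (x i))" "Ck_on m k U f'"
      using Ck_on_SucE[OF Suc.prems i] by blast
    have "((\<lambda>t. e n (f (x(i := t)))) has_real_derivative e (Suc n) (f x) * f' x) (at (x i))"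
      if "x \<in> U" for x
      by (rule DERIV_chain2[where g = "\<lambda>t. f (x(i := t))"]) (use e assms(2) * that in auto)
    then show ?thesis
      using Suc.prems Suc.IH *
      by (intro exI[of _ "\<lambda>x. e (Suc n) (f x) * f' x"] conjI ballI Ck_on_mult)
         (auto simp del: Ck_on.simps intro: Ck_on_SucD)
  qed
  ultimately show ?case by (intro Ck_on_SucI)
qed

lemma Ck_on_inverse:
  assumes "Ck_on m k U f" "\<And>x. x \<in> U \<Longrightarrow> f x \<noteq> 0"
  shows "Ck_on m k U (\<lambda>x. inverse (f x))"
proof -
  \<comment> \<open>The derivative sequence of \<open>1/s\<close> on the punctured line.\<close>
  define e :: "nat \<Rightarrow> real \<Rightarrow> real" where "e = (\<lambda>n s. (-1)^n * fact n * inverse s ^ Suc n)"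
  have "(e n has_real_derivative e (Suc n) s) (at s)" if "s \<in> -{0}" for n s
  proof -
    have "((\<lambda>s. inverse s ^ Suc n) has_real_derivative
        real (Suc n) * (- (inverse s ^ Suc (Suc 0)) * inverse s ^ (Suc n - Suc 0))) (at s)"
      by (rule DERIV_power[OF DERIV_inverse]) (use that in auto)
    from DERIV_cmult[OF this, of "(-1)^n * fact n"] show ?thesis
      by (simp add: e_def mult_ac)
  qed
  then have "Ck_on m k U (\<lambda>x. e 0 (f x))"
    by (rule Ck_on_compose_deriv_seq[where D = "-{0}"]) (use assms in auto)
  then show ?thesis by (simp add: e_def)
qed

section \<open>The chain rule in several variables\<close>

lemma MVT_between:
  fixes f :: "real \<Rightarrow> real"
  assumes "\<And>s. \<bar>s - x\<bar> \<le> \<bar>t - x\<bar> \<Longrightarrow> (f has_real_derivative f' s) (at s)"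
  obtains s where "\<bar>s - x\<bar> \<le> \<bar>t - x\<bar>" "f t - f x = f' s * (t - x)"
proof -
  \<comment> \<open>\<open>MVT2\<close> wants ordered end points, while the increments in the chain
    rule may have either sign or vanish; in the last case \<open>s = x\<close> serves.\<close>
  consider "t = x" | "t > x" | "t < x" by linarith
  then show ?thesis
  proof cases
    case 1
    then show ?thesis using that[of x] by simp
  next
    case 2
    obtain s where "s > x" "s < t" "f t - f x = (t - x) * f' s"
      using MVT2[OF 2, of f f'] assms by auto
    then show ?thesis using that[of s] by (simp add: mult.commute)
  next
    case 3
    obtain s where "s < x" "s > t" "f x - f t = (x - t) * f' s"
      using MVT2[OF 3, of f f'] assms by auto
    then show ?thesis using that[of s] by (simp add: algebra_simps)
  qed
qed

text \<open>Continuous partial derivatives suffice, without a total derivative: pass from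
  \<open>c t0\<close> to \<open>c t\<close> by changing one coordinate at a time. Each change is a
  one-variable increment, which the mean value theorem writes as a partial derivative at a nearby
  point times \<open>c t j - p j\<close>; continuity of that partial derivative gives the
  limit.\<close>

lemma has_derivative_along_curve:
  assumes V: "openin (Euclidean_space n) V"
    and f': "\<And>j x. j < n \<Longrightarrow> x \<in> V \<Longrightarrow> ((\<lambda>t. f (x(j := t))) has_real_derivative f' j x) (at (x j))"
    and cont: "\<And>j. j < n \<Longrightarrow> continuous_on V (f' j)"
    and c: "\<And>j. j < n \<Longrightarrow> ((\<lambda>t. c t j) has_real_derivative c' j) (at t0)"
    and cV: "eventually (\<lambda>t. c t \<in> V) (nhds t0)"
  shows "((\<lambda>t. f (c t)) has_real_derivative (\<Sum>j<n. f' j (c t0) * c' j)) (at t0)"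
proof -
  define p where "p = c t0"
  have pV: "p \<in> V" using cV eventually_nhds_x_imp_x p_def by fastforce
  obtain T where T: "open T" "V = {x. \<forall>i\<ge>n. x i = 0} \<inter> T"
    using V openin_Euclidean_space_iff by auto
  \<comment> \<open>The first \<open>j\<close> coordinates have already moved along the curve, the
    others still sit at \<open>p\<close>; the induction is on \<open>j\<close>.\<close>
  define z where "z = (\<lambda>j t i. if i < j then c t i else p i)"
  have ct: "((\<lambda>t. c t i) \<longlongrightarrow> p i) (at t0)" if "i < n" for i
    using DERIV_isCont[OF c[OF that]] by (simp add: isCont_def p_def)
  have "((\<lambda>t. f (z j t)) has_real_derivative (\<Sum>i<j. f' i p * c' i)) (at t0)" if "j \<le> n" for j
    using that
  proof (induction j)
    case 0
    then show ?case by (simp add: z_def)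
  next
    case (Suc j)
    then have j: "j < n" by simp
    define D where "D = (\<lambda>t. f (z (Suc j) t) - f (z j t))"
    have zt: "((\<lambda>t. z j t i) \<longlongrightarrow> p i) (at t0)" for i
      using ct[of i] j by (cases "i < j") (simp_all add: z_def)
    have zz: "z (Suc j) t = (z j t)(j := c t j)" for t
      by (auto simp: z_def fun_eq_iff less_Suc_eq)
    have zj: "z j t j = p j" for t by (simp add: z_def)
    have "z i t0 = p" for i by (auto simp: z_def p_def)
    then have D0: "D t0 = 0" by (simp add: D_def)
    \<comment> \<open>The whole segment along which coordinate \<open>j\<close> changes must lie in
      \<open>V\<close> before the mean value theorem applies; this holds for \<open>t\<close> close
      to \<open>t0\<close>.\<close>
    have ev: "eventually (\<lambda>t. \<exists>s. \<bar>s - p j\<bar> \<le> \<bar>c t j - p j\<bar> \<and> (z j t)(j := s) \<in> V \<and>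
            D t = f' j ((z j t)(j := s)) * (c t j - p j)) (at t0)"
    proof -
      have "((\<lambda>(t,s). (z j t)(j := s)) \<longlongrightarrow> p) (at t0 \<times>\<^sub>F nhds (p j))"
        unfolding tendsto_fun_iff
      proof
        fix i
        show "((\<lambda>x. (case x of (t, s) \<Rightarrow> (z j t)(j := s)) i) \<longlongrightarrow> p i) (at t0 \<times>\<^sub>F nhds (p j))"
        proof (cases "i = j")
          case True
          then show ?thesis by (simp add: case_prod_unfold filterlim_snd)
        next
          case False
          then show ?thesis
            using filterlim_compose[OF zt[of i] filterlim_fst] by (simp add: case_prod_unfold)
        qed
      qed
      then have "eventually (\<lambda>(t,s). (z j t)(j := s) \<in> T) (at t0 \<times>\<^sub>F nhds (p j))"
        using topological_tendstoD[OF _ T(1)] pV T(2) by (fastforce simp: case_prod_unfold)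
      then obtain P Q where P: "eventually P (at t0)" and Q: "eventually Q (nhds (p j))"
        and PQ: "\<And>t s. P t \<Longrightarrow> Q s \<Longrightarrow> (z j t)(j := s) \<in> T"
        by (auto simp: eventually_prod_filter)
      obtain d where d: "d > 0" "\<And>s. \<bar>s - p j\<bar> < d \<Longrightarrow> Q s"
        using Q by (auto simp: eventually_nhds_metric dist_real_def)
      have "eventually (\<lambda>t. \<bar>c t j - p j\<bar> < d) (at t0)"
        using tendstoD[OF ct[OF j] d(1)] by (simp add: dist_real_def)
      with P show ?thesis
      proof eventually_elim
        case (elim t)
        have inV: "(z j t)(j := s) \<in> V" if "\<bar>s - p j\<bar> \<le> \<bar>c t j - p j\<bar>" for s
        proof -
          have "(z j t)(j := s) \<in> T" using PQ elim d that by auto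
          moreover have "p i = 0" if "i \<ge> n" for i using that pV T by auto
          ultimately show ?thesis using T(2) j by (auto simp: z_def)
        qed
        have der: "((\<lambda>s. f ((z j t)(j := s))) has_real_derivative f' j ((z j t)(j := s))) (at s)"
          if "\<bar>s - p j\<bar> \<le> \<bar>c t j - p j\<bar>" for s
          using f'[OF j inV[OF that]] by simp
        have upd: "(z j t)(j := p j) = z j t" using zj by (metis fun_upd_triv)
        obtain s where "\<bar>s - p j\<bar> \<le> \<bar>c t j - p j\<bar>"
          "f ((z j t)(j := c t j)) - f ((z j t)(j := p j)) = f' j ((z j t)(j := s)) * (c t j - p j)"
          using MVT_between[of "p j" "c t j" "\<lambda>s. f ((z j t)(j := s))" "\<lambda>s. f' j ((z j t)(j := s))"] der by blast
        then show ?case using upd inV by (intro exI[of _ s]) (simp add: D_def zz)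
      qed
    qed
    \<comment> \<open>A mean value point chosen for each \<open>t\<close>; the bound by
      \<open>\<bar>c t j - p j\<bar>\<close> alone forces it to tend to \<open>p j\<close>.\<close>
    define s where "s = (\<lambda>t. SOME s. \<bar>s - p j\<bar> \<le> \<bar>c t j - p j\<bar> \<and> (z j t)(j := s) \<in> V \<and>
            D t = f' j ((z j t)(j := s)) * (c t j - p j))"
    have s: "eventually (\<lambda>t. \<bar>s t - p j\<bar> \<le> \<bar>c t j - p j\<bar> \<and> (z j t)(j := s t) \<in> V \<and>
            D t = f' j ((z j t)(j := s t)) * (c t j - p j)) (at t0)"
      using ev unfolding s_def by (rule eventually_mono) (rule someI_ex)
    have "((\<lambda>t. \<bar>c t j - p j\<bar>) \<longlongrightarrow> 0) (at t0)"
      using tendsto_rabs_zero LIM_zero ct[OF j] by blast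
    then have "((\<lambda>t. s t - p j) \<longlongrightarrow> 0) (at t0)"
      by (rule Lim_null_comparison[rotated]) (use s in \<open>auto elim: eventually_mono\<close>)
    then have st: "(s \<longlongrightarrow> p j) (at t0)" using LIM_zero_cancel by blast
    have "((\<lambda>t. (z j t)(j := s t)) \<longlongrightarrow> p) (at t0)"
      unfolding tendsto_fun_iff
    proof
      fix i show "((\<lambda>t. ((z j t)(j := s t)) i) \<longlongrightarrow> p i) (at t0)"
        using zt[of i] st by (cases "i = j") simp_all
    qed
    then have f'lim: "((\<lambda>t. f' j ((z j t)(j := s t))) \<longlongrightarrow> f' j p) (at t0)"
      by (rule continuous_on_tendsto_compose[OF cont[OF j]]) (use pV s in \<open>auto elim: eventually_mono\<close>)
    have "((\<lambda>t. (c t j - p j) / (t - t0)) \<longlongrightarrow> c' j) (at t0)"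
      using c[OF j] by (simp add: has_field_derivative_iff p_def)
    then have "((\<lambda>t. f' j ((z j t)(j := s t)) * ((c t j - p j) / (t - t0))) \<longlongrightarrow> f' j p * c' j) (at t0)"
      using f'lim tendsto_mult by blast
    then have "((\<lambda>t. (D t - D t0) / (t - t0)) \<longlongrightarrow> f' j p * c' j) (at t0)"
      by (rule Lim_transform_eventually) (use s D0 in \<open>auto elim!: eventually_mono\<close>)
    then have "(D has_real_derivative f' j p * c' j) (at t0)"
      by (simp add: has_field_derivative_iff)
    then have "((\<lambda>t. f (z j t) + D t) has_real_derivative (\<Sum>i<j. f' i p * c' i) + f' j p * c' j) (at t0)"
      using Suc.IH j by (intro DERIV_add) auto
    then show ?case by (simp add: D_def)
  qed
  from this[of n] have *: "((\<lambda>t. f (z n t)) has_real_derivative (\<Sum>i<n. f' i p * c' i)) (at t0)" by simp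
  \<comment> \<open>\<open>c t\<close> and \<open>z n t\<close> agree in the coordinates below
    \<open>n\<close>; the remaining ones vanish because both \<open>c t\<close> and \<open>p\<close>
    lie in \<open>V\<close>.\<close>
  have "eventually (\<lambda>t. f (z n t) = f (c t)) (nhds t0)"
    using cV
  proof eventually_elim
    case (elim t)
    have "z n t = c t"
      using openin_Euclidean_spaceD[OF V elim] openin_Euclidean_spaceD[OF V pV]
      by (auto simp: z_def fun_eq_iff)
    then show ?case by simp
  qed
  from DERIV_cong_ev[OF refl this refl] * show ?thesis by (simp add: p_def)
qed

text \<open>Generalising over \<open>f\<close> lets the induction hypothesis treat
  \<open>pd j f\<close> composed with \<open>F\<close>, the factor that the chain rule leaves at one
  order less.\<close>

lemma Ck_on_compose:
  assumes U: "openin (Euclidean_space m) U" and V: "openin (Euclidean_space n) V"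
    and "\<And>j. j < n \<Longrightarrow> Ck_on m k U (\<lambda>x. F x j)" and FV: "\<And>x. x \<in> U \<Longrightarrow> F x \<in> V"
    and "Ck_on n k V f"
  shows "Ck_on m k U (\<lambda>x. f (F x))"
  using assms(3,5)
proof (induction k arbitrary: f)
  case (0 f)
  \<comment> \<open>Continuity into the function space involves all coordinates; those from
    \<open>n\<close> on are zero since \<open>F x\<close> lies in \<open>V\<close>.\<close>
  have "continuous_on U (\<lambda>x. F x j)" for j
  proof (cases "j < n")
    case False
    then have "\<And>x. x \<in> U \<Longrightarrow> F x j = 0" using FV openin_Euclidean_spaceD[OF V] by simp
    then show ?thesis using continuous_on_cong[of U U "\<lambda>x. F x j" "\<lambda>x. 0"] by auto
  qed (use 0 in auto)
  then have "continuous_on U F" by (rule continuous_on_coordinatewise_then_product)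
  then show ?case using 0 FV continuous_on_compose2 by (metis Ck_on.simps(1) image_subsetI)
next
  case (Suc k)
  have "Ck_on m k U (\<lambda>x. f (F x))"
    using Ck_on_SucD[OF Suc.prems(1)] Ck_on_SucD[OF Suc.prems(2)] by (rule Suc.IH)
  then have "continuous_on U (\<lambda>x. f (F x))" by (rule Ck_on_imp_continuous_on)
  moreover have "\<exists>h. (\<forall>x\<in>U. ((\<lambda>t. f (F (x(i := t)))) has_real_derivative h x) (at (x i))) \<and> Ck_on m k U h"
    if "i < m" for i
  proof -
    note pf = Ck_on_Suc_pd[OF V, THEN iffD1, OF Suc.prems(2)]
    note pF = Ck_on_Suc_pd[OF U, THEN iffD1, OF Suc.prems(1)]
    let ?h = "\<lambda>x. \<Sum>j<n. pd j f (F x) * pd i (\<lambda>x. F x j) x"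
    have "((\<lambda>t. f (F (x(i := t)))) has_real_derivative ?h x) (at (x i))" if "x \<in> U" for x
    proof -
      have "((\<lambda>t. f (F (x(i := t)))) has_real_derivative
          (\<Sum>j<n. pd j f (F (x(i := x i))) * pd i (\<lambda>x. F x j) x)) (at (x i))"
      proof (rule has_derivative_along_curve[OF V])
        show "((\<lambda>t. f (y(j := t))) has_real_derivative pd j f y) (at (y j))" if "j < n" "y \<in> V" for j y
          using pf that by blast
        show "continuous_on V (pd j f)" if "j < n" for j
          using pf that Ck_on_imp_continuous_on by blast
        show "((\<lambda>t. F (x(i := t)) j) has_real_derivative pd i (\<lambda>x. F x j) x) (at (x i))" if "j < n" for j
          using pF that \<open>i < m\<close> \<open>x \<in> U\<close> by blast
        show "eventually (\<lambda>t. F (x(i := t)) \<in> V) (nhds (x i))"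
          using eventually_coord_update[OF U that \<open>i < m\<close>] by (rule eventually_mono) (rule FV)
      qed
      then show ?thesis by simp
    qed
    moreover have "Ck_on m k U ?h"
    proof (rule Ck_on_sum, rule Ck_on_mult)
      fix j assume "j \<in> {..<n}"
      then have j: "j < n" by simp
      show "Ck_on m k U (pd i (\<lambda>x. F x j))" using pF j \<open>i < m\<close> by blast
      show "Ck_on m k U (\<lambda>x. pd j f (F x))"
      proof (rule Suc.IH)
        show "Ck_on n k V (pd j f)" using pf j by blast
        fix j' assume "j' < n"
        then show "Ck_on m k U (\<lambda>x. F x j')" by (rule Ck_on_SucD[OF Suc.prems(1)])
      qed
    qed
    ultimately show ?thesis by (intro exI[of _ ?h]) simp
  qed
  ultimately show ?case by (intro Ck_on_SucI)
qed


text \<open>\<open>flat n\<close> is the \<open>n\<close>-th derivative of the function $s \mapsto e^{-1/s}$, extended by \<open>0\<close> to $s \le 0$.\<close>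

fun flat_poly :: "nat \<Rightarrow> real poly" where
  "flat_poly 0 = 1"
| "flat_poly (Suc n) = [:0, 0, 1:] * (flat_poly n - pderiv (flat_poly n))"

definition flat :: "nat \<Rightarrow> real \<Rightarrow> real" where
  "flat n s = (if s \<le> 0 then 0 else poly (flat_poly n) (1 / s) * exp (- (1 / s)))"

section \<open>Derivatives of the flat function, also at the origin\<close>

lemma poly_times_exp_minus_tendsto_0:
  fixes p :: "real poly"
  shows "((\<lambda>x. poly p x * exp (- x)) \<longlongrightarrow> 0) at_top"
proof -
  have "((\<lambda>x. \<Sum>i\<le>degree p. coeff p i * (x ^ i / exp x)) \<longlongrightarrow> (\<Sum>i\<le>degree p. coeff p i * 0)) at_top"
    by (intro tendsto_sum tendsto_mult tendsto_const tendsto_power_div_exp_0)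
  then show ?thesis
    by (simp add: poly_altdef sum_distrib_right exp_minus divide_inverse mult.assoc)
qed

text \<open>For \<open>s > 0\<close> the derivative of \<open>p(1/s) exp(-1/s)\<close> is
  \<open>(1/s^2) (p - p')(1/s) exp(-1/s)\<close>, which explains the recursion of
  \<open>flat_poly\<close>. At \<open>0\<close> exponential decay beats every polynomial in
  \<open>1/s\<close>.\<close>

lemma flat_has_derivative: "(flat n has_real_derivative flat (Suc n) s) (at s)"
proof -
  consider "s < 0" | "s > 0" | "s = 0" by linarith
  then show ?thesis
  proof cases
    case 1
    have "eventually (\<lambda>t. t < 0) (nhds s)" using eventually_nhds_in_open[of "{..<0}" s] 1 by simp
    then have "eventually (\<lambda>t. flat n t = 0) (nhds s)" by (rule eventually_mono) (simp add: flat_def)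
    then have "(flat n has_real_derivative 0) (at s)"
      using DERIV_cong_ev[OF refl _ refl, of "flat n" "\<lambda>_. 0" s 0] by simp
    then show ?thesis using 1 by (simp add: flat_def)
  next
    case 2
    have "eventually (\<lambda>t. t > 0) (nhds s)" using eventually_nhds_in_open[of "{0<..}" s] 2 by simp
    then have ev: "eventually (\<lambda>t. flat n t = poly (flat_poly n) (1 / t) * exp (- (1 / t))) (nhds s)"
      by (rule eventually_mono) (simp add: flat_def)
    have d: "((\<lambda>t. 1 / t) has_real_derivative - (1 / s\<^sup>2)) (at s)"
      using 2 by (auto intro!: derivative_eq_intros simp: power2_eq_square)
    have dp: "((\<lambda>t. poly (flat_poly n) (1 / t)) has_real_derivative poly (pderiv (flat_poly n)) (1 / s) * - (1 / s\<^sup>2)) (at s)"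
      by (rule DERIV_chain2[OF poly_DERIV d])
    have de: "((\<lambda>t. exp (- (1 / t))) has_real_derivative exp (- (1 / s)) * - (- (1 / s\<^sup>2))) (at s)"
      by (rule DERIV_chain2[OF DERIV_exp DERIV_minus[OF d]])
    have "((\<lambda>t. poly (flat_poly n) (1 / t) * exp (- (1 / t))) has_real_derivative flat (Suc n) s) (at s)"
      using DERIV_mult[OF dp de] 2 by (simp add: flat_def power2_eq_square field_simps)
    with DERIV_cong_ev[OF refl ev refl] show ?thesis by simp
  next
    case 3
    have "((\<lambda>t. flat n t / t) \<longlongrightarrow> 0) (at_left 0)"
    proof (rule tendsto_eventually)
      show "eventually (\<lambda>t. flat n t / t = 0) (at_left 0)"
        by (auto simp: eventually_at_filter flat_def)
    qed
    moreover have "((\<lambda>t. flat n t / t) \<longlongrightarrow> 0) (at_right 0)"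
    proof -
      \<comment> \<open>\<open>pCons 0\<close> multiplies the polynomial by its variable
        \<open>1/t\<close> and thereby absorbs the division by \<open>t\<close>.\<close>
      have "((\<lambda>t. poly (pCons 0 (flat_poly n)) (inverse t) * exp (- inverse t)) \<longlongrightarrow> 0) (at_right 0)"
        by (rule filterlim_compose[OF poly_times_exp_minus_tendsto_0 filterlim_inverse_at_top_right])
      moreover have "eventually (\<lambda>t. poly (pCons 0 (flat_poly n)) (inverse t) * exp (- inverse t) = flat n t / t) (at_right 0)"
        by (auto simp: eventually_at_filter flat_def field_simps)
      ultimately show ?thesis by (rule Lim_transform_eventually)
    qed
    ultimately have "((\<lambda>t. flat n t / t) \<longlongrightarrow> 0) (at 0)"
      by (simp add: filterlim_at_split)
    then show ?thesis using 3 by (simp add: has_field_derivative_iff flat_def)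
  qed
qed

lemma flat_0_nonneg: "flat 0 s \<ge> 0" and flat_0_pos_iff: "flat 0 s > 0 \<longleftrightarrow> s > 0"
  by (auto simp: flat_def)

lemma Ck_on_flat: "Ck_on m k U f \<Longrightarrow> Ck_on m k U (\<lambda>x. flat 0 (f x))"
  by (rule Ck_on_compose_deriv_seq[where D = UNIV]) (auto intro: flat_has_derivative)


section \<open>Differentiability in the second variable, continuously in a parameter\<close>

text \<open>Continuity is joint in the parameter and the point, but derivatives are taken only in
  the point, so that \<open>X\<close> may be any space. Naming the derivative by \<open>pd\<close>
  instead of an existential witness makes it a family in \<open>a\<close>, whose joint continuity
  can be demanded at the next level.\<close>

fun PCk :: "'g topology \<Rightarrow> nat \<Rightarrow> nat \<Rightarrow> (nat \<Rightarrow> real) set \<Rightarrow> ('g \<Rightarrow> (nat \<Rightarrow> real) \<Rightarrow> real) \<Rightarrow> bool" where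
  "PCk X m 0 U \<Phi> \<longleftrightarrow>
     continuous_map (prod_topology X (subtopology (Euclidean_space m) U)) euclideanreal (\<lambda>(a, y). \<Phi> a y)"
| "PCk X m (Suc k) U \<Phi> \<longleftrightarrow>
     continuous_map (prod_topology X (subtopology (Euclidean_space m) U)) euclideanreal (\<lambda>(a, y). \<Phi> a y) \<and>
     (\<forall>i<m. (\<forall>a\<in>topspace X. \<forall>y\<in>U. ((\<lambda>t. \<Phi> a (y(i := t))) has_real_derivative pd i (\<Phi> a) y) (at (y i))) \<and>
            PCk X m k U (\<lambda>a. pd i (\<Phi> a)))"

lemma PCk_imp_continuous_map:
  "PCk X m k U \<Phi> \<Longrightarrow>
     continuous_map (prod_topology X (subtopology (Euclidean_space m) U)) euclideanreal (\<lambda>(a, y). \<Phi> a y)"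
  by (cases k) auto

lemma PCk_subset: "PCk X m k U \<Phi> \<Longrightarrow> V \<subseteq> U \<Longrightarrow> PCk X m k V \<Phi>"
proof (induction k arbitrary: \<Phi>)
  have c: "continuous_map (prod_topology X (subtopology (Euclidean_space m) V)) euclideanreal (\<lambda>(a, y). \<Phi> a y)"
    if "continuous_map (prod_topology X (subtopology (Euclidean_space m) U)) euclideanreal (\<lambda>(a, y). \<Phi> a y)" "V \<subseteq> U"
    for \<Phi> :: "'a \<Rightarrow> (nat \<Rightarrow> real) \<Rightarrow> real"
  proof -
    have "prod_topology X (subtopology (Euclidean_space m) V) =
        subtopology (prod_topology X (subtopology (Euclidean_space m) U)) (topspace X \<times> V)"
      using that(2) by (simp add: subtopology_Times subtopology_subtopology inf.absorb2)
    then show ?thesis using that(1) continuous_map_from_subtopology by metis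
  qed
  {
    case 0
    then show ?case using c by simp
  next
    case (Suc k)
    then show ?case using c by auto
  }
qed

lemma PCk_cong:
  assumes U: "openin (Euclidean_space m) U"
    and "\<And>a y. a \<in> topspace X \<Longrightarrow> y \<in> U \<Longrightarrow> \<Phi> a y = \<Psi> a y" and "PCk X m k U \<Phi>"
  shows "PCk X m k U \<Psi>"
  using assms(2,3)
proof (induction k arbitrary: \<Phi> \<Psi>)
  case 0
  show ?case unfolding PCk.simps
    by (rule continuous_map_eq[OF PCk_imp_continuous_map[OF 0(2)]]) (use 0(1) in auto)
next
  case (Suc k)
  have "continuous_map (prod_topology X (subtopology (Euclidean_space m) U)) euclideanreal (\<lambda>(a, y). \<Psi> a y)"
    by (rule continuous_map_eq[OF PCk_imp_continuous_map[OF Suc.prems(2)]]) (use Suc.prems(1) in auto)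
  moreover have eq: "pd i (\<Phi> a) y = pd i (\<Psi> a) y" if "i < m" "a \<in> topspace X" "y \<in> U" for i a y
    using pd_cong[OF U, of "\<Phi> a" "\<Psi> a"] that Suc.prems(1) by blast
  moreover have "((\<lambda>t. \<Psi> a (y(i := t))) has_real_derivative pd i (\<Psi> a) y) (at (y i))"
    if "i < m" "a \<in> topspace X" "y \<in> U" for i a y
  proof -
    have "eventually (\<lambda>t. \<Phi> a (y(i := t)) = \<Psi> a (y(i := t))) (nhds (y i))"
      using eventually_coord_update[OF U that(3,1)] by (rule eventually_mono) (use Suc.prems(1) that(2) in auto)
    moreover have "((\<lambda>t. \<Phi> a (y(i := t))) has_real_derivative pd i (\<Phi> a) y) (at (y i))"
      using Suc.prems(2) that by auto
    ultimately have "((\<lambda>t. \<Psi> a (y(i := t))) has_real_derivative pd i (\<Phi> a) y) (at (y i))"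
      using DERIV_cong_ev[OF refl _ refl, of "\<lambda>t. \<Phi> a (y(i := t))" "\<lambda>t. \<Psi> a (y(i := t))" "y i" "pd i (\<Phi> a) y"]
      by blast
    then show ?thesis by (simp add: eq[OF that])
  qed
  moreover have "PCk X m k U (\<lambda>a. pd i (\<Psi> a))" if "i < m" for i
    by (rule Suc.IH[of "\<lambda>a. pd i (\<Phi> a)"]) (use eq that Suc.prems(2) in auto)
  ultimately show ?case by simp
qed

text \<open>Used with chart domains of the group as \<open>A\<close>. The pieces fit because
  \<open>pd i (\<Phi> a)\<close> does not mention the topology of the parameter space; only
  continuity has to be pasted.\<close>

lemma PCk_local:
  assumes "\<And>a. a \<in> topspace X \<Longrightarrow> \<exists>A. openin X A \<and> a \<in> A \<and> PCk (subtopology X A) m k U \<Phi>"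
  shows "PCk X m k U \<Phi>"
  using assms
proof (induction k arbitrary: \<Phi>)
  have c: "continuous_map (prod_topology X (subtopology (Euclidean_space m) U)) euclideanreal (\<lambda>(a, y). \<Phi> a y)"
    if loc: "\<And>a. a \<in> topspace X \<Longrightarrow> \<exists>A. openin X A \<and> a \<in> A \<and> PCk (subtopology X A) m k U \<Phi>"
    for \<Phi> :: "'a \<Rightarrow> (nat \<Rightarrow> real) \<Rightarrow> real" and k
  proof -
    let ?Y = "subtopology (Euclidean_space m) U"
    let ?C = "{A. openin X A \<and> PCk (subtopology X A) m k U \<Phi>}"
    have "continuous_map (subtopology (prod_topology X ?Y) (A \<times> topspace ?Y)) euclideanreal (\<lambda>(a, y). \<Phi> a y)"
      if "A \<in> ?C" for A
      using that PCk_imp_continuous_map[of "subtopology X A" m k U \<Phi>]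
      by (simp only: subtopology_Times subtopology_topspace mem_Collect_eq)
    moreover have "openin (prod_topology X ?Y) (A \<times> topspace ?Y)" if "A \<in> ?C" for A
      using that by (simp only: openin_prod_Times_iff mem_Collect_eq openin_topspace simp_thms)
    moreover have "\<exists>A. A \<in> ?C \<and> x \<in> A \<times> topspace ?Y \<and> (case x of (a, y) \<Rightarrow> \<Phi> a y) = (case x of (a, y) \<Rightarrow> \<Phi> a y)"
      if "x \<in> topspace (prod_topology X ?Y)" for x
      using loc[of "fst x"] that by (auto simp: mem_Times_iff)
    ultimately show ?thesis
      using pasting_lemma[where I = ?C and T = "\<lambda>A. A \<times> topspace ?Y" and f = "\<lambda>A (a, y). \<Phi> a y"
          and X = "prod_topology X ?Y" and Y = euclideanreal and g = "\<lambda>(a, y). \<Phi> a y"]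
      by blast
  qed
  {
    case 0
    then show ?case using c[of 0 \<Phi>] by simp
  next
    case (Suc k)
    have "((\<lambda>t. \<Phi> a (y(i := t))) has_real_derivative pd i (\<Phi> a) y) (at (y i))"
      if "i < m" "a \<in> topspace X" "y \<in> U" for i a y
    proof -
      obtain A where "openin X A" "a \<in> A" "PCk (subtopology X A) m (Suc k) U \<Phi>"
        using Suc.prems \<open>a \<in> topspace X\<close> by blast
      then show ?thesis using that by auto
    qed
    moreover have "PCk X m k U (\<lambda>a. pd i (\<Phi> a))" if "i < m" for i
    proof (rule Suc.IH)
      fix a assume "a \<in> topspace X"
      then obtain A where "openin X A" "a \<in> A" "PCk (subtopology X A) m (Suc k) U \<Phi>"
        using Suc.prems by blast
      then show "\<exists>A. openin X A \<and> a \<in> A \<and> PCk (subtopology X A) m k U (\<lambda>a. pd i (\<Phi> a))"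
        using that by auto
    qed
    ultimately show ?case using c[OF Suc.prems] by simp
  }
qed

text \<open>The index layout of \<open>prod_chart\<close>, for coordinate vectors; see
  \<open>prod_chart_eq_join\<close>.\<close>

definition join :: "nat \<Rightarrow> (nat \<Rightarrow> real) \<Rightarrow> (nat \<Rightarrow> real) \<Rightarrow> nat \<Rightarrow> real" where
  "join q u y = (\<lambda>i. if i < q then u i else y (i - q))"

lemma join_update: "join q u (y(i := t)) = (join q u y)(q + i := t)"
  by (auto simp: join_def fun_eq_iff)

lemma PCk_join:
  assumes W: "openin (Euclidean_space (q + m)) W" and U: "openin (Euclidean_space m) U"
    and \<xi>: "continuous_map X (Euclidean_space q) \<xi>"
    and UW: "\<And>a y. a \<in> topspace X \<Longrightarrow> y \<in> U \<Longrightarrow> join q (\<xi> a) y \<in> W"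
    and "Ck_on (q + m) k W \<Theta>"
  shows "PCk X m k U (\<lambda>a y. \<Theta> (join q (\<xi> a) y))"
  using assms(5)
proof (induction k arbitrary: \<Theta>)
  let ?Y = "subtopology (Euclidean_space m) U"
  have "continuous_map (prod_topology X ?Y) euclideanreal (\<lambda>x. join q (\<xi> (fst x)) (snd x) i)" for i
  proof (cases "i < q")
    case True
    have "continuous_map X euclideanreal (\<lambda>a. \<xi> a i)"
      using \<xi> by (auto simp: Euclidean_space_def continuous_map_in_subtopology continuous_map_componentwise_UNIV)
    from continuous_map_compose[OF continuous_map_fst this] show ?thesis
      using True by (simp add: join_def o_def)
  next
    case False
    have "continuous_map ?Y euclideanreal (\<lambda>y. y (i - q))"
      unfolding Euclidean_space_def
      by (intro continuous_map_from_subtopology continuous_map_product_projection) simp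
    from continuous_map_compose[OF continuous_map_snd this] show ?thesis
      using False by (simp add: join_def o_def)
  qed
  then have "continuous_map (prod_topology X ?Y) (powertop_real UNIV) (\<lambda>x. join q (\<xi> (fst x)) (snd x))"
    by (simp add: continuous_map_componentwise_UNIV)
  then have J: "continuous_map (prod_topology X ?Y) (top_of_set W) (\<lambda>x. join q (\<xi> (fst x)) (snd x))"
    using UW by (auto simp: continuous_map_in_subtopology euclidean_product_topology)
  have c: "continuous_map (prod_topology X ?Y) euclideanreal (\<lambda>(a, y). \<Theta> (join q (\<xi> a) y))"
    if "continuous_on W \<Theta>" for \<Theta> :: "(nat \<Rightarrow> real) \<Rightarrow> real"
    using continuous_map_compose[OF J, of euclideanreal \<Theta>] that
    by (simp add: o_def case_prod_unfold)
  {
    case 0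
    then show ?case using c by simp
  next
    case (Suc k)
    note p = Ck_on_Suc_pd[OF W, THEN iffD1, OF Suc.prems]
    have pdj: "pd i (\<lambda>y. \<Theta> (join q (\<xi> a) y)) y = pd (q + i) \<Theta> (join q (\<xi> a) y)" for a i y
      by (simp add: pd_def join_update) (simp add: join_def)
    have "((\<lambda>t. \<Theta> (join q (\<xi> a) (y(i := t)))) has_real_derivative pd i (\<lambda>y. \<Theta> (join q (\<xi> a) y)) y) (at (y i))"
      if "i < m" "a \<in> topspace X" "y \<in> U" for i a y
    proof -
      have "((\<lambda>t. \<Theta> ((join q (\<xi> a) y)(q + i := t))) has_real_derivative pd (q + i) \<Theta> (join q (\<xi> a) y))
          (at (join q (\<xi> a) y (q + i)))"
        using p UW[OF that(2,3)] that(1) nat_add_left_cancel_less by blast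
      then show ?thesis by (simp add: pdj join_update) (simp add: join_def)
    qed
    moreover have "PCk X m k U (\<lambda>a. pd i (\<lambda>y. \<Theta> (join q (\<xi> a) y)))" if "i < m" for i
    proof -
      have "(\<lambda>a. pd i (\<lambda>y. \<Theta> (join q (\<xi> a) y))) = (\<lambda>a y. pd (q + i) \<Theta> (join q (\<xi> a) y))"
        by (simp add: pdj fun_eq_iff)
      then show ?thesis using Suc.IH[of "pd (q + i) \<Theta>"] p that by simp
    qed
    ultimately show ?case using c p by simp
  }
qed


section \<open>Compactly supported continuous functions\<close>

text \<open>Nothing is required off \<open>topspace X\<close>; the compact \<open>K\<close> only has
  to contain the nonzero points, so no closure of a support has to be formed.\<close>

definition Cc :: "'g topology \<Rightarrow> ('g \<Rightarrow> real) set" where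
  "Cc X = {u. continuous_map X euclideanreal u \<and> (\<exists>K. compactin X K \<and> (\<forall>x\<in>topspace X - K. u x = 0))}"

definition Cp :: "'g topology \<Rightarrow> ('g \<Rightarrow> real) set" where
  "Cp X = {u \<in> Cc X. \<forall>x\<in>topspace X. 0 \<le> u x}"

lemma CcI: "continuous_map X euclideanreal u \<Longrightarrow> compactin X K \<Longrightarrow>
    (\<And>x. x \<in> topspace X \<Longrightarrow> x \<notin> K \<Longrightarrow> u x = 0) \<Longrightarrow> u \<in> Cc X"
  by (auto simp: Cc_def)

lemma CcE:
  assumes "u \<in> Cc X"
  obtains K where "compactin X K" "\<And>x. x \<in> topspace X \<Longrightarrow> x \<notin> K \<Longrightarrow> u x = 0"
  using assms by (auto simp: Cc_def)

lemma Cc_continuous: "u \<in> Cc X \<Longrightarrow> continuous_map X euclideanreal u"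
  by (simp add: Cc_def)

lemma Cp_Cc: "u \<in> Cp X \<Longrightarrow> u \<in> Cc X"
  by (simp add: Cp_def)

lemma Cp_nonneg: "u \<in> Cp X \<Longrightarrow> x \<in> topspace X \<Longrightarrow> 0 \<le> u x"
  by (simp add: Cp_def)

text \<open>The union of the two supports serves any pointwise operation fixing zero: sums, and
  positive parts via \<open>max\<close>.\<close>

lemma Cc_combine:
  assumes "u \<in> Cc X" "v \<in> Cc X" and "continuous_map X euclideanreal (\<lambda>x. h (u x) (v x))" and "h 0 0 = 0"
  shows "(\<lambda>x. h (u x) (v x)) \<in> Cc X"
proof -
  obtain K L where "compactin X K" "\<And>x. x \<in> topspace X \<Longrightarrow> x \<notin> K \<Longrightarrow> u x = 0"
    "compactin X L" "\<And>x. x \<in> topspace X \<Longrightarrow> x \<notin> L \<Longrightarrow> v x = 0"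
    using assms(1,2) CcE by metis
  then show ?thesis
    by (intro CcI[of X _ "K \<union> L"] assms(3)) (auto simp: compactin_Un assms(4))
qed

lemma Cc_add: "u \<in> Cc X \<Longrightarrow> v \<in> Cc X \<Longrightarrow> (\<lambda>x. u x + v x) \<in> Cc X"
  using Cc_combine[of u X v "(+)"] by (simp add: continuous_map_add Cc_continuous)

lemma Cc_mult: "u \<in> Cc X \<Longrightarrow> continuous_map X euclideanreal v \<Longrightarrow> (\<lambda>x. u x * v x) \<in> Cc X"
  unfolding Cc_def by (auto intro!: continuous_map_real_mult)

lemma Cc_scale: "u \<in> Cc X \<Longrightarrow> (\<lambda>x. c * u x) \<in> Cc X"
  using Cc_mult[of u X "\<lambda>_. c"] by (simp add: mult.commute)

lemma Cc_diff: "u \<in> Cc X \<Longrightarrow> v \<in> Cc X \<Longrightarrow> (\<lambda>x. u x - v x) \<in> Cc X"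
  using Cc_add[of u X "\<lambda>x. (-1) * v x"] Cc_scale[of v X "-1"] by simp

lemma Cc_zero: "(\<lambda>x. 0) \<in> Cc X"
  by (rule CcI[of _ _ "{}"]) auto

lemma Cp_add: "u \<in> Cp X \<Longrightarrow> v \<in> Cp X \<Longrightarrow> (\<lambda>x. u x + v x) \<in> Cp X"
  by (simp add: Cp_def Cc_add)

lemma Cp_scale: "u \<in> Cp X \<Longrightarrow> c \<ge> 0 \<Longrightarrow> (\<lambda>x. c * u x) \<in> Cp X"
  by (simp add: Cp_def Cc_scale)

lemma Cp_zero: "(\<lambda>x. 0) \<in> Cp X"
  by (simp add: Cp_def Cc_zero)

lemma Cp_sum: "(\<And>k. k \<in> F \<Longrightarrow> u k \<in> Cp X) \<Longrightarrow> (\<lambda>x. \<Sum>k\<in>F. u k x) \<in> Cp X"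
  by (induction F rule: infinite_finite_induct) (auto intro: Cp_add Cp_zero)

lemma Cc_pos_part: "u \<in> Cc X \<Longrightarrow> (\<lambda>x. max (u x) 0) \<in> Cp X"
  using Cc_combine[of u X "\<lambda>_. 0" max]
  by (simp add: Cp_def Cc_zero continuous_map_real_max Cc_continuous)

lemma Cc_neg_part: "u \<in> Cc X \<Longrightarrow> (\<lambda>x. max (- u x) 0) \<in> Cp X"
  using Cc_pos_part[OF Cc_scale[of u X "-1"]] by simp

lemma Cc_bounded:
  assumes "u \<in> Cc X"
  obtains B where "B > 0" "\<And>x. x \<in> topspace X \<Longrightarrow> \<bar>u x\<bar> \<le> B"
proof -
  obtain K where K: "compactin X K" "\<And>x. x \<in> topspace X \<Longrightarrow> x \<notin> K \<Longrightarrow> u x = 0"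
    using CcE[OF assms] by blast
  have "compact (u ` K)"
    using image_compactin[OF K(1) Cc_continuous[OF assms]] by simp
  then obtain B where B: "B > 0" "\<And>y. y \<in> u ` K \<Longrightarrow> norm y \<le> B"
    using compact_imp_bounded bounded_pos by metis
  show ?thesis
  proof
    show "B > 0" by fact
    fix x assume "x \<in> topspace X"
    then show "\<bar>u x\<bar> \<le> B" using B K(2)[of x] by (cases "x \<in> K") auto
  qed
qed

text \<open>Complete regularity separates \<open>p\<close> from the complement of
  \<open>U \<inter> V\<close>, where \<open>U\<close> lies in a compact set; one minus the
  separating function vanishes off \<open>V\<close> and off that compact set.\<close>

lemma locally_compact_bump:
  assumes "Hausdorff_space X" "locally_compact_space X" "openin X V" "p \<in> V"
  obtains \<phi> where "\<phi> \<in> Cp X" "\<phi> p = 1" "\<And>x. x \<in> topspace X \<Longrightarrow> x \<notin> V \<Longrightarrow> \<phi> x = 0"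
proof -
  have p: "p \<in> topspace X" using assms(3,4) openin_subset by blast
  obtain U K where U: "openin X U" "compactin X K" "p \<in> U" "U \<subseteq> K"
    using assms(2) p unfolding locally_compact_space_def by metis
  have "completely_regular_space X"
    using assms(1,2) locally_compact_regular_imp_completely_regular_space by blast
  moreover have "closedin X (topspace X - (U \<inter> V))" "p \<in> topspace X - (topspace X - (U \<inter> V))"
    using U assms p by auto
  ultimately obtain f :: "'a \<Rightarrow> real" where f: "continuous_map X (top_of_set {0..1}) f" "f p = 0"
      "f ` (topspace X - (U \<inter> V)) \<subseteq> {1}"
    unfolding completely_regular_space_def by metis
  have fc: "continuous_map X euclideanreal f" and f1: "\<And>x. x \<in> topspace X \<Longrightarrow> f x \<le> 1"
    using f(1) by (auto simp: continuous_map_in_subtopology)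
  have f0: "1 - f x = 0" if "x \<in> topspace X" "x \<notin> U \<inter> V" for x
    using f(3) that by fastforce
  show ?thesis
  proof
    have "(\<lambda>x. 1 - f x) \<in> Cc X"
    proof (rule CcI[OF _ U(2)])
      show "continuous_map X euclideanreal (\<lambda>x. 1 - f x)"
        using fc by (intro continuous_map_diff) auto
      show "1 - f x = 0" if "x \<in> topspace X" "x \<notin> K" for x
        using f0[of x] that U(4) by blast
    qed
    then show "(\<lambda>x. 1 - f x) \<in> Cp X" using f1 by (simp add: Cp_def)
    show "1 - f p = 1" using f by simp
    show "1 - f x = 0" if "x \<in> topspace X" "x \<notin> V" for x
      using f0 that by blast
  qed
qed

text \<open>A majorant of the indicator of \<open>K\<close> inside \<open>Cp X\<close> replaces
  constants, which need not have compact support, in estimates on \<open>K\<close>.\<close>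

lemma locally_compact_dominate:
  assumes "Hausdorff_space X" "locally_compact_space X" "compactin X K"
  obtains w where "w \<in> Cp X" "\<And>x. x \<in> K \<Longrightarrow> w x \<ge> 1"
proof -
  have "\<forall>k\<in>topspace X. \<exists>\<phi>. \<phi> \<in> Cp X \<and> \<phi> k = 1"
    using locally_compact_bump[OF assms(1,2) openin_topspace] by metis
  then obtain \<phi> where \<phi>: "\<And>k. k \<in> topspace X \<Longrightarrow> \<phi> k \<in> Cp X" "\<And>k. k \<in> topspace X \<Longrightarrow> \<phi> k k = 1"
    by metis
  have KX: "K \<subseteq> topspace X" using assms(3) compactin_subset_topspace by blast
  let ?O = "\<lambda>k. {x \<in> topspace X. \<phi> k x \<in> {1/2<..}}"
  have "\<exists>\<F>. finite \<F> \<and> \<F> \<subseteq> ?O ` K \<and> K \<subseteq> \<Union>\<F>"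
  proof (rule compactinD[OF assms(3)])
    show "openin X U" if U: "U \<in> ?O ` K" for U
    proof -
      obtain k where k: "k \<in> K" "U = ?O k" using U by blast
      have "continuous_map X euclideanreal (\<phi> k)" using \<phi> k KX Cp_Cc Cc_continuous by blast
      from openin_continuous_map_preimage[OF this, of "{1/2<..}"] show ?thesis using k by simp
    qed
    show "K \<subseteq> \<Union>(?O ` K)" using \<phi>(2) KX by fastforce
  qed
  then obtain F where F: "finite F" "F \<subseteq> K" "K \<subseteq> \<Union>(?O ` F)"
    by (metis (no_types, lifting) finite_subset_image)
  \<comment> \<open>The factor \<open>2\<close> makes up for the threshold \<open>1/2\<close> of the
    covering sets.\<close>
  define w where "w = (\<lambda>x. \<Sum>k\<in>F. 2 * \<phi> k x)"
  have \<phi>p: "\<And>k x. k \<in> F \<Longrightarrow> x \<in> topspace X \<Longrightarrow> 0 \<le> \<phi> k x"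
    using \<phi>(1) F(2) KX Cp_nonneg by (metis subsetD)
  show ?thesis
  proof
    show "w \<in> Cp X" unfolding w_def
      using \<phi>(1) F(2) KX by (intro Cp_sum Cp_scale) auto
    fix x assume "x \<in> K"
    then obtain k where k: "k \<in> F" "\<phi> k x > 1/2" "x \<in> topspace X" using F(3) by auto
    have "2 * \<phi> k x \<le> w x"
      unfolding w_def using k F(1) \<phi>p by (intro member_le_sum) auto
    then show "w x \<ge> 1" using k by simp
  qed
qed


section \<open>The Haar integral\<close>

locale lc_group = group G for G (structure) +
  fixes X :: "'a topology"
  assumes topspace_eq [simp]: "topspace X = carrier G"
    and Hausdorff: "Hausdorff_space X"
    and locally_compact: "locally_compact_space X"
    and continuous_mult: "continuous_map (prod_topology X X) X (\<lambda>(a, b). a \<otimes> b)"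
    and continuous_inv: "continuous_map X X (\<lambda>a. inv a)"
begin

lemma continuous_mult_right: "b \<in> carrier G \<Longrightarrow> continuous_map X X (\<lambda>a. a \<otimes> b)"
  using continuous_map_compose[OF continuous_map_pairedI continuous_mult, of X "\<lambda>x. x" "\<lambda>_. b"]
  by (simp add: o_def)

lemma Cc_translate:
  assumes "u \<in> Cc X" "b \<in> carrier G"
  shows "(\<lambda>x. u (x \<otimes> b)) \<in> Cc X"
proof -
  obtain K where K: "compactin X K" "\<And>x. x \<in> topspace X \<Longrightarrow> x \<notin> K \<Longrightarrow> u x = 0"
    using CcE[OF assms(1)] by blast
  show ?thesis
  proof (rule CcI)
    show "continuous_map X euclideanreal (\<lambda>x. u (x \<otimes> b))"
      using continuous_map_compose[OF continuous_mult_right[OF assms(2)] Cc_continuous[OF assms(1)]]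
      by (simp add: o_def)
    show "compactin X ((\<lambda>a. a \<otimes> inv b) ` K)"
      using image_compactin[OF K(1) continuous_mult_right] assms(2) by simp
    fix x assume x: "x \<in> topspace X" "x \<notin> (\<lambda>a. a \<otimes> inv b) ` K"
    have "x = (x \<otimes> b) \<otimes> inv b" using x assms(2) by (simp add: m_assoc)
    then have "x \<otimes> b \<notin> K" using x(2) by blast
    then show "u (x \<otimes> b) = 0" using K(2) x(1) assms(2) by simp
  qed
qed

lemma Cp_translate: "u \<in> Cp X \<Longrightarrow> b \<in> carrier G \<Longrightarrow> (\<lambda>x. u (x \<otimes> b)) \<in> Cp X"
  by (simp add: Cp_def Cc_translate)

text \<open>The tube lemma bounds the change by \<open>\<delta>\<close> when \<open>y\<close> is in
  the support. If only \<open>v \<otimes> y\<close> is there, the same bound is applied to it and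
  \<open>inv v\<close>, which is why the neighbourhood is intersected with its inverse; if neither
  is, both values vanish.\<close>

lemma Cc_left_uniformly_continuous:
  assumes "h \<in> Cc X" "\<delta> > 0"
  obtains V where "openin X V" "\<one> \<in> V"
    "\<And>v y. v \<in> V \<Longrightarrow> y \<in> carrier G \<Longrightarrow> \<bar>h (v \<otimes> y) - h y\<bar> < \<delta>"
proof -
  obtain K where K: "compactin X K" "\<And>x. x \<in> topspace X \<Longrightarrow> x \<notin> K \<Longrightarrow> h x = 0"
    using CcE[OF assms(1)] by blast
  let ?d = "\<lambda>(v, y). \<bar>h (v \<otimes> y) - h y\<bar>"
  have "continuous_map (prod_topology X X) euclideanreal (\<lambda>p. h (fst p \<otimes> snd p))"
    using continuous_map_compose[OF continuous_mult Cc_continuous[OF assms(1)]]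
    by (simp add: o_def case_prod_unfold)
  moreover have "continuous_map (prod_topology X X) euclideanreal (\<lambda>p. h (snd p))"
    using continuous_map_compose[OF continuous_map_snd Cc_continuous[OF assms(1)]] by (simp add: o_def)
  ultimately have "continuous_map (prod_topology X X) euclideanreal ?d"
    by (simp add: case_prod_unfold continuous_map_real_abs continuous_map_diff)
  from openin_continuous_map_preimage[OF this, of "{..<\<delta>}"]
  have O: "openin (prod_topology X X) {p \<in> carrier G \<times> carrier G. ?d p < \<delta>}" by simp
  have "{\<one>} \<times> K \<subseteq> {p \<in> carrier G \<times> carrier G. ?d p < \<delta>}"
    using compactin_subset_topspace[OF K(1)] assms(2) by auto
  then obtain U V where UV: "openin X U" "openin X V" "{\<one>} \<subseteq> U" "K \<subseteq> V"
      "U \<times> V \<subseteq> {p \<in> carrier G \<times> carrier G. ?d p < \<delta>}"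
    using Wallace_theorem_prod_topology[OF _ K(1) O, of "{\<one>}"] by auto
  let ?W = "U \<inter> {v \<in> carrier G. inv v \<in> U}"
  show ?thesis
  proof
    show "openin X ?W"
      using UV(1) openin_continuous_map_preimage[OF continuous_inv UV(1)] by auto
    show "\<one> \<in> ?W" using UV(3) by auto
    fix v y assume v: "v \<in> ?W" and y: "y \<in> carrier G"
    consider "y \<in> K" | "v \<otimes> y \<in> K" | "y \<notin> K" "v \<otimes> y \<notin> K" by blast
    then show "\<bar>h (v \<otimes> y) - h y\<bar> < \<delta>"
    proof cases
      case 1
      then have "(v, y) \<in> U \<times> V" using UV(4) v by auto
      then show ?thesis using UV(5) by auto
    next
      case 2
      then have "(inv v, v \<otimes> y) \<in> U \<times> V" using UV(4) v by auto
      then have "\<bar>h (inv v \<otimes> (v \<otimes> y)) - h (v \<otimes> y)\<bar> < \<delta>" using UV(5) by auto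
      moreover have "inv v \<otimes> (v \<otimes> y) = y" using v y by (simp flip: m_assoc)
      ultimately show ?thesis by (simp add: abs_minus_commute)
    next
      case 3
      then show ?thesis using K(2) v y assms(2) by simp
    qed
  qed
qed

section \<open>Weil's covering numbers\<close>

definition weight :: "(real \<times> 'a) list \<Rightarrow> real" where
  "weight L = sum_list (map fst L)"

text \<open>Lists rather than finite sets of translates: concatenation covers a sum, and repeated
  translates do no harm. Group elements multiply \<open>x\<close> on the right, as right invariance
  is the aim.\<close>

definition covers :: "('a \<Rightarrow> real) \<Rightarrow> ('a \<Rightarrow> real) \<Rightarrow> (real \<times> 'a) list \<Rightarrow> bool" where
  "covers \<phi> f L \<longleftrightarrow> (\<forall>(c, s)\<in>set L. 0 \<le> c \<and> s \<in> carrier G) \<and>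
     (\<forall>x\<in>carrier G. f x \<le> (\<Sum>(c, s)\<leftarrow>L. c * \<phi> (x \<otimes> s)))"

text \<open>Written \<open>(f : \<phi>)\<close> by Weil.\<close>

definition cov :: "('a \<Rightarrow> real) \<Rightarrow> ('a \<Rightarrow> real) \<Rightarrow> real" where
  "cov \<phi> f = Inf {weight L | L. covers \<phi> f L}"

definition nz :: "('a \<Rightarrow> real) \<Rightarrow> bool" where
  "nz u \<longleftrightarrow> (\<exists>x\<in>carrier G. u x > 0)"

lemma weight_nonneg: "covers \<phi> f L \<Longrightarrow> 0 \<le> weight L"
  unfolding weight_def covers_def by (intro sum_list_nonneg) auto

text \<open>Finitely many translates of the set where \<open>\<phi> > d\<close> cover the support of
  \<open>f\<close>; there the multiple \<open>B / d\<close> of the translate exceeds the bound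
  \<open>B\<close> of \<open>f\<close>.\<close>

lemma covers_exists:
  assumes f: "f \<in> Cp X" and \<phi>: "\<phi> \<in> Cp X" "nz \<phi>"
  obtains L where "covers \<phi> f L"
proof -
  obtain x0 where x0: "x0 \<in> carrier G" "\<phi> x0 > 0" using \<phi> nz_def by auto
  define d where "d = \<phi> x0 / 2"
  have d: "d > 0" "\<phi> x0 > d" using x0 by (auto simp: d_def)
  obtain K where K: "compactin X K" "\<And>x. x \<in> topspace X \<Longrightarrow> x \<notin> K \<Longrightarrow> f x = 0"
    using CcE[OF Cp_Cc[OF f]] by blast
  have KX: "K \<subseteq> carrier G" using K compactin_subset_topspace by fastforce
  obtain B where B: "B > 0" "\<And>x. x \<in> topspace X \<Longrightarrow> \<bar>f x\<bar> \<le> B"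
    using Cc_bounded[OF Cp_Cc[OF f]] by blast
  \<comment> \<open>Chosen so that \<open>k \<otimes> ?s k = x0\<close>, a point where
    \<open>\<phi> > d\<close>.\<close>
  let ?s = "\<lambda>k. inv k \<otimes> x0"
  let ?O = "\<lambda>k. {x \<in> topspace X. \<phi> (x \<otimes> ?s k) \<in> {d<..}}"
  have "\<exists>\<F>. finite \<F> \<and> \<F> \<subseteq> ?O ` K \<and> K \<subseteq> \<Union>\<F>"
  proof (rule compactinD[OF K(1)])
    show "openin X U" if U: "U \<in> ?O ` K" for U
    proof -
      obtain k where k: "k \<in> K" "U = ?O k" using U by blast
      have "continuous_map X euclideanreal (\<lambda>x. \<phi> (x \<otimes> ?s k))"
        using Cc_translate[OF Cp_Cc[OF \<phi>(1)], of "?s k"] k KX x0 Cc_continuous by auto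
      from openin_continuous_map_preimage[OF this, of "{d<..}"] show ?thesis using k by simp
    qed
    have "k \<in> ?O k" if "k \<in> K" for k
    proof -
      have "k \<otimes> ?s k = x0" using that KX x0 by (auto simp flip: m_assoc)
      then show ?thesis using that KX d by auto
    qed
    then show "K \<subseteq> \<Union>(?O ` K)" by blast
  qed
  then obtain F where F: "finite F" "F \<subseteq> K" "K \<subseteq> \<Union>(?O ` F)"
    by (metis (no_types, lifting) finite_subset_image)
  obtain ks where ks: "set ks = F" using finite_list[OF F(1)] by blast
  define L where "L = map (\<lambda>k. (B / d, ?s k)) ks"
  have "covers \<phi> f L"
    unfolding covers_def
  proof (intro conjI ballI)
    show "case p of (c, s) \<Rightarrow> 0 \<le> c \<and> s \<in> carrier G" if "p \<in> set L" for p
      using that B d ks F KX x0 by (auto simp: L_def)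
    fix x assume x: "x \<in> carrier G"
    have eq: "(\<Sum>(c, s)\<leftarrow>L. c * \<phi> (x \<otimes> s)) = (\<Sum>k\<leftarrow>ks. B / d * \<phi> (x \<otimes> ?s k))"
      by (simp add: L_def o_def)
    have nn: "\<And>k. k \<in> set ks \<Longrightarrow> 0 \<le> B / d * \<phi> (x \<otimes> ?s k)"
      using Cp_nonneg[OF \<phi>(1)] B d x x0 ks F KX by (intro mult_nonneg_nonneg) auto
    show "f x \<le> (\<Sum>(c, s)\<leftarrow>L. c * \<phi> (x \<otimes> s))"
    proof (cases "x \<in> K")
      case True
      then obtain k where k: "k \<in> set ks" "\<phi> (x \<otimes> ?s k) > d" using F(3) ks by auto
      have "f x \<le> B" using B(2)[of x] x by auto
      also have "B \<le> B / d * \<phi> (x \<otimes> ?s k)" using k B d by (simp add: field_simps)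
      also have "\<dots> \<le> (\<Sum>k\<leftarrow>ks. B / d * \<phi> (x \<otimes> ?s k))"
        using nn k by (intro member_le_sum_list) (auto simp: image_iff)
      finally show ?thesis using eq by simp
    next
      case False
      then have "f x = 0" using K(2) x by simp
      moreover have "0 \<le> (\<Sum>k\<leftarrow>ks. B / d * \<phi> (x \<otimes> ?s k))"
        using nn by (intro sum_list_nonneg) auto
      ultimately show ?thesis using eq by simp
    qed
  qed
  then show ?thesis using that by blast
qed

lemma cov_le: "covers \<phi> f L \<Longrightarrow> cov \<phi> f \<le> weight L"
  unfolding cov_def by (rule cInf_lower) (auto intro!: bdd_belowI[of _ 0] weight_nonneg)

lemma cov_greatest:
  assumes "f \<in> Cp X" "\<phi> \<in> Cp X" "nz \<phi>" "c \<ge> 0"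
    and "\<And>L. covers \<phi> f L \<Longrightarrow> z \<le> c * weight L"
  shows "z \<le> c * cov \<phi> f"
proof (cases "c = 0")
  case True
  obtain L where "covers \<phi> f L" using covers_exists assms(1-3) by blast
  then show ?thesis using assms(5)[of L] True by simp
next
  case False
  have "z / c \<le> cov \<phi> f"
    unfolding cov_def
  proof (rule cInf_greatest)
    obtain L where "covers \<phi> f L" using covers_exists assms(1-3) by blast
    then show "{weight L | L. covers \<phi> f L} \<noteq> {}" by blast
    show "z / c \<le> w" if "w \<in> {weight L | L. covers \<phi> f L}" for w
      using that assms(4,5) False by (auto simp: field_simps)
  qed
  then show ?thesis using False assms(4) by (simp add: field_simps)
qed

lemma cov_mono:
  assumes "g \<in> Cp X" "\<phi> \<in> Cp X" "nz \<phi>" "\<And>x. x \<in> carrier G \<Longrightarrow> f x \<le> g x"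
  shows "cov \<phi> f \<le> cov \<phi> g"
proof -
  have "cov \<phi> f \<le> 1 * cov \<phi> g"
  proof (rule cov_greatest[OF assms(1-3)])
    fix L assume "covers \<phi> g L"
    then have "covers \<phi> f L" using assms(4) unfolding covers_def by (meson order_trans)
    then show "cov \<phi> f \<le> 1 * weight L" using cov_le by simp
  qed simp
  then show ?thesis by simp
qed

lemma cov_scale_le:
  assumes "f \<in> Cp X" "\<phi> \<in> Cp X" "nz \<phi>" "c \<ge> 0"
  shows "cov \<phi> (\<lambda>x. c * f x) \<le> c * cov \<phi> f"
proof (rule cov_greatest[OF assms])
  fix L assume L: "covers \<phi> f L"
  let ?L = "map (\<lambda>(d, s). (c * d, s)) L"
  have sum: "(\<Sum>(d, s)\<leftarrow>?L. d * \<phi> (x \<otimes> s)) = c * (\<Sum>(d, s)\<leftarrow>L. d * \<phi> (x \<otimes> s))" for x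
    by (simp add: o_def case_prod_unfold sum_list_const_mult mult.assoc)
  have "covers \<phi> (\<lambda>x. c * f x) ?L"
    using L assms(4) unfolding covers_def sum by (auto intro: mult_left_mono)
  moreover have "weight ?L = c * weight L"
    by (simp add: weight_def o_def case_prod_unfold sum_list_const_mult)
  ultimately show "cov \<phi> (\<lambda>x. c * f x) \<le> c * weight L" using cov_le by metis
qed

text \<open>Multiplying the translating elements by \<open>b\<close> on the left turns a covering of
  \<open>f\<close> into one of its translate. Equality for the limit functional comes from using the
  inequality with \<open>inv b\<close> as well.\<close>

lemma cov_translate_le:
  assumes "f \<in> Cp X" "\<phi> \<in> Cp X" "nz \<phi>" "b \<in> carrier G"
  shows "cov \<phi> (\<lambda>x. f (x \<otimes> b)) \<le> cov \<phi> f"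
proof -
  have "cov \<phi> (\<lambda>x. f (x \<otimes> b)) \<le> 1 * cov \<phi> f"
  proof (rule cov_greatest[OF assms(1-3)])
    fix L assume L: "covers \<phi> f L"
    let ?L = "map (\<lambda>(d, s). (d, b \<otimes> s)) L"
    have sum: "(\<Sum>(d, s)\<leftarrow>?L. d * \<phi> (x \<otimes> s)) = (\<Sum>(d, s)\<leftarrow>L. d * \<phi> ((x \<otimes> b) \<otimes> s))"
      if "x \<in> carrier G" for x
      using L assms(4) that unfolding covers_def
      by (auto simp: o_def m_assoc intro!: arg_cong[where f = sum_list] map_cong)
    have "covers \<phi> (\<lambda>x. f (x \<otimes> b)) ?L"
      unfolding covers_def
    proof (intro conjI ballI)
      show "case p of (c, s) \<Rightarrow> 0 \<le> c \<and> s \<in> carrier G" if "p \<in> set ?L" for p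
        using that L assms(4) unfolding covers_def by auto
      fix x assume x: "x \<in> carrier G"
      then have "f (x \<otimes> b) \<le> (\<Sum>(d, s)\<leftarrow>L. d * \<phi> ((x \<otimes> b) \<otimes> s))"
        using L assms(4) unfolding covers_def by blast
      then show "f (x \<otimes> b) \<le> (\<Sum>(d, s)\<leftarrow>?L. d * \<phi> (x \<otimes> s))" using sum[OF x] by simp
    qed
    moreover have "weight ?L = weight L"
      by (simp add: weight_def o_def case_prod_unfold)
    ultimately show "cov \<phi> (\<lambda>x. f (x \<otimes> b)) \<le> 1 * weight L" using cov_le by fastforce
  qed simp
  then show ?thesis by simp
qed

text \<open>Concatenate coverings; the two infima are taken one after the other.\<close>

lemma cov_add_le:
  assumes "f \<in> Cp X" "g \<in> Cp X" "\<phi> \<in> Cp X" "nz \<phi>"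
  shows "cov \<phi> (\<lambda>x. f x + g x) \<le> cov \<phi> f + cov \<phi> g"
proof -
  have "cov \<phi> (\<lambda>x. f x + g x) - cov \<phi> f \<le> 1 * cov \<phi> g"
  proof (rule cov_greatest[OF assms(2-4)])
    fix L assume L: "covers \<phi> g L"
    have "cov \<phi> (\<lambda>x. f x + g x) - weight L \<le> 1 * cov \<phi> f"
    proof (rule cov_greatest[OF assms(1,3,4)])
      fix K assume "covers \<phi> f K"
      with L have "covers \<phi> (\<lambda>x. f x + g x) (K @ L)"
        unfolding covers_def by (auto intro: add_mono)
      from cov_le[OF this] show "cov \<phi> (\<lambda>x. f x + g x) - weight L \<le> 1 * weight K"
        by (simp add: weight_def)
    qed simp
    then show "cov \<phi> (\<lambda>x. f x + g x) - cov \<phi> f \<le> 1 * weight L" by simp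
  qed simp
  then show ?thesis by simp
qed

text \<open>Evaluating a covering at a point where \<open>f x > 0\<close> bounds its weight from
  below by \<open>f x / B\<close>, whatever the translates.\<close>

lemma cov_pos:
  assumes "f \<in> Cp X" "\<phi> \<in> Cp X" "nz \<phi>" "nz f"
  shows "cov \<phi> f > 0"
proof -
  obtain x where x: "x \<in> carrier G" "f x > 0" using assms nz_def by auto
  obtain B where B: "B > 0" "\<And>x. x \<in> topspace X \<Longrightarrow> \<bar>\<phi> x\<bar> \<le> B"
    using Cc_bounded[OF Cp_Cc[OF assms(2)]] by blast
  have "f x \<le> B * cov \<phi> f"
  proof (rule cov_greatest[OF assms(1-3)])
    fix L assume L: "covers \<phi> f L"
    have "f x \<le> (\<Sum>(c, s)\<leftarrow>L. c * \<phi> (x \<otimes> s))" using L x unfolding covers_def by blast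
    also have "\<dots> \<le> (\<Sum>(c, s)\<leftarrow>L. B * c)"
    proof (rule sum_list_mono)
      fix p assume "p \<in> set L"
      moreover obtain c s where "p = (c, s)" by fastforce
      ultimately have p: "p = (c, s)" "0 \<le> c" "s \<in> carrier G" using L unfolding covers_def by auto
      then have "\<phi> (x \<otimes> s) \<le> B" using B(2)[of "x \<otimes> s"] x by auto
      then show "(case p of (c, s) \<Rightarrow> c * \<phi> (x \<otimes> s)) \<le> (case p of (c, s) \<Rightarrow> B * c)"
        using p mult_left_mono by (fastforce simp: mult.commute)
    qed
    also have "\<dots> = B * weight L"
      by (simp add: weight_def case_prod_unfold sum_list_const_mult)
    finally show "f x \<le> B * weight L" .
  qed (use B in simp)
  then show ?thesis using x B by (metis less_le_trans zero_less_mult_pos)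
qed

lemma cov_nonneg: "f \<in> Cp X \<Longrightarrow> \<phi> \<in> Cp X \<Longrightarrow> nz \<phi> \<Longrightarrow> 0 \<le> cov \<phi> f"
  using cov_greatest[of f \<phi> 1 0] weight_nonneg by simp

text \<open>Cover \<open>f\<close> by translates of \<open>\<psi>\<close> and each of these by
  translates of \<open>\<phi>\<close>; subadditivity, homogeneity and translation add up the
  weights. The resulting bounds on normalised covering numbers are independent of
  \<open>\<phi>\<close>.\<close>

lemma cov_trans:
  assumes "f \<in> Cp X" "\<psi> \<in> Cp X" "nz \<psi>" "\<phi> \<in> Cp X" "nz \<phi>"
  shows "cov \<phi> f \<le> cov \<phi> \<psi> * cov \<psi> f"
proof (rule cov_greatest[OF assms(1-3) cov_nonneg[OF assms(2,4,5)]])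
  fix L assume L: "covers \<psi> f L"
  have "(\<lambda>x. \<Sum>(c, s)\<leftarrow>M. c * \<psi> (x \<otimes> s)) \<in> Cp X \<and>
      cov \<phi> (\<lambda>x. \<Sum>(c, s)\<leftarrow>M. c * \<psi> (x \<otimes> s)) \<le> cov \<phi> \<psi> * weight M"
    if "\<forall>(c, s)\<in>set M. 0 \<le> c \<and> s \<in> carrier G" for M
    using that
  proof (induction M)
    case Nil
    have "covers \<phi> (\<lambda>x. 0) []" by (simp add: covers_def)
    from cov_le[OF this] show ?case by (simp add: Cp_zero weight_def)
  next
    case (Cons p M)
    obtain c s where p: "p = (c, s)" by fastforce
    then have cs: "0 \<le> c" "s \<in> carrier G" using Cons.prems by auto
    let ?t = "\<lambda>x. \<psi> (x \<otimes> s)"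
    let ?r = "\<lambda>x. \<Sum>(c, s)\<leftarrow>M. c * \<psi> (x \<otimes> s)"
    have t: "?t \<in> Cp X" using Cp_translate assms cs by blast
    have r: "?r \<in> Cp X" "cov \<phi> ?r \<le> cov \<phi> \<psi> * weight M" using Cons by auto
    have ct: "(\<lambda>x. c * ?t x) \<in> Cp X" using t cs Cp_scale by blast
    have "cov \<phi> (\<lambda>x. c * ?t x + ?r x) \<le> cov \<phi> (\<lambda>x. c * ?t x) + cov \<phi> ?r"
      using cov_add_le[OF ct r(1) assms(4,5)] .
    also have "cov \<phi> (\<lambda>x. c * ?t x) \<le> c * cov \<phi> ?t"
      using cov_scale_le[OF t assms(4,5) cs(1)] .
    also have "c * cov \<phi> ?t \<le> c * cov \<phi> \<psi>"
      using cov_translate_le[OF assms(2,4,5) cs(2)] cs by (intro mult_left_mono)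
    finally show ?case
      using Cp_add[OF ct r(1)] r(2) by (simp add: p weight_def algebra_simps)
  qed
  from this[of L] have "(\<lambda>x. \<Sum>(c, s)\<leftarrow>L. c * \<psi> (x \<otimes> s)) \<in> Cp X"
      "cov \<phi> (\<lambda>x. \<Sum>(c, s)\<leftarrow>L. c * \<psi> (x \<otimes> s)) \<le> cov \<phi> \<psi> * weight L"
    using L unfolding covers_def by auto
  moreover have "cov \<phi> f \<le> cov \<phi> (\<lambda>x. \<Sum>(c, s)\<leftarrow>L. c * \<psi> (x \<otimes> s))"
    using L calculation(1) assms unfolding covers_def by (intro cov_mono) auto
  ultimately show "cov \<phi> f \<le> cov \<phi> \<psi> * weight L" by simp
qed


text \<open>Given a covering of slightly more than \<open>f + g\<close>, split each coefficient
  \<open>c\<close> at \<open>s\<close> in the proportions \<open>h f\<close>, \<open>h g\<close> of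
  \<open>f\<close> and \<open>g\<close> at \<open>inv s\<close>. If \<open>\<phi>\<close> lives in a
  small \<open>V\<close>, a term contributes at \<open>x\<close> only when
  \<open>x \<otimes> s \<in> V\<close>; then \<open>x = (x \<otimes> s) \<otimes> inv s\<close> is
  close to \<open>inv s\<close>, and the proportions there differ by less than
  \<open>\<delta>\<close>. The function \<open>f0\<close> is the unit in which the error is measured
  uniformly in \<open>\<phi>\<close>.\<close>

lemma cov_almost_additive:
  assumes f: "f \<in> Cp X" and g: "g \<in> Cp X" and f0: "f0 \<in> Cp X" "nz f0" and "e > 0"
  obtains V where "openin X V" "\<one> \<in> V"
    "\<And>\<phi>. \<phi> \<in> Cp X \<Longrightarrow> nz \<phi> \<Longrightarrow> (\<And>x. x \<in> carrier G \<Longrightarrow> x \<notin> V \<Longrightarrow> \<phi> x = 0) \<Longrightarrow>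
       cov \<phi> f + cov \<phi> g \<le> cov \<phi> (\<lambda>x. f x + g x) + e * cov \<phi> f0"
proof -
  have fg: "(\<lambda>x. f x + g x) \<in> Cp X" using f g by (rule Cp_add)
  obtain K where K: "compactin X K" "\<And>x. x \<in> topspace X \<Longrightarrow> x \<notin> K \<Longrightarrow> f x + g x = 0"
    using CcE[OF Cp_Cc[OF fg]] by blast
  have K0: "f x = 0 \<and> g x = 0" if "x \<in> carrier G" "x \<notin> K" for x
    using K(2)[of x] Cp_nonneg[OF f, of x] Cp_nonneg[OF g, of x] that by simp
  obtain w where w: "w \<in> Cp X" "\<And>x. x \<in> K \<Longrightarrow> w x \<ge> 1"
    using locally_compact_dominate[OF Hausdorff locally_compact K(1)] by blast
  define C1 where "C1 = cov f0 (\<lambda>x. f x + g x)"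
  define C2 where "C2 = cov f0 w"
  have C: "C1 \<ge> 0" "C2 \<ge> 0" using cov_nonneg fg w f0 by (auto simp: C1_def C2_def)
  \<comment> \<open>The final error is at most \<open>\<delta> * (2 * C1 + 3 * C2)\<close> times
    \<open>cov \<phi> f0\<close>, where \<open>\<delta> \<le> 1\<close> absorbs the quadratic term;
    the added \<open>1\<close> keeps the denominator positive.\<close>
  define \<delta> where "\<delta> = min 1 (e / (2 * C1 + 3 * C2 + 1))"
  have \<delta>: "\<delta> > 0" "\<delta> \<le> 1" using C assms(5) by (auto simp: \<delta>_def)
  have \<delta>e: "2 * \<delta> * (C1 + \<delta> * C2) + \<delta> * C2 \<le> e"
  proof -
    have "\<delta> * (\<delta> * C2) \<le> \<delta> * C2"
      using \<delta> C by (intro mult_left_mono) (auto intro: mult_left_le_one_le)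
    then have "2 * \<delta> * (C1 + \<delta> * C2) + \<delta> * C2 \<le> \<delta> * (2 * C1 + 3 * C2)" by (simp add: algebra_simps)
    also have "\<dots> \<le> \<delta> * (2 * C1 + 3 * C2 + 1)" using \<delta> by simp
    also have "\<dots> \<le> e / (2 * C1 + 3 * C2 + 1) * (2 * C1 + 3 * C2 + 1)"
      using C by (intro mult_right_mono) (auto simp: \<delta>_def)
    also have "\<dots> = e" using C by simp
    finally show ?thesis .
  qed
  \<comment> \<open>The added \<open>\<delta>\<close> keeps the denominator positive everywhere. On
    \<open>K\<close> it is dominated by the \<open>F\<close> below, since \<open>w \<ge> 1\<close>
    there.\<close>
  define D where "D = (\<lambda>x. f x + g x + \<delta>)"
  have D: "D x > 0" if "x \<in> carrier G" for x
    using Cp_nonneg[OF fg, of x] that \<delta> by (simp add: D_def)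
  have Dc: "continuous_map X euclideanreal (\<lambda>x. inverse (D x))"
  proof (rule continuous_map_real_inverse)
    show "continuous_map X euclideanreal D"
      unfolding D_def using Cc_continuous[OF Cp_Cc[OF fg]] by (rule continuous_map_add) simp
    show "D x \<noteq> 0" if "x \<in> topspace X" for x
      using D[of x] that by auto
  qed
  define h where "h = (\<lambda>p x. p x * inverse (D x))"
  have hc: "h p \<in> Cc X" if "p \<in> {f, g}" for p
    unfolding h_def using Cc_mult[OF Cp_Cc Dc] f g that by auto
  have h0: "h p x \<ge> 0" if "p \<in> {f, g}" "x \<in> carrier G" for p x
    using Cp_nonneg[OF f, of x] Cp_nonneg[OF g, of x] D[OF that(2)] that by (auto simp: h_def)
  have h1: "h f x + h g x \<le> 1" if "x \<in> carrier G" for x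
  proof -
    have "h f x + h g x = (f x + g x) / D x" by (simp add: h_def divide_inverse distrib_right)
    also have "\<dots> \<le> 1" using D[OF that] \<delta> by (simp add: D_def)
    finally show ?thesis .
  qed
  obtain V1 where V1: "openin X V1" "\<one> \<in> V1"
      "\<And>v y. v \<in> V1 \<Longrightarrow> y \<in> carrier G \<Longrightarrow> \<bar>h f (v \<otimes> y) - h f y\<bar> < \<delta>"
    using Cc_left_uniformly_continuous[OF hc \<delta>(1)] by blast
  obtain V2 where V2: "openin X V2" "\<one> \<in> V2"
      "\<And>v y. v \<in> V2 \<Longrightarrow> y \<in> carrier G \<Longrightarrow> \<bar>h g (v \<otimes> y) - h g y\<bar> < \<delta>"
    using Cc_left_uniformly_continuous[OF hc \<delta>(1)] by blast
  define V where "V = V1 \<inter> V2"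
  have V: "\<And>p v y. p \<in> {f, g} \<Longrightarrow> v \<in> V \<Longrightarrow> y \<in> carrier G \<Longrightarrow> \<bar>h p (v \<otimes> y) - h p y\<bar> < \<delta>"
    using V1 V2 by (auto simp: V_def)
  show ?thesis
  proof
    show "openin X V" "\<one> \<in> V" using V1 V2 by (auto simp: V_def)
    fix \<phi> assume \<phi>: "\<phi> \<in> Cp X" "nz \<phi>" and \<phi>V: "\<And>x. x \<in> carrier G \<Longrightarrow> x \<notin> V \<Longrightarrow> \<phi> x = 0"
    define F where "F = (\<lambda>x. (f x + g x) + \<delta> * w x)"
    have dw: "(\<lambda>x. \<delta> * w x) \<in> Cp X" using w(1) \<delta> by (intro Cp_scale) auto
    have F: "F \<in> Cp X" unfolding F_def using fg dw by (rule Cp_add)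
    have main: "cov \<phi> f + cov \<phi> g \<le> (1 + 2 * \<delta>) * cov \<phi> F"
    proof (rule cov_greatest[OF F \<phi>])
      fix L assume L: "covers \<phi> F L"
      have Ls: "0 \<le> c \<and> s \<in> carrier G" if "(c, s) \<in> set L" for c s
        using L that unfolding covers_def by auto
      let ?L = "\<lambda>p. map (\<lambda>(c, s). (c * (h p (inv s) + \<delta>), s)) L"
      have cL: "covers \<phi> p (?L p)" if p: "p \<in> {f, g}" for p
        unfolding covers_def
      proof (intro conjI ballI)
        show "case q of (c, s) \<Rightarrow> 0 \<le> c \<and> s \<in> carrier G" if "q \<in> set (?L p)" for q
          using that Ls h0[OF p] \<delta> by (fastforce intro!: mult_nonneg_nonneg add_nonneg_nonneg)
        fix x assume x: "x \<in> carrier G"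
        have eq: "(\<Sum>(c, s)\<leftarrow>?L p. c * \<phi> (x \<otimes> s)) = (\<Sum>(c, s)\<leftarrow>L. c * (h p (inv s) + \<delta>) * \<phi> (x \<otimes> s))"
          by (simp add: o_def case_prod_unfold)
        have t0: "0 \<le> c * (h p (inv s) + \<delta>) * \<phi> (x \<otimes> s)" if "(c, s) \<in> set L" for c s
          using Ls[OF that] h0[OF p, of "inv s"] \<delta> Cp_nonneg[OF \<phi>(1), of "x \<otimes> s"] x
          by (intro mult_nonneg_nonneg) auto
        show "p x \<le> (\<Sum>(c, s)\<leftarrow>?L p. c * \<phi> (x \<otimes> s))"
        proof (cases "x \<in> K")
          case False
          then have "p x = 0" using K0 x p by auto
          also have "0 \<le> (\<Sum>(c, s)\<leftarrow>L. c * (h p (inv s) + \<delta>) * \<phi> (x \<otimes> s))"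
            using t0 by (intro sum_list_nonneg) auto
          finally show ?thesis using eq by simp
        next
          case True
          have "p x = h p x * D x" using D[OF x] by (simp add: h_def)
          also have "\<dots> \<le> h p x * F x"
            using w(2)[OF True] \<delta> h0[OF p x] by (intro mult_left_mono) (auto simp: D_def F_def)
          also have "\<dots> \<le> h p x * (\<Sum>(c, s)\<leftarrow>L. c * \<phi> (x \<otimes> s))"
            using L x h0[OF p x] unfolding covers_def by (intro mult_left_mono) auto
          also have "\<dots> = (\<Sum>(c, s)\<leftarrow>L. h p x * (c * \<phi> (x \<otimes> s)))"
            by (simp add: case_prod_unfold sum_list_const_mult)
          also have "\<dots> \<le> (\<Sum>(c, s)\<leftarrow>L. c * (h p (inv s) + \<delta>) * \<phi> (x \<otimes> s))"
          proof (rule sum_list_mono)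
            fix q assume "q \<in> set L"
            then obtain c s where q: "q = (c, s)" "(c, s) \<in> set L" by (metis surj_pair)
            note cs = Ls[OF q(2)]
            have "h p x * (c * \<phi> (x \<otimes> s)) \<le> c * (h p (inv s) + \<delta>) * \<phi> (x \<otimes> s)"
            proof (cases "x \<otimes> s \<in> V")
              case False
              then show ?thesis using \<phi>V cs x by simp
            next
              case True
              have "(x \<otimes> s) \<otimes> inv s = x" using cs x by (simp add: m_assoc)
              then have "h p x \<le> h p (inv s) + \<delta>" using V[OF p True, of "inv s"] cs by auto
              moreover have "0 \<le> c * \<phi> (x \<otimes> s)" using cs x Cp_nonneg[OF \<phi>(1), of "x \<otimes> s"] by auto
              ultimately have "h p x * (c * \<phi> (x \<otimes> s)) \<le> (h p (inv s) + \<delta>) * (c * \<phi> (x \<otimes> s))"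
                by (rule mult_right_mono)
              then show ?thesis by (simp add: mult_ac)
            qed
            then show "(case q of (c, s) \<Rightarrow> h p x * (c * \<phi> (x \<otimes> s))) \<le>
                (case q of (c, s) \<Rightarrow> c * (h p (inv s) + \<delta>) * \<phi> (x \<otimes> s))" using q by simp
          qed
          finally show ?thesis using eq by simp
        qed
      qed
      have "cov \<phi> f + cov \<phi> g \<le> weight (?L f) + weight (?L g)"
        using cov_le[OF cL] by (intro add_mono) auto
      also have "\<dots> = (\<Sum>(c, s)\<leftarrow>L. c * (h f (inv s) + h g (inv s) + 2 * \<delta>))"
        by (simp add: weight_def o_def case_prod_unfold algebra_simps flip: sum_list_addf)
      also have "\<dots> \<le> (\<Sum>(c, s)\<leftarrow>L. (1 + 2 * \<delta>) * c)"
      proof (rule sum_list_mono)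
        fix q assume "q \<in> set L"
        then obtain c s where q: "q = (c, s)" "(c, s) \<in> set L" by (metis surj_pair)
        have "c * (h f (inv s) + h g (inv s) + 2 * \<delta>) \<le> c * (1 + 2 * \<delta>)"
          using Ls[OF q(2)] h1[of "inv s"] by (intro mult_left_mono) auto
        then show "(case q of (c, s) \<Rightarrow> c * (h f (inv s) + h g (inv s) + 2 * \<delta>)) \<le>
            (case q of (c, s) \<Rightarrow> (1 + 2 * \<delta>) * c)" using q by (simp add: mult.commute)
      qed
      also have "\<dots> = (1 + 2 * \<delta>) * weight L"
        by (simp add: weight_def case_prod_unfold sum_list_const_mult)
      finally show "cov \<phi> f + cov \<phi> g \<le> (1 + 2 * \<delta>) * weight L" .
    qed (use \<delta> in simp)
    let ?c0 = "cov \<phi> f0"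
    have c0: "?c0 \<ge> 0" using cov_nonneg f0 \<phi> by blast
    have a1: "cov \<phi> (\<lambda>x. f x + g x) \<le> ?c0 * C1"
      unfolding C1_def using cov_trans[OF fg f0 \<phi>] .
    have a2: "cov \<phi> w \<le> ?c0 * C2"
      unfolding C2_def using cov_trans[OF w(1) f0 \<phi>] .
    have "cov \<phi> F \<le> cov \<phi> (\<lambda>x. f x + g x) + cov \<phi> (\<lambda>x. \<delta> * w x)"
      unfolding F_def using cov_add_le[OF fg dw \<phi>] .
    also have "cov \<phi> (\<lambda>x. \<delta> * w x) \<le> \<delta> * cov \<phi> w"
      using cov_scale_le[OF w(1) \<phi>] \<delta> by simp
    also have "\<delta> * cov \<phi> w \<le> \<delta> * (?c0 * C2)" using a2 \<delta> by (intro mult_left_mono) auto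
    finally have a3: "cov \<phi> F \<le> cov \<phi> (\<lambda>x. f x + g x) + \<delta> * (?c0 * C2)" by simp
    then have "(1 + 2 * \<delta>) * cov \<phi> F \<le> (1 + 2 * \<delta>) * (cov \<phi> (\<lambda>x. f x + g x) + \<delta> * (?c0 * C2))"
      using \<delta> by (intro mult_left_mono) auto
    also have "\<dots> = cov \<phi> (\<lambda>x. f x + g x) + 2 * \<delta> * cov \<phi> (\<lambda>x. f x + g x) + (1 + 2 * \<delta>) * (\<delta> * (?c0 * C2))"
      by (simp add: algebra_simps)
    also have "\<dots> \<le> cov \<phi> (\<lambda>x. f x + g x) + 2 * \<delta> * (?c0 * C1) + (1 + 2 * \<delta>) * (\<delta> * (?c0 * C2))"
      using a1 \<delta> c0 by (intro add_mono mult_left_mono) auto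
    also have "\<dots> = cov \<phi> (\<lambda>x. f x + g x) + (2 * \<delta> * (C1 + \<delta> * C2) + \<delta> * C2) * ?c0"
      by (simp add: algebra_simps)
    also have "\<dots> \<le> cov \<phi> (\<lambda>x. f x + g x) + e * ?c0"
      using \<delta>e c0 by (intro add_mono mult_right_mono) auto
    finally show "cov \<phi> f + cov \<phi> g \<le> cov \<phi> (\<lambda>x. f x + g x) + e * cov \<phi> f0"
      using main by linarith
  qed
qed

section \<open>The limit of normalised covering numbers and the integral\<close>

definition "supported_in V = {\<phi> \<in> Cp X. nz \<phi> \<and> (\<forall>x\<in>carrier G. x \<notin> V \<longrightarrow> \<phi> x = 0)}"

lemma exists_supported_in:
  assumes "openin X V" "\<one> \<in> V"
  shows "supported_in V \<noteq> {}"
proof -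
  obtain \<phi> where "\<phi> \<in> Cp X" "\<phi> \<one> = 1" "\<And>x. x \<in> topspace X \<Longrightarrow> x \<notin> V \<Longrightarrow> \<phi> x = 0"
    using locally_compact_bump[OF Hausdorff locally_compact assms] by blast
  then have "\<phi> \<in> supported_in V" by (auto simp: supported_in_def nz_def intro!: bexI[of _ \<one>])
  then show ?thesis by blast
qed

text \<open>A cluster point of the normalised covering numbers \<open>(f : \<phi>) / (f0 : \<phi>)\<close>, as the support of
  \<open>\<phi>\<close> shrinks to \<open>\<one>\<close>, exists by Tychonoff's theorem because \<open>(f : \<phi>) / (f0 : \<phi>) \<le> (f : f0)\<close>.\<close>

lemma covering_number_limit:
  assumes f0: "f0 \<in> Cp X" "nz f0"
  obtains J F where "F \<noteq> bot"
    "\<And>V. openin X V \<Longrightarrow> \<one> \<in> V \<Longrightarrow> eventually (\<lambda>\<phi>. \<phi> \<in> supported_in V) F"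
    "\<And>f. f \<in> Cp X \<Longrightarrow> ((\<lambda>\<phi>. cov \<phi> f / cov \<phi> f0) \<longlongrightarrow> J f) F"
proof -
  \<comment> \<open>The value \<open>0\<close> off \<open>Cp X\<close> lets the values range over a
    product of compact intervals indexed by all functions.\<close>
  define N where "N = (\<lambda>\<phi> f. if f \<in> Cp X then cov \<phi> f / cov \<phi> f0 else 0)"
  define B where "B = (\<lambda>f. if f \<in> Cp X then cov f0 f else 0)"
  let ?\<V> = "{V. openin X V \<and> \<one> \<in> V}"
  \<comment> \<open>The filter of comparison functions with support shrinking to
    \<open>\<one>\<close>; intersecting neighbourhoods shows that the family is a filter
    base.\<close>
  define E where "E = (INF V\<in>?\<V>. principal (supported_in V))"
  have evE: "eventually P E \<longleftrightarrow> (\<exists>V\<in>?\<V>. \<forall>\<phi>\<in>supported_in V. P \<phi>)" for P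
    unfolding E_def
  proof (subst eventually_INF_base)
    show "?\<V> \<noteq> {}" using openin_topspace[of X] by fastforce
    show "\<exists>W\<in>?\<V>. principal (supported_in W) \<le> inf (principal (supported_in U)) (principal (supported_in V))"
      if "U \<in> ?\<V>" "V \<in> ?\<V>" for U V
      using that by (intro bexI[of _ "U \<inter> V"]) (auto simp: supported_in_def)
  qed (simp add: eventually_principal)
  have Ebot: "E \<noteq> bot"
    unfolding trivial_limit_def evE using exists_supported_in by blast
  define P where "P = PiE UNIV (\<lambda>f. {0..B f})"
  have "compact P"
    using compactin_PiE[of "\<lambda>_. euclideanreal" UNIV "\<lambda>f. {0..B f}"]
    by (simp add: P_def euclidean_product_topology)
  moreover have "filtermap N E \<noteq> bot" using Ebot by (simp add: filtermap_bot_iff)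
  moreover have "eventually (\<lambda>I. I \<in> P) (filtermap N E)"
  proof -
    have "N \<phi> f \<in> {0..B f}" if "\<phi> \<in> supported_in (carrier G)" for \<phi> f
    proof (cases "f \<in> Cp X")
      case True
      have \<phi>: "\<phi> \<in> Cp X" "nz \<phi>" using that by (auto simp: supported_in_def)
      have "cov \<phi> f \<le> cov \<phi> f0 * cov f0 f" using cov_trans[OF True f0 \<phi>] .
      then show ?thesis
        using True cov_pos[OF f0(1) \<phi> f0(2)] cov_nonneg[OF True \<phi>]
        by (simp add: N_def B_def field_simps)
    qed (simp add: N_def B_def)
    moreover have "carrier G \<in> ?\<V>" using openin_topspace[of X] by simp
    ultimately show ?thesis
      unfolding eventually_filtermap evE P_def by (intro bexI[of _ "carrier G"]) auto
  qed
  ultimately obtain J where J: "inf (nhds J) (filtermap N E) \<noteq> bot"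
    unfolding compact_filter by blast
  \<comment> \<open>Refining \<open>E\<close> by the preimages of neighbourhoods of \<open>J\<close>
    turns the cluster point into a limit along the finer filter.\<close>
  define F where "F = inf (filtercomap N (nhds J)) E"
  have "F \<noteq> bot"
  proof
    assume "F = bot"
    then have "eventually (\<lambda>_. False) F" by simp
    then obtain Q R where Q: "eventually Q (filtercomap N (nhds J))" and R: "eventually R E"
      and QR: "\<And>\<phi>. Q \<phi> \<Longrightarrow> R \<phi> \<Longrightarrow> False"
      unfolding F_def eventually_inf by blast
    obtain S where S: "eventually S (nhds J)" "\<And>\<phi>. S (N \<phi>) \<Longrightarrow> Q \<phi>"
      using Q eventually_filtercomap by blast
    have "eventually (\<lambda>I. \<not> S I) (filtermap N E)"
      unfolding eventually_filtermap using R by (rule eventually_mono) (use S(2) QR in blast)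
    with S(1) have "eventually (\<lambda>_. False) (inf (nhds J) (filtermap N E))"
      unfolding eventually_inf by blast
    then show False using J by (simp add: trivial_limit_def)
  qed
  moreover have "eventually (\<lambda>\<phi>. \<phi> \<in> supported_in V) F" if "openin X V" "\<one> \<in> V" for V
  proof -
    have "eventually (\<lambda>\<phi>. \<phi> \<in> supported_in V) E" unfolding evE using that by blast
    moreover have "F \<le> E" by (simp add: F_def)
    ultimately show ?thesis by (rule filter_leD[rotated])
  qed
  moreover have "((\<lambda>\<phi>. cov \<phi> f / cov \<phi> f0) \<longlongrightarrow> J f) F" if "f \<in> Cp X" for f
  proof -
    have "(N \<longlongrightarrow> J) F"
      unfolding F_def filterlim_def using filtermap_filtercomap
      by (metis filtermap_inf inf.coboundedI1 inf_le1 order_trans filtermap_mono)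
    then have "((\<lambda>\<phi>. N \<phi> f) \<longlongrightarrow> J f) F" by (simp add: tendsto_fun_iff)
    then show ?thesis using that by (simp add: N_def)
  qed
  ultimately show ?thesis by (rule that)
qed

text \<open>Inequalities between covering numbers pass to the limit. The reverse ones come from
  invertibility of scaling and translation, and for additivity from
  \<open>cov_almost_additive\<close>, whose error becomes an arbitrary \<open>e\<close> after
  division by \<open>cov \<phi> f0\<close>.\<close>

lemma Haar_on_Cp:
  obtains J :: "('a \<Rightarrow> real) \<Rightarrow> real" where
    "\<And>f g. f \<in> Cp X \<Longrightarrow> g \<in> Cp X \<Longrightarrow> J (\<lambda>x. f x + g x) = J f + J g"
    "\<And>f c. f \<in> Cp X \<Longrightarrow> c \<ge> 0 \<Longrightarrow> J (\<lambda>x. c * f x) = c * J f"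
    "\<And>f. f \<in> Cp X \<Longrightarrow> J f \<ge> 0"
    "\<And>f. f \<in> Cp X \<Longrightarrow> nz f \<Longrightarrow> J f > 0"
    "\<And>f b. f \<in> Cp X \<Longrightarrow> b \<in> carrier G \<Longrightarrow> J (\<lambda>x. f (x \<otimes> b)) = J f"
proof -
  obtain f0 where f0: "f0 \<in> Cp X" "nz f0"
    using exists_supported_in[of "carrier G"] openin_topspace[of X] by (auto simp: supported_in_def)
  obtain J F where F: "F \<noteq> bot" and ev: "\<And>V. openin X V \<Longrightarrow> \<one> \<in> V \<Longrightarrow> eventually (\<lambda>\<phi>. \<phi> \<in> supported_in V) F"
    and lim: "\<And>f. f \<in> Cp X \<Longrightarrow> ((\<lambda>\<phi>. cov \<phi> f / cov \<phi> f0) \<longlongrightarrow> J f) F"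
    by (rule covering_number_limit[OF f0]) (rule that, assumption+)
  have ev1: "eventually (\<lambda>\<phi>. \<phi> \<in> Cp X \<and> nz \<phi> \<and> cov \<phi> f0 > 0) F"
    using ev[of "carrier G"] openin_topspace[of X]
    by (auto simp: supported_in_def elim!: eventually_mono intro: cov_pos f0)
  have mono: "J f \<le> J g" if "f \<in> Cp X" "g \<in> Cp X" "\<And>x. x \<in> carrier G \<Longrightarrow> f x \<le> g x" for f g
  proof (rule tendsto_le[OF F lim[OF that(2)] lim[OF that(1)]])
    show "eventually (\<lambda>\<phi>. cov \<phi> f / cov \<phi> f0 \<le> cov \<phi> g / cov \<phi> f0) F"
      using ev1 by (rule eventually_mono) (use that cov_mono in \<open>auto intro!: divide_right_mono\<close>)
  qed
  have scale_le: "J (\<lambda>x. c * f x) \<le> c * J f" if "f \<in> Cp X" "c \<ge> 0" for f c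
  proof (rule tendsto_le[OF F tendsto_mult[OF tendsto_const lim[OF that(1)]] lim[OF Cp_scale[OF that]]])
    show "eventually (\<lambda>\<phi>. cov \<phi> (\<lambda>x. c * f x) / cov \<phi> f0 \<le> c * (cov \<phi> f / cov \<phi> f0)) F"
      using ev1 by (rule eventually_mono) (use that cov_scale_le in \<open>auto simp: divide_simps\<close>)
  qed
  have nonneg: "J f \<ge> 0" if "f \<in> Cp X" for f
  proof (rule tendsto_lowerbound[OF lim[OF that] _ F])
    show "eventually (\<lambda>\<phi>. 0 \<le> cov \<phi> f / cov \<phi> f0) F"
      using ev1 by (rule eventually_mono) (use that cov_nonneg in auto)
  qed
  have trans_le: "J (\<lambda>x. f (x \<otimes> b)) \<le> J f" if "f \<in> Cp X" "b \<in> carrier G" for f b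
  proof (rule tendsto_le[OF F lim[OF that(1)] lim[OF Cp_translate[OF that]]])
    show "eventually (\<lambda>\<phi>. cov \<phi> (\<lambda>x. f (x \<otimes> b)) / cov \<phi> f0 \<le> cov \<phi> f / cov \<phi> f0) F"
      using ev1 by (rule eventually_mono) (use that cov_translate_le in \<open>auto intro!: divide_right_mono\<close>)
  qed
  show ?thesis
  proof
    show "J (\<lambda>x. c * f x) = c * J f" if "f \<in> Cp X" "c \<ge> 0" for f c
    proof (cases "c = 0")
      case True
      then show ?thesis using scale_le[OF that] nonneg[OF Cp_scale[OF that]] by simp
    next
      case False
      have "J (\<lambda>x. inverse c * (c * f x)) \<le> inverse c * J (\<lambda>x. c * f x)"
        using scale_le[OF Cp_scale[OF that], of "inverse c"] that by simp
      then have "J f \<le> inverse c * J (\<lambda>x. c * f x)" using False by (simp flip: mult.assoc)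
      then have "c * J f \<le> J (\<lambda>x. c * f x)" using False that(2) by (simp add: field_simps)
      then show ?thesis using scale_le[OF that] by simp
    qed
    show "J f \<ge> 0" if "f \<in> Cp X" for f using nonneg[OF that] .
    show "J f > 0" if "f \<in> Cp X" "nz f" for f
    proof -
      have c: "cov f f0 > 0" using cov_pos f0 that by blast
      \<comment> \<open>Covering \<open>f0\<close> by translates of \<open>f\<close> gives
        \<open>(f0 : \<phi>) \<le> (f0 : f) (f : \<phi>)\<close>, a lower bound for the quotients
        that survives the limit.\<close>
      have "1 / cov f f0 \<le> J f"
      proof (rule tendsto_lowerbound[OF lim[OF that(1)] _ F])
        show "eventually (\<lambda>\<phi>. 1 / cov f f0 \<le> cov \<phi> f / cov \<phi> f0) F"
          using ev1
        proof (rule eventually_mono)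
          fix \<phi> assume \<phi>: "\<phi> \<in> Cp X \<and> nz \<phi> \<and> cov \<phi> f0 > 0"
          then have "cov \<phi> f0 \<le> cov \<phi> f * cov f f0" using cov_trans[OF f0(1) that] by blast
          then show "1 / cov f f0 \<le> cov \<phi> f / cov \<phi> f0" using c \<phi> by (simp add: field_simps)
        qed
      qed
      then show ?thesis using c by (meson less_le_trans zero_less_divide_1_iff)
    qed
    show "J (\<lambda>x. f (x \<otimes> b)) = J f" if "f \<in> Cp X" "b \<in> carrier G" for f b
    proof (rule antisym[OF trans_le[OF that]])
      have t: "(\<lambda>x. f (x \<otimes> b)) \<in> Cp X" "(\<lambda>x. f (x \<otimes> inv b \<otimes> b)) \<in> Cp X"
        using Cp_translate that Cp_translate[OF Cp_translate[OF that], of "inv b"] by auto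
      have "J f \<le> J (\<lambda>x. f (x \<otimes> inv b \<otimes> b))"
        using that t by (intro mono) (auto simp: m_assoc)
      also have "\<dots> \<le> J (\<lambda>x. f (x \<otimes> b))"
        using trans_le[OF t(1), of "inv b"] that by simp
      finally show "J f \<le> J (\<lambda>x. f (x \<otimes> b))" .
    qed
    show "J (\<lambda>x. f x + g x) = J f + J g" if fg: "f \<in> Cp X" "g \<in> Cp X" for f g
    proof (rule antisym)
      show "J (\<lambda>x. f x + g x) \<le> J f + J g"
      proof (rule tendsto_le[OF F tendsto_add[OF lim[OF that(1)] lim[OF that(2)]] lim[OF Cp_add[OF that]]])
        show "eventually (\<lambda>\<phi>. cov \<phi> (\<lambda>x. f x + g x) / cov \<phi> f0 \<le> cov \<phi> f / cov \<phi> f0 + cov \<phi> g / cov \<phi> f0) F"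
          using ev1
          by (rule eventually_mono)
             (use that cov_add_le in \<open>auto intro!: divide_right_mono simp flip: add_divide_distrib\<close>)
      qed
      show "J f + J g \<le> J (\<lambda>x. f x + g x)"
      proof (rule field_le_epsilon)
        fix e :: real assume "e > 0"
        then obtain V where V: "openin X V" "\<one> \<in> V"
            "\<And>\<phi>. \<phi> \<in> Cp X \<Longrightarrow> nz \<phi> \<Longrightarrow> (\<And>x. x \<in> carrier G \<Longrightarrow> x \<notin> V \<Longrightarrow> \<phi> x = 0) \<Longrightarrow>
              cov \<phi> f + cov \<phi> g \<le> cov \<phi> (\<lambda>x. f x + g x) + e * cov \<phi> f0"
          using cov_almost_additive[OF fg f0] by blast
        show "J f + J g \<le> J (\<lambda>x. f x + g x) + e"
        proof (rule tendsto_le[OF F tendsto_add[OF lim[OF Cp_add[OF that]] tendsto_const]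
              tendsto_add[OF lim[OF that(1)] lim[OF that(2)]]])
          show "eventually (\<lambda>\<phi>. cov \<phi> f / cov \<phi> f0 + cov \<phi> g / cov \<phi> f0
              \<le> cov \<phi> (\<lambda>x. f x + g x) / cov \<phi> f0 + e) F"
            using ev1 ev[OF V(1,2)]
          proof eventually_elim
            case (elim \<phi>)
            then have "cov \<phi> f + cov \<phi> g \<le> cov \<phi> (\<lambda>x. f x + g x) + e * cov \<phi> f0"
              using V(3)[of \<phi>] by (auto simp: supported_in_def)
            then have "(cov \<phi> f + cov \<phi> g) / cov \<phi> f0 \<le> (cov \<phi> (\<lambda>x. f x + g x) + e * cov \<phi> f0) / cov \<phi> f0"
              using elim by (intro divide_right_mono) auto
            then show ?case using elim by (simp add: add_divide_distrib)
          qed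
        qed
      qed
    qed
  qed
qed

theorem Haar_integral_exists:
  obtains I :: "('a \<Rightarrow> real) \<Rightarrow> real" where
    "\<And>u v. u \<in> Cc X \<Longrightarrow> v \<in> Cc X \<Longrightarrow> I (\<lambda>x. u x + v x) = I u + I v"
    "\<And>u c. u \<in> Cc X \<Longrightarrow> I (\<lambda>x. c * u x) = c * I u"
    "\<And>u. u \<in> Cp X \<Longrightarrow> I u \<ge> 0"
    "\<And>u x. u \<in> Cp X \<Longrightarrow> x \<in> carrier G \<Longrightarrow> u x > 0 \<Longrightarrow> I u > 0"
    "\<And>u b. u \<in> Cc X \<Longrightarrow> b \<in> carrier G \<Longrightarrow> I (\<lambda>x. u (x \<otimes> b)) = I u"
proof -
  obtain J :: "('a \<Rightarrow> real) \<Rightarrow> real" where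
    Jadd: "\<And>f g. f \<in> Cp X \<Longrightarrow> g \<in> Cp X \<Longrightarrow> J (\<lambda>x. f x + g x) = J f + J g" and
    Jscale: "\<And>f c. f \<in> Cp X \<Longrightarrow> c \<ge> 0 \<Longrightarrow> J (\<lambda>x. c * f x) = c * J f" and
    Jnn: "\<And>f. f \<in> Cp X \<Longrightarrow> J f \<ge> 0" and
    Jpos: "\<And>f. f \<in> Cp X \<Longrightarrow> nz f \<Longrightarrow> J f > 0" and
    Jtr: "\<And>f b. f \<in> Cp X \<Longrightarrow> b \<in> carrier G \<Longrightarrow> J (\<lambda>x. f (x \<otimes> b)) = J f"
    using Haar_on_Cp by blast
  define I where "I = (\<lambda>u. J (\<lambda>x. max (u x) 0) - J (\<lambda>x. max (- u x) 0))"
  \<comment> \<open>Any decomposition gives the same value: move the negative parts to the other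
    sides and use additivity of \<open>J\<close> on \<open>Cp X\<close>.\<close>
  have I: "I u = J p - J q" if "u \<in> Cc X" "p \<in> Cp X" "q \<in> Cp X" "\<And>x. u x = p x - q x" for u p q
  proof -
    have "(\<lambda>x. max (u x) 0 + q x) = (\<lambda>x. p x + max (- u x) 0)"
      using that(4) by (auto simp: fun_eq_iff max_def)
    then have "J (\<lambda>x. max (u x) 0) + J q = J p + J (\<lambda>x. max (- u x) 0)"
      using Jadd[OF Cc_pos_part[OF that(1)] that(3)] Jadd[OF that(2) Cc_neg_part[OF that(1)]] by simp
    then show ?thesis by (simp add: I_def)
  qed
  have IJ: "I u = J u" if "u \<in> Cp X" for u
    using I[OF Cp_Cc[OF that] that Cp_zero] Jscale[OF Cp_zero, of 0] by simp
  show ?thesis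
  proof
    fix u v assume u: "u \<in> Cc X" and v: "v \<in> Cc X"
    note pu = Cc_pos_part[OF u] and nu = Cc_neg_part[OF u] and pv = Cc_pos_part[OF v] and nv = Cc_neg_part[OF v]
    have "I (\<lambda>x. u x + v x) = J (\<lambda>x. max (u x) 0 + max (v x) 0) - J (\<lambda>x. max (- u x) 0 + max (- v x) 0)"
      using Cc_add[OF u v] Cp_add[OF pu pv] Cp_add[OF nu nv] by (rule I) (simp add: max_def)
    then show "I (\<lambda>x. u x + v x) = I u + I v"
      using Jadd[OF pu pv] Jadd[OF nu nv] by (simp add: I_def)
  next
    fix u c assume u: "u \<in> Cc X"
    note pu = Cc_pos_part[OF u] and nu = Cc_neg_part[OF u]
    show "I (\<lambda>x. c * u x) = c * I u"
    proof (cases "c \<ge> 0")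
      case True
      have "I (\<lambda>x. c * u x) = J (\<lambda>x. c * max (u x) 0) - J (\<lambda>x. c * max (- u x) 0)"
        using Cc_scale[OF u] Cp_scale[OF pu True] Cp_scale[OF nu True]
        by (rule I) (simp add: max_def)
      then show ?thesis using Jscale[OF pu True] Jscale[OF nu True] by (simp add: I_def algebra_simps)
    next
      case False
      then have c: "- c \<ge> 0" by simp
      have "I (\<lambda>x. c * u x) = J (\<lambda>x. - c * max (- u x) 0) - J (\<lambda>x. - c * max (u x) 0)"
        using Cc_scale[OF u] Cp_scale[OF nu c] Cp_scale[OF pu c]
        by (rule I) (simp add: max_def)
      then show ?thesis using Jscale[OF pu c] Jscale[OF nu c] by (simp add: I_def algebra_simps)
    qed
  next
    show "I u \<ge> 0" if "u \<in> Cp X" for u using IJ Jnn that by simp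
    show "I u > 0" if "u \<in> Cp X" "x \<in> carrier G" "u x > 0" for u x
      using IJ Jpos that unfolding nz_def by auto
    show "I (\<lambda>x. u (x \<otimes> b)) = I u" if "u \<in> Cc X" "b \<in> carrier G" for u b
      using Jtr[OF Cc_pos_part[OF that(1)] that(2)] Jtr[OF Cc_neg_part[OF that(1)] that(2)]
      by (simp add: I_def)
  qed
qed

end


section \<open>Differentiation under a positive functional\<close>

locale positive_functional =
  fixes X :: "'g topology" and I :: "('g \<Rightarrow> real) \<Rightarrow> real"
  assumes Hausdorff: "Hausdorff_space X" and locally_compact: "locally_compact_space X"
    and add: "\<And>u v. u \<in> Cc X \<Longrightarrow> v \<in> Cc X \<Longrightarrow> I (\<lambda>x. u x + v x) = I u + I v"
    and scale: "\<And>u c. u \<in> Cc X \<Longrightarrow> I (\<lambda>x. c * u x) = c * I u"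
    and nonneg: "\<And>u. u \<in> Cp X \<Longrightarrow> I u \<ge> 0"
begin

lemma diff: "u \<in> Cc X \<Longrightarrow> v \<in> Cc X \<Longrightarrow> I (\<lambda>x. u x - v x) = I u - I v"
  using add[of u "\<lambda>x. (-1) * v x"] Cc_scale[of v X "-1"] scale[of v "-1"] by simp

text \<open>The difference vanishes on \<open>topspace X\<close>, hence it and its negative both
  belong to \<open>Cp X\<close>.\<close>

lemma cong:
  assumes "u \<in> Cc X" "v \<in> Cc X" "\<And>a. a \<in> topspace X \<Longrightarrow> u a = v a"
  shows "I u = I v"
proof -
  have "(\<lambda>a. u a - v a) \<in> Cp X" "(\<lambda>a. v a - u a) \<in> Cp X"
    using Cc_diff assms by (auto simp: Cp_def)
  from nonneg[OF this(1)] nonneg[OF this(2)] show ?thesis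
    using diff assms(1,2) by simp
qed

text \<open>With a majorant \<open>w\<close> of the indicator of \<open>K\<close>, both
  \<open>e * w + u\<close> and \<open>e * w - u\<close> are nonnegative. This is the continuity of
  positive functionals under uniform convergence with supports in a fixed compact set.\<close>

lemma bounded_on_compact:
  assumes "compactin X K"
  obtains C where "C > 0" "\<And>u e. u \<in> Cc X \<Longrightarrow> e \<ge> 0 \<Longrightarrow> (\<And>a. a \<in> topspace X \<Longrightarrow> a \<notin> K \<Longrightarrow> u a = 0) \<Longrightarrow>
      (\<And>a. a \<in> K \<Longrightarrow> \<bar>u a\<bar> \<le> e) \<Longrightarrow> \<bar>I u\<bar> \<le> e * C"
proof -
  obtain w where w: "w \<in> Cp X" "\<And>x. x \<in> K \<Longrightarrow> w x \<ge> 1"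
    using locally_compact_dominate[OF Hausdorff locally_compact assms] by blast
  show ?thesis
  proof
    \<comment> \<open>The added \<open>1\<close> makes the constant strictly positive, so that
      errors can be divided by it.\<close>
    show "I w + 1 > 0" using nonneg[OF w(1)] by simp
    fix u and e :: real
    assume u: "u \<in> Cc X" and e: "e \<ge> 0" and u0: "\<And>a. a \<in> topspace X \<Longrightarrow> a \<notin> K \<Longrightarrow> u a = 0"
      and ue: "\<And>a. a \<in> K \<Longrightarrow> \<bar>u a\<bar> \<le> e"
    have ew: "(\<lambda>x. e * w x) \<in> Cc X" using w by (intro Cc_scale Cp_Cc)
    have le: "\<bar>u a\<bar> \<le> e * w a" if "a \<in> topspace X" for a
    proof (cases "a \<in> K")
      case True
      then have "\<bar>u a\<bar> \<le> e * 1" using ue by simp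
      also have "\<dots> \<le> e * w a" using e w(2)[OF True] by (intro mult_left_mono)
      finally show ?thesis .
    next
      case False
      then show ?thesis using u0 that e Cp_nonneg[OF w(1)] by simp
    qed
    have "I (\<lambda>x. e * w x + u x) \<ge> 0"
      using Cc_add[OF ew u] le by (intro nonneg) (force simp: Cp_def)
    moreover have "I (\<lambda>x. e * w x - u x) \<ge> 0"
      using Cc_diff[OF ew u] le by (intro nonneg) (force simp: Cp_def)
    ultimately have "\<bar>I u\<bar> \<le> e * I w"
      using add[OF ew u] diff[OF ew u] scale[OF Cp_Cc[OF w(1)]] by simp
    also have "\<dots> \<le> e * (I w + 1)" using e by (intro mult_left_mono) auto
    finally show "\<bar>I u\<bar> \<le> e * (I w + 1)" .
  qed
qed

text \<open>By the mean value theorem the difference quotient at \<open>a\<close> is a partial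
  derivative at an intermediate point, and by the tube lemma this is close to the one at
  \<open>y\<close>, uniformly in \<open>a \<in> K\<close>. The derivative family again vanishes off
  \<open>K\<close>, so the induction closes.\<close>

lemma Ck_on_functional_fixed_support:
  assumes U: "openin (Euclidean_space m) U" and K: "compactin X K"
    and "PCk X m k U \<Phi>"
    and "\<And>a y. a \<in> topspace X \<Longrightarrow> a \<notin> K \<Longrightarrow> y \<in> U \<Longrightarrow> \<Phi> a y = 0"
  shows "Ck_on m k U (\<lambda>y. I (\<lambda>a. \<Phi> a y))"
  using assms(3,4)
proof (induction k arbitrary: \<Phi>)
  let ?Y = "subtopology (Euclidean_space m) U"
  have EU: "topspace (Euclidean_space m) \<inter> U = U" using openin_subset[OF U] by blast
  then have topY: "topspace ?Y = U" by simp
  obtain C where C: "C > 0" "\<And>u e. u \<in> Cc X \<Longrightarrow> e \<ge> 0 \<Longrightarrow> (\<And>a. a \<in> topspace X \<Longrightarrow> a \<notin> K \<Longrightarrow> u a = 0) \<Longrightarrow>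
      (\<And>a. a \<in> K \<Longrightarrow> \<bar>u a\<bar> \<le> e) \<Longrightarrow> \<bar>I u\<bar> \<le> e * C"
    using bounded_on_compact[OF K] by blast
  have slice: "(\<lambda>a. \<Psi> a y) \<in> Cc X"
    if "continuous_map (prod_topology X ?Y) euclideanreal (\<lambda>(a, y). \<Psi> a y)"
      "\<And>a y. a \<in> topspace X \<Longrightarrow> a \<notin> K \<Longrightarrow> y \<in> U \<Longrightarrow> \<Psi> a y = 0" "y \<in> U" for \<Psi> y
  proof (rule CcI[OF _ K])
    have "continuous_map X (prod_topology X ?Y) (\<lambda>a. (a, y))"
      using that(3) topY by (intro continuous_map_pairedI) auto
    from continuous_map_compose[OF this that(1)] show "continuous_map X euclideanreal (\<lambda>a. \<Psi> a y)"
      by (simp add: o_def)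
  qed (use that in auto)
  have unif: "\<exists>T. open T \<and> y0 \<in> T \<and> (\<forall>y\<in>T \<inter> U. \<forall>a\<in>K. \<bar>\<Psi> a y - \<Psi> a y0\<bar> < e)"
    if cont: "continuous_map (prod_topology X ?Y) euclideanreal (\<lambda>(a, y). \<Psi> a y)" and y0: "y0 \<in> U" and "e > 0"
    for \<Psi> y0 e
  proof -
    have "continuous_map (prod_topology X ?Y) (prod_topology X ?Y) (\<lambda>p. (fst p, y0))"
      using y0 topY by (intro continuous_map_pairedI continuous_map_fst) auto
    from continuous_map_compose[OF this cont]
    have "continuous_map (prod_topology X ?Y) euclideanreal (\<lambda>p. \<Psi> (fst p) y0)" by (simp add: o_def)
    then have "continuous_map (prod_topology X ?Y) euclideanreal (\<lambda>p. \<bar>\<Psi> (fst p) (snd p) - \<Psi> (fst p) y0\<bar>)"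
      using cont by (intro continuous_map_real_abs continuous_map_diff) (auto simp: case_prod_unfold)
    from openin_continuous_map_preimage[OF this, of "{..<e}"]
    have O: "openin (prod_topology X ?Y) {p \<in> topspace X \<times> U. \<bar>\<Psi> (fst p) (snd p) - \<Psi> (fst p) y0\<bar> < e}"
      (is "openin _ ?O") by (simp add: EU)
    have "K \<times> {y0} \<subseteq> ?O" using compactin_subset_topspace[OF K] y0 \<open>e > 0\<close> by auto
    moreover have "compactin ?Y {y0}" using y0 topY by simp
    ultimately obtain P Q where PQ: "openin X P" "openin ?Y Q" "K \<subseteq> P" "{y0} \<subseteq> Q" "P \<times> Q \<subseteq> ?O"
      using Wallace_theorem_prod_topology[OF K _ O] by blast
    obtain S where S: "openin (Euclidean_space m) S" "Q = S \<inter> U" using PQ(2) openin_subtopology by metis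
    obtain T where T: "open T" "S = {x. \<forall>i\<ge>m. x i = 0} \<inter> T" using S(1) openin_Euclidean_space_iff by auto
    have "\<bar>\<Psi> a y - \<Psi> a y0\<bar> < e" if "y \<in> T \<inter> U" "a \<in> K" for a y
    proof -
      have "y \<in> Q" using that S(2) T(2) openin_Euclidean_spaceD[OF U] by auto
      then have "(a, y) \<in> ?O" using that PQ(3,5) by blast
      then show ?thesis by simp
    qed
    moreover have "y0 \<in> T" using PQ(4) S T by auto
    ultimately show ?thesis using T(1) by blast
  qed
  have cont: "continuous_on U (\<lambda>y. I (\<lambda>a. \<Psi> a y))"
    if \<Psi>: "continuous_map (prod_topology X ?Y) euclideanreal (\<lambda>(a, y). \<Psi> a y)"
      "\<And>a y. a \<in> topspace X \<Longrightarrow> a \<notin> K \<Longrightarrow> y \<in> U \<Longrightarrow> \<Psi> a y = 0" for \<Psi>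
    unfolding continuous_on_def
  proof (intro ballI tendstoI)
    fix y0 and e :: real assume y0: "y0 \<in> U" and e: "e > 0"
    \<comment> \<open>Half of \<open>e / C\<close>, so that the weak bound \<open>e' * C\<close>
      yields a strict one by \<open>e\<close>.\<close>
    define e' where "e' = e / (2 * C)"
    have e': "e' > 0" "e' * C < e" using e C(1) by (auto simp: e'_def)
    obtain T where T: "open T" "y0 \<in> T" "\<And>y a. y \<in> T \<Longrightarrow> y \<in> U \<Longrightarrow> a \<in> K \<Longrightarrow> \<bar>\<Psi> a y - \<Psi> a y0\<bar> < e'"
      using unif[OF \<Psi>(1) y0 e'(1)] by blast
    have "dist (I (\<lambda>a. \<Psi> a y)) (I (\<lambda>a. \<Psi> a y0)) < e" if "y \<in> T" "y \<in> U" for y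
    proof -
      have sl: "(\<lambda>a. \<Psi> a y) \<in> Cc X" "(\<lambda>a. \<Psi> a y0) \<in> Cc X"
        using slice[OF \<Psi>(1)] \<Psi>(2) \<open>y \<in> U\<close> y0 by blast+
      have "\<bar>I (\<lambda>a. \<Psi> a y - \<Psi> a y0)\<bar> \<le> e' * C"
      proof (rule C(2)[OF Cc_diff[OF sl]])
        show "\<Psi> a y - \<Psi> a y0 = 0" if "a \<in> topspace X" "a \<notin> K" for a
          using \<Psi>(2)[OF that] \<open>y \<in> U\<close> y0 by simp
        show "\<bar>\<Psi> a y - \<Psi> a y0\<bar> \<le> e'" if "a \<in> K" for a
          using T(3)[OF \<open>y \<in> T\<close> \<open>y \<in> U\<close> that] by simp
      qed (rule less_imp_le[OF e'(1)])
      then show ?thesis using diff[OF sl] e' by (simp add: dist_real_def)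
    qed
    then show "eventually (\<lambda>y. dist (I (\<lambda>a. \<Psi> a y)) (I (\<lambda>a. \<Psi> a y0)) < e) (at y0 within U)"
      unfolding eventually_at_topological using T(1,2) by blast
  qed
  {
    case 0
    then show ?case using cont by simp
  next
    case (Suc k)
    note cPhi = PCk_imp_continuous_map[OF Suc.prems(1)]
    have "\<exists>f'. (\<forall>y\<in>U. ((\<lambda>t. I (\<lambda>a. \<Phi> a (y(i := t)))) has_real_derivative f' y) (at (y i))) \<and> Ck_on m k U f'"
      if i: "i < m" for i
    proof (intro exI conjI ballI)
      have pk: "PCk X m k U (\<lambda>a. pd i (\<Phi> a))" using Suc.prems(1) i by simp
      have pder: "((\<lambda>t. \<Phi> a (y(i := t))) has_real_derivative pd i (\<Phi> a) y) (at (y i))"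
        if "a \<in> topspace X" "y \<in> U" for a y
        using Suc.prems(1) i that by simp
      note cpd = PCk_imp_continuous_map[OF pk]
      \<comment> \<open>\<open>U\<close> is open, so the function vanishes along a short segment
        through \<open>y\<close> and not only at \<open>y\<close>.\<close>
      have pd0: "pd i (\<Phi> a) y = 0" if "a \<in> topspace X" "a \<notin> K" "y \<in> U" for a y
      proof -
        have "pd i (\<Phi> a) y = pd i (\<lambda>_. 0) y"
          using Suc.prems(2) that i by (intro pd_cong[OF U]) auto
        then show ?thesis by (simp add: pd_def)
      qed
      show "Ck_on m k U (\<lambda>y. I (\<lambda>a. pd i (\<Phi> a) y))"
        using Suc.IH[OF pk] pd0 by blast
      fix y assume y: "y \<in> U"
      show "((\<lambda>t. I (\<lambda>a. \<Phi> a (y(i := t)))) has_real_derivative I (\<lambda>a. pd i (\<Phi> a) y)) (at (y i))"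
        unfolding has_field_derivative_iff
      proof (rule tendstoI)
        fix e :: real assume e: "e > 0"
        define e' where "e' = e / (2 * C)"
        have e': "e' > 0" "e' * C < e" using e C(1) by (auto simp: e'_def)
        obtain T where T: "open T" "y \<in> T"
          "\<And>z a. z \<in> T \<Longrightarrow> z \<in> U \<Longrightarrow> a \<in> K \<Longrightarrow> \<bar>pd i (\<Phi> a) z - pd i (\<Phi> a) y\<bar> < e'"
          using unif[OF cpd y e'(1)] by blast
        have "openin (Euclidean_space m) (U \<inter> T)"
          using U T(1) by (auto simp: Euclidean_space_eq openin_Int_open)
        from eventually_coord_update[OF this _ i, of y]
        obtain d where d: "d > 0" "\<And>t. \<bar>t - y i\<bar> < d \<Longrightarrow> y(i := t) \<in> U \<inter> T"
          using y T(2) by (auto simp: eventually_nhds_metric dist_real_def)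
        have "dist ((I (\<lambda>a. \<Phi> a (y(i := t))) - I (\<lambda>a. \<Phi> a (y(i := y i)))) / (t - y i)) (I (\<lambda>a. pd i (\<Phi> a) y)) < e"
          if t: "t \<noteq> y i" "\<bar>t - y i\<bar> < d" for t
        proof -
          define u where "u = (\<lambda>a. inverse (t - y i) * (\<Phi> a (y(i := t)) - \<Phi> a y))"
          have yt: "y(i := t) \<in> U" using d(2) t by blast
          have sl: "(\<lambda>a. \<Phi> a (y(i := t))) \<in> Cc X" "(\<lambda>a. \<Phi> a y) \<in> Cc X"
            using slice[OF cPhi] Suc.prems(2) yt y by blast+
          have u: "u \<in> Cc X" unfolding u_def by (rule Cc_scale[OF Cc_diff[OF sl]])
          have p: "(\<lambda>a. pd i (\<Phi> a) y) \<in> Cc X" using slice[OF cpd] pd0 y by blast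
          have Iu: "I u = (I (\<lambda>a. \<Phi> a (y(i := t))) - I (\<lambda>a. \<Phi> a y)) / (t - y i)"
            unfolding u_def using scale[OF Cc_diff[OF sl]] diff[OF sl] by (simp add: divide_inverse mult.commute)
          have "\<bar>I (\<lambda>a. u a - pd i (\<Phi> a) y)\<bar> \<le> e' * C"
          proof (rule C(2)[OF Cc_diff[OF u p]])
            show "u a - pd i (\<Phi> a) y = 0" if "a \<in> topspace X" "a \<notin> K" for a
              by (simp only: u_def Suc.prems(2)[OF that yt] Suc.prems(2)[OF that y] pd0[OF that y]) simp
            show "\<bar>u a - pd i (\<Phi> a) y\<bar> \<le> e'" if a: "a \<in> K" for a
            proof -
              have aX: "a \<in> topspace X" using a compactin_subset_topspace[OF K] by blast
              \<comment> \<open>The point \<open>s\<close> depends on \<open>a\<close>; uniformity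
                of the neighbourhood \<open>T\<close> over \<open>K\<close> makes this
                harmless.\<close>
              obtain s where s: "\<bar>s - y i\<bar> \<le> \<bar>t - y i\<bar>"
                  "\<Phi> a (y(i := t)) - \<Phi> a (y(i := y i)) = pd i (\<Phi> a) (y(i := s)) * (t - y i)"
              proof (rule MVT_between[where x = "y i" and t = t and f = "\<lambda>s. \<Phi> a (y(i := s))" and f' = "\<lambda>s. pd i (\<Phi> a) (y(i := s))"])
                fix s assume "\<bar>s - y i\<bar> \<le> \<bar>t - y i\<bar>"
                then have "y(i := s) \<in> U" using d(2)[of s] t by auto
                from pder[OF aX this]
                show "((\<lambda>s. \<Phi> a (y(i := s))) has_real_derivative pd i (\<Phi> a) (y(i := s))) (at s)" by simp
              qed
              have "u a = pd i (\<Phi> a) (y(i := s))" using s(2) t by (simp add: u_def)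
              moreover have "y(i := s) \<in> U \<inter> T" using d(2)[of s] s t by auto
              ultimately show ?thesis using T(3)[of "y(i := s)" a] a by auto
            qed
          qed (rule less_imp_le[OF e'(1)])
          then show ?thesis using diff[OF u p] e' Iu by (simp add: dist_real_def)
        qed
        then show "eventually (\<lambda>t. dist ((I (\<lambda>a. \<Phi> a (y(i := t))) - I (\<lambda>a. \<Phi> a (y(i := y i)))) / (t - y i))
            (I (\<lambda>a. pd i (\<Phi> a) y)) < e) (at (y i))"
          unfolding eventually_at using d(1) by (auto simp: dist_real_def)
      qed
    qed
    then show ?case using cont[OF cPhi Suc.prems(2)] by (intro Ck_on_SucI)
  }
qed

text \<open>The compact set may change with \<open>y\<close>, since properness of the action
  provides one only for \<open>y\<close> in a compact neighbourhood; differentiability is local, so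
  this suffices.\<close>

lemma Ck_on_functional:
  assumes U: "openin (Euclidean_space m) U" and \<Phi>: "PCk X m k U \<Phi>"
    and loc: "\<And>y. y \<in> U \<Longrightarrow> \<exists>N K. openin (Euclidean_space m) N \<and> y \<in> N \<and> N \<subseteq> U \<and> compactin X K \<and>
      (\<forall>a\<in>topspace X. \<forall>z\<in>N. a \<notin> K \<longrightarrow> \<Phi> a z = 0)"
  shows "Ck_on m k U (\<lambda>y. I (\<lambda>a. \<Phi> a y))"
proof (rule Ck_on_local[OF U])
  fix y assume "y \<in> U"
  then obtain N K where N: "openin (Euclidean_space m) N" "y \<in> N" "N \<subseteq> U" "compactin X K"
    "\<forall>a\<in>topspace X. \<forall>z\<in>N. a \<notin> K \<longrightarrow> \<Phi> a z = 0" using loc by metis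
  then have "Ck_on m k N (\<lambda>y. I (\<lambda>a. \<Phi> a y))"
    using Ck_on_functional_fixed_support[OF N(1,4) PCk_subset[OF \<Phi> N(3)]] by blast
  then show "\<exists>N. openin (Euclidean_space m) N \<and> y \<in> N \<and> N \<subseteq> U \<and> Ck_on m k N (\<lambda>y. I (\<lambda>a. \<Phi> a y))"
    using N by blast
qed

end


section \<open>Smooth functions on manifolds\<close>

lemma is_chartD:
  assumes "is_chart X m U \<phi>"
  shows "openin X U" "openin (Euclidean_space m) (\<phi> ` U)" "inj_on \<phi> U"
    "continuous_map (subtopology X U) (Euclidean_space m) \<phi>"
    "continuous_map (subtopology (Euclidean_space m) (\<phi> ` U)) X (inv_into U \<phi>)"
proof -
  show U: "openin X U" and V: "openin (Euclidean_space m) (\<phi> ` U)" using assms by (auto simp: is_chart_def)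
  let ?A = "subtopology X U" and ?B = "subtopology (Euclidean_space m) (\<phi> ` U)"
  have tops: "topspace ?A = U" "topspace ?B = \<phi> ` U" using openin_subset[OF U] openin_subset[OF V] by auto
  have h: "homeomorphic_map ?A ?B \<phi>" using assms by (simp add: is_chart_def)
  show inj: "inj_on \<phi> U" using homeomorphic_imp_injective_map[OF h] tops by simp
  show "continuous_map ?A (Euclidean_space m) \<phi>"
    using homeomorphic_imp_continuous_map[OF h] continuous_map_in_subtopology by blast
  obtain g where g: "homeomorphic_maps ?A ?B \<phi> g" using h homeomorphic_map_maps by blast
  have gc: "continuous_map ?B ?A g" and gf: "\<And>x. x \<in> U \<Longrightarrow> g (\<phi> x) = x"
    using g unfolding homeomorphic_maps_def tops by auto
  have "continuous_map ?B X g" using gc continuous_map_in_subtopology by blast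
  then show "continuous_map ?B X (inv_into U \<phi>)"
    by (rule continuous_map_eq) (use gf inj tops in auto)
qed

lemma is_chart_open_image:
  assumes "is_chart X m U \<phi>" "openin X W"
  shows "openin (Euclidean_space m) (\<phi> ` (U \<inter> W))"
proof -
  note c = is_chartD[OF assms(1)]
  have "homeomorphic_map (subtopology X U) (subtopology (Euclidean_space m) (\<phi> ` U)) \<phi>"
    using assms(1) by (simp add: is_chart_def)
  then have "open_map (subtopology X U) (subtopology (Euclidean_space m) (\<phi> ` U)) \<phi>"
    by (rule homeomorphic_imp_open_map)
  moreover have "openin (subtopology X U) (U \<inter> W)"
    using assms(2) by (metis openin_subtopology_Int2)
  ultimately have "openin (subtopology (Euclidean_space m) (\<phi> ` U)) (\<phi> ` (U \<inter> W))"
    by (simp add: open_map_def)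
  then show ?thesis using c(2) openin_trans_full by blast
qed

lemma smooth_on_imp_continuous_on: "smooth_on m U f \<Longrightarrow> continuous_on U f"
  using Ck_on_imp_continuous_on unfolding smooth_on_def by blast

lemma smooth_on_cong:
  assumes "openin (Euclidean_space m) U" "\<And>x. x \<in> U \<Longrightarrow> f x = g x" "smooth_on m U f"
  shows "smooth_on m U g"
  using assms Ck_on_cong unfolding smooth_on_def by blast

lemma smooth_on_subset: "smooth_on m U f \<Longrightarrow> V \<subseteq> U \<Longrightarrow> smooth_on m V f"
  using Ck_on_subset unfolding smooth_on_def by blast

lemma smooth_on_local:
  assumes "openin (Euclidean_space m) U"
    and "\<And>x. x \<in> U \<Longrightarrow> \<exists>N. openin (Euclidean_space m) N \<and> x \<in> N \<and> N \<subseteq> U \<and> smooth_on m N f"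
  shows "smooth_on m U f"
  unfolding smooth_on_def
proof
  show "Ck_on m k U f" for k
    using assms(2) unfolding smooth_on_def by (intro Ck_on_local[OF assms(1)]) blast
qed

lemma smooth_on_compose:
  assumes "openin (Euclidean_space m) U" "openin (Euclidean_space n) V"
    and "smooth_vec_on m n U F" "\<And>x. x \<in> U \<Longrightarrow> F x \<in> V" "smooth_on n V f"
  shows "smooth_on m U (\<lambda>x. f (F x))"
  using assms Ck_on_compose unfolding smooth_on_def smooth_vec_on_def by blast

lemma charts_of_manifold:
  assumes "smooth_manifold M" "(U, \<phi>) \<in> matlas M"
  shows "is_chart (mtop M) (mdim M) U \<phi>"
  using assms unfolding smooth_manifold_def by auto

lemma chart_at:
  assumes "smooth_manifold M" "x \<in> topspace (mtop M)"
  obtains U \<phi> where "(U, \<phi>) \<in> matlas M" "x \<in> U"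
  using assms unfolding smooth_manifold_def by blast

lemma smooth_functionsD:
  "h \<in> smooth_functions M \<Longrightarrow> (U, \<phi>) \<in> matlas M \<Longrightarrow> smooth_on (mdim M) (\<phi> ` U) (h \<circ> inv_into U \<phi>)"
  unfolding smooth_functions_def by auto

text \<open>Smoothness is defined through charts only, so continuity for the topology of the
  manifold has to be pasted together from the chart domains.\<close>

lemma smooth_functions_continuous:
  assumes M: "smooth_manifold M" and h: "h \<in> smooth_functions M"
  shows "continuous_map (mtop M) euclideanreal h"
proof (rule pasting_lemma[where I = "matlas M" and T = fst and f = "\<lambda>_. h"])
  fix c assume c: "c \<in> matlas M"
  obtain U \<phi> where U: "c = (U, \<phi>)" by fastforce
  note ch = charts_of_manifold[OF M c[unfolded U]]
  note d = is_chartD[OF ch]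
  show "openin (mtop M) (fst c)" using d(1) U by simp
  have "continuous_on (\<phi> ` U) (h \<circ> inv_into U \<phi>)"
    using smooth_functionsD[OF h] c U smooth_on_imp_continuous_on by blast
  then have hc: "continuous_map (top_of_set (\<phi> ` U)) euclideanreal (h \<circ> inv_into U \<phi>)" by simp
  have "top_of_set (\<phi> ` U) = subtopology (Euclidean_space (mdim M)) (\<phi> ` U)"
    using openin_subset[OF d(2)]
    by (auto simp: Euclidean_space_eq subtopology_subtopology topspace_Euclidean_space Int_absorb1)
  moreover have "continuous_map (subtopology (mtop M) U) (subtopology (Euclidean_space (mdim M)) (\<phi> ` U)) \<phi>"
    using d(4) by (auto simp: continuous_map_in_subtopology)
  ultimately have "continuous_map (subtopology (mtop M) U) euclideanreal ((h \<circ> inv_into U \<phi>) \<circ> \<phi>)"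
    using hc continuous_map_compose by metis
  then have "continuous_map (subtopology (mtop M) U) euclideanreal h"
    by (rule continuous_map_eq) (use d(3) in auto)
  then show "continuous_map (subtopology (mtop M) (fst c)) euclideanreal h" using U by simp
next
  fix x assume "x \<in> topspace (mtop M)"
  then show "\<exists>c. c \<in> matlas M \<and> x \<in> fst c \<and> h x = h x"
    using chart_at[OF M] by (metis fst_conv)
qed simp

text \<open>Charts may be cut down to \<open>W\<close>, where \<open>h\<close> is the smooth
  function \<open>g\<close>. This makes locally finite sums smooth and changes of values off the
  manifold harmless.\<close>

lemma smooth_functionsI_local:
  assumes M: "smooth_manifold M"
    and loc: "\<And>x. x \<in> topspace (mtop M) \<Longrightarrow>
      \<exists>W g. openin (mtop M) W \<and> x \<in> W \<and> g \<in> smooth_functions M \<and> (\<forall>y\<in>W. h y = g y)"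
  shows "h \<in> smooth_functions M"
  unfolding smooth_functions_def
proof clarify
  fix U \<phi> assume c: "(U, \<phi>) \<in> matlas M"
  note ch = charts_of_manifold[OF M c]
  note d = is_chartD[OF ch]
  show "smooth_on (mdim M) (\<phi> ` U) (h \<circ> inv_into U \<phi>)"
  proof (rule smooth_on_local[OF d(2)])
    fix q assume "q \<in> \<phi> ` U"
    then obtain x where x: "x \<in> U" "q = \<phi> x" by blast
    then have xM: "x \<in> topspace (mtop M)" using d(1) openin_subset by blast
    obtain W g where W: "openin (mtop M) W" "x \<in> W" "g \<in> smooth_functions M" "\<forall>y\<in>W. h y = g y"
      using loc[OF xM] by (elim exE conjE) (rule that)
    have o: "openin (Euclidean_space (mdim M)) (\<phi> ` (U \<inter> W))" by (rule is_chart_open_image[OF ch W(1)])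
    have "smooth_on (mdim M) (\<phi> ` (U \<inter> W)) (h \<circ> inv_into U \<phi>)"
    proof (rule smooth_on_cong[OF o])
      show "smooth_on (mdim M) (\<phi> ` (U \<inter> W)) (g \<circ> inv_into U \<phi>)"
        by (rule smooth_on_subset[OF smooth_functionsD[OF W(3) c]]) auto
      show "(g \<circ> inv_into U \<phi>) z = (h \<circ> inv_into U \<phi>) z" if "z \<in> \<phi> ` (U \<inter> W)" for z
        using that W(4) d(3) by auto
    qed
    then show "\<exists>N. openin (Euclidean_space (mdim M)) N \<and> q \<in> N \<and> N \<subseteq> \<phi> ` U \<and>
        smooth_on (mdim M) N (h \<circ> inv_into U \<phi>)"
      using o x W(2) by (intro exI[of _ "\<phi> ` (U \<inter> W)"]) auto
  qed
qed

lemma smooth_functions_cong: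
  assumes "smooth_manifold M" "g \<in> smooth_functions M" "\<And>x. x \<in> topspace (mtop M) \<Longrightarrow> h x = g x"
  shows "h \<in> smooth_functions M"
  using assms by (intro smooth_functionsI_local) auto

lemma smooth_functions_const: "(\<lambda>x. c) \<in> smooth_functions M"
  unfolding smooth_functions_def smooth_on_def by (auto simp: o_def)

lemma smooth_functions_add:
  "g \<in> smooth_functions M \<Longrightarrow> h \<in> smooth_functions M \<Longrightarrow> (\<lambda>x. g x + h x) \<in> smooth_functions M"
  unfolding smooth_functions_def smooth_on_def by (fastforce simp: o_def intro: Ck_on_add)

lemma smooth_functions_mult:
  "g \<in> smooth_functions M \<Longrightarrow> h \<in> smooth_functions M \<Longrightarrow> (\<lambda>x. g x * h x) \<in> smooth_functions M"
  unfolding smooth_functions_def smooth_on_def by (fastforce simp: o_def intro: Ck_on_mult)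

lemma smooth_functions_sum:
  "(\<And>j. j \<in> J \<Longrightarrow> g j \<in> smooth_functions M) \<Longrightarrow> (\<lambda>x. \<Sum>j\<in>J. g j x) \<in> smooth_functions M"
  by (induction J rule: infinite_finite_induct) (auto intro: smooth_functions_add smooth_functions_const)

lemma smooth_functions_prod:
  "(\<And>j. j \<in> J \<Longrightarrow> g j \<in> smooth_functions M) \<Longrightarrow> (\<lambda>x. \<Prod>j\<in>J. g j x) \<in> smooth_functions M"
  by (induction J rule: infinite_finite_induct) (auto intro: smooth_functions_mult smooth_functions_const)

lemma smooth_functions_flat:
  "g \<in> smooth_functions M \<Longrightarrow> (\<lambda>x. flat 0 (g x)) \<in> smooth_functions M"
  unfolding smooth_functions_def smooth_on_def by (fastforce simp: o_def intro: Ck_on_flat)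

lemma smooth_functions_inverse:
  assumes M: "smooth_manifold M" and g: "g \<in> smooth_functions M" "\<And>x. x \<in> topspace (mtop M) \<Longrightarrow> g x \<noteq> 0"
  shows "(\<lambda>x. inverse (g x)) \<in> smooth_functions M"
  unfolding smooth_functions_def smooth_on_def
proof clarify
  fix U \<phi> k assume c: "(U, \<phi>) \<in> matlas M"
  have "inv_into U \<phi> q \<in> topspace (mtop M)" if "q \<in> \<phi> ` U" for q
    using inv_into_into[OF that] openin_subset[OF is_chartD(1)[OF charts_of_manifold[OF M c]]] by blast
  then show "Ck_on (mdim M) k (\<phi> ` U) ((\<lambda>x. inverse (g x)) \<circ> inv_into U \<phi>)"
    using g c unfolding o_def smooth_functions_def smooth_on_def
    by (intro Ck_on_inverse) (auto simp: o_def)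
qed

lemma smooth_functions_suminf:
  assumes M: "smooth_manifold M" and u: "\<And>j. u j \<in> smooth_functions M"
    and fin: "\<And>x. x \<in> topspace (mtop M) \<Longrightarrow>
      \<exists>W J. openin (mtop M) W \<and> x \<in> W \<and> (\<forall>y\<in>W. \<forall>j\<ge>J. u j y = 0)"
  shows "(\<lambda>x. \<Sum>j::nat. u j x) \<in> smooth_functions M"
proof (rule smooth_functionsI_local[OF M])
  fix x assume x: "x \<in> topspace (mtop M)"
  obtain W J where W: "openin (mtop M) W" "x \<in> W" "\<forall>y\<in>W. \<forall>j\<ge>J. u j y = 0"
    using fin[OF x] by (elim exE conjE) (rule that)
  have "(\<Sum>j. u j y) = (\<Sum>j<J. u j y)" if "y \<in> W" for y
    using W(3) that by (intro suminf_finite) auto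
  then show "\<exists>W g. openin (mtop M) W \<and> x \<in> W \<and> g \<in> smooth_functions M \<and> (\<forall>y\<in>W. (\<Sum>j. u j y) = g y)"
    using W(1,2) u by (intro exI[of _ W] exI[of _ "\<lambda>y. \<Sum>j<J. u j y"]) (auto intro: smooth_functions_sum)
qed


section \<open>Bump functions and local compactness\<close>

lemma openin_Euclidean_space_contains_box:
  assumes "openin (Euclidean_space m) V" "p \<in> V"
  obtains e where "e > 0" "\<And>q. (\<And>i. i \<ge> m \<Longrightarrow> q i = 0) \<Longrightarrow> (\<And>i. i < m \<Longrightarrow> \<bar>q i - p i\<bar> \<le> e) \<Longrightarrow> q \<in> V"
proof -
  obtain T where T: "open T" "V = {x. \<forall>i\<ge>m. x i = 0} \<inter> T"
    using assms openin_Euclidean_space_iff by auto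
  have "openin (product_topology (\<lambda>i. euclideanreal) UNIV) T"
    using T(1) by (simp add: euclidean_product_topology)
  then obtain Y where Y: "p \<in> PiE UNIV Y" "\<And>i. open (Y i)" "PiE UNIV Y \<subseteq> T"
    using product_topology_open_contains_basis[of "\<lambda>i. euclideanreal" UNIV T p] assms(2) T(2) by auto
  have "\<exists>d>0. \<forall>s. \<bar>s - p i\<bar> < d \<longrightarrow> s \<in> Y i" for i
    using Y(2)[of i] Y(1) unfolding open_dist by (auto simp: dist_real_def PiE_iff)
  then obtain d where d: "\<And>i. d i > 0" "\<And>i s. \<bar>s - p i\<bar> < d i \<Longrightarrow> s \<in> Y i" by metis
  \<comment> \<open>The inserted \<open>1\<close> gives a minimum also for
    \<open>m = 0\<close>.\<close>
  define \<mu> where "\<mu> = Min (insert 1 (d ` {..<m}))"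
  have pos: "\<mu> > 0" unfolding \<mu>_def using d(1) by (subst Min_gr_iff) auto
  define e where "e = \<mu> / 2"
  have e: "e > 0" "\<And>i. i < m \<Longrightarrow> e < d i"
  proof -
    show "e > 0" using pos by (simp add: e_def)
    fix i assume "i < m"
    then have "\<mu> \<le> d i" unfolding \<mu>_def by (intro Min_le) auto
    then show "e < d i" using pos by (simp add: e_def)
  qed
  show ?thesis
  proof
    show "e > 0" by fact
    fix q assume q0: "\<And>i. i \<ge> m \<Longrightarrow> q i = 0" and qe: "\<And>i. i < m \<Longrightarrow> \<bar>q i - p i\<bar> \<le> e"
    \<comment> \<open>The sets \<open>Y i\<close> constrain all coordinates; those from
      \<open>m\<close> on vanish for \<open>q\<close> and \<open>p\<close> alike.\<close>
    have "q i \<in> Y i" for i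
    proof (rule d(2))
      show "\<bar>q i - p i\<bar> < d i"
      proof (cases "i < m")
        case True
        then show ?thesis using qe e(2) by fastforce
      next
        case False
        then show ?thesis using q0[of i] openin_Euclidean_spaceD[OF assms, of i] d(1) by simp
      qed
    qed
    then have "q \<in> T" using Y(3) by auto
    then show "q \<in> V" using T(2) q0 by auto
  qed
qed

text \<open>A product of flat functions is positive exactly inside an open box of a chart; the
  closed box is compact and pulls back to \<open>C\<close>. Extension by zero is smooth since the
  chart domain and the complement of \<open>C\<close>, which is closed by the Hausdorff property,
  cover \<open>M\<close>. In dimension \<open>0\<close> the empty product is \<open>1\<close> on an
  isolated point.\<close>

lemma smooth_bump:
  assumes M: "smooth_manifold M" and W: "openin (mtop M) W" "x \<in> W"
  obtains \<phi> C where "\<phi> \<in> smooth_functions M" "\<And>y. \<phi> y \<ge> 0" "\<phi> x > 0"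
    "compactin (mtop M) C" "C \<subseteq> W" "\<And>y. y \<in> topspace (mtop M) \<Longrightarrow> y \<notin> C \<Longrightarrow> \<phi> y = 0"
proof -
  let ?m = "mdim M"
  have "x \<in> topspace (mtop M)" using W openin_subset by blast
  then obtain U \<psi> where U: "(U, \<psi>) \<in> matlas M" "x \<in> U" using chart_at[OF M] by blast
  note ch = charts_of_manifold[OF M U(1)]
  note d = is_chartD[OF ch]
  define p where "p = \<psi> x"
  have V: "openin (Euclidean_space ?m) (\<psi> ` (U \<inter> W))" by (rule is_chart_open_image[OF ch W(1)])
  have pV: "p \<in> \<psi> ` (U \<inter> W)" using U W by (auto simp: p_def)
  obtain e where e: "e > 0"
    "\<And>q. (\<And>i. i \<ge> ?m \<Longrightarrow> q i = 0) \<Longrightarrow> (\<And>i. i < ?m \<Longrightarrow> \<bar>q i - p i\<bar> \<le> e) \<Longrightarrow> q \<in> \<psi> ` (U \<inter> W)"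
    using openin_Euclidean_space_contains_box[OF V pV] by blast
  \<comment> \<open>Subtraction and squares are spelled out by sums and products to match the
    closure rules for \<open>Ck_on\<close>.\<close>
  define \<beta> where "\<beta> = (\<lambda>q. \<Prod>i<?m. flat 0 (e\<^sup>2 + (-1) * ((q i + - p i) * (q i + - p i))))"
  define \<phi> where "\<phi> = (\<lambda>y. if y \<in> U then \<beta> (\<psi> y) else 0)"
  define B where "B = PiE UNIV (\<lambda>i. if i < ?m then {p i - e..p i + e} else {0})"
  define C where "C = inv_into U \<psi> ` B"
  have BV: "B \<subseteq> \<psi> ` (U \<inter> W)"
  proof
    fix q assume "q \<in> B"
    then have q: "q i \<in> (if i < ?m then {p i - e..p i + e} else {0})" for i
      using PiE_mem[of q UNIV "\<lambda>i. if i < ?m then {p i - e..p i + e} else {0}" i] by (simp only: B_def UNIV_I)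
    show "q \<in> \<psi> ` (U \<inter> W)"
    proof (rule e(2))
      show "q i = 0" if "i \<ge> ?m" for i using q[of i] that by simp
      show "\<bar>q i - p i\<bar> \<le> e" if "i < ?m" for i using q[of i] that by auto
    qed
  qed
  have "compact B"
    using compactin_PiE[of "\<lambda>_. euclideanreal" UNIV "\<lambda>i. if i < ?m then {p i - e..p i + e} else {0}"]
    by (auto simp: B_def euclidean_product_topology)
  then have "compactin (subtopology (Euclidean_space ?m) (\<psi> ` U)) B"
    using BV openin_subset[OF V]
    by (auto simp: Euclidean_space_eq compactin_subtopology topspace_Euclidean_space)
  then have C: "compactin (mtop M) C"
    unfolding C_def using image_compactin[OF _ d(5)] by blast
  have CW: "C \<subseteq> U \<inter> W" using BV d(3) unfolding C_def by auto
  have zero: "\<phi> y = 0" if "y \<notin> C" for y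
  proof (cases "y \<in> U")
    case True
    have "\<psi> y \<notin> B" using that True d(3) unfolding C_def by (metis image_eqI inv_into_f_f)
    moreover have "\<psi> y i = 0" if "i \<ge> ?m" for i
      using openin_Euclidean_spaceD[OF d(2)] True that by blast
    ultimately obtain i where "i < ?m \<and> \<psi> y i \<notin> {p i - e..p i + e}"
      unfolding B_def PiE_UNIV_domain Pi_iff by (metis UNIV_I not_le singletonI)
    then have i: "i < ?m" "\<psi> y i \<notin> {p i - e..p i + e}" by blast+
    then have "\<bar>e\<bar> \<le> \<bar>\<psi> y i - p i\<bar>" using e(1) by auto
    then have "e\<^sup>2 \<le> (\<psi> y i - p i)\<^sup>2" by (simp only: abs_le_square_iff)
    then have "flat 0 (e\<^sup>2 + (-1) * ((\<psi> y i + - p i) * (\<psi> y i + - p i))) = 0"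
      by (simp add: flat_def power2_eq_square)
    then show ?thesis using i(1) True by (auto simp: \<phi>_def \<beta>_def intro!: prod_zero)
  qed (simp add: \<phi>_def)
  have \<beta>s: "smooth_on ?m S \<beta>" for S
    unfolding smooth_on_def \<beta>_def
    by (intro allI Ck_on_prod Ck_on_flat Ck_on_add Ck_on_mult Ck_on_const Ck_on_coord)
  show ?thesis
  proof
    show "\<phi> y \<ge> 0" for y by (auto simp: \<phi>_def \<beta>_def intro!: prod_nonneg flat_0_nonneg)
    show "\<phi> x > 0" using U(2) e(1) by (auto simp: \<phi>_def \<beta>_def p_def flat_0_pos_iff intro!: prod_pos)
    show "compactin (mtop M) C" by (rule C)
    show "C \<subseteq> W" using CW by blast
    show "\<phi> y = 0" if "y \<notin> C" for y by (rule zero[OF that])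
    show "\<phi> \<in> smooth_functions M"
      unfolding smooth_functions_def
    proof clarify
      fix V' \<xi> assume c: "(V', \<xi>) \<in> matlas M"
      note ch' = charts_of_manifold[OF M c]
      note d' = is_chartD[OF ch']
      show "smooth_on ?m (\<xi> ` V') (\<phi> \<circ> inv_into V' \<xi>)"
      proof (rule smooth_on_local[OF d'(2)])
        fix q assume "q \<in> \<xi> ` V'"
        then obtain z where z: "z \<in> V'" "q = \<xi> z" by blast
        show "\<exists>N. openin (Euclidean_space ?m) N \<and> q \<in> N \<and> N \<subseteq> \<xi> ` V' \<and> smooth_on ?m N (\<phi> \<circ> inv_into V' \<xi>)"
        proof (cases "z \<in> U")
          case True
          have N: "openin (Euclidean_space ?m) (\<xi> ` (V' \<inter> U))" by (rule is_chart_open_image[OF ch' d(1)])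
          have "smooth_vec_on ?m ?m (\<xi> ` (V' \<inter> U)) (\<psi> \<circ> inv_into V' \<xi>)"
            using M c U(1) unfolding smooth_manifold_def by fast
          then have "smooth_on ?m (\<xi> ` (V' \<inter> U)) (\<lambda>w. \<beta> ((\<psi> \<circ> inv_into V' \<xi>) w))"
            by (rule smooth_on_compose[OF N d(2) _ _ \<beta>s]) (use d'(3) in auto)
          then have "smooth_on ?m (\<xi> ` (V' \<inter> U)) (\<phi> \<circ> inv_into V' \<xi>)"
            by (rule smooth_on_cong[OF N, rotated]) (use d'(3) in \<open>auto simp: \<phi>_def\<close>)
          then show ?thesis using N z True by (intro exI[of _ "\<xi> ` (V' \<inter> U)"]) auto
        next
          case False
          let ?O = "topspace (mtop M) - C"
          have "Hausdorff_space (mtop M)" using M by (simp add: smooth_manifold_def)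
          then have "closedin (mtop M) C" using C compactin_imp_closedin by blast
          then have "openin (mtop M) ?O" by blast
          then have N: "openin (Euclidean_space ?m) (\<xi> ` (V' \<inter> ?O))" by (rule is_chart_open_image[OF ch'])
          have "smooth_on ?m (\<xi> ` (V' \<inter> ?O)) (\<lambda>_. 0)" by (simp add: smooth_on_def)
          then have "smooth_on ?m (\<xi> ` (V' \<inter> ?O)) (\<phi> \<circ> inv_into V' \<xi>)"
            by (rule smooth_on_cong[OF N, rotated]) (use d'(3) zero in auto)
          moreover have "z \<in> ?O" using z False CW openin_subset[OF d'(1)] by auto
          ultimately show ?thesis using N z by (intro exI[of _ "\<xi> ` (V' \<inter> ?O)"]) auto
        qed
      qed
    qed
  qed
qed

text \<open>The points where a bump is positive form an open set inside the compact
  \<open>C\<close>.\<close>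

lemma smooth_manifold_locally_compact:
  assumes M: "smooth_manifold M"
  shows "locally_compact_space (mtop M)"
  unfolding locally_compact_space_def
proof
  fix x assume "x \<in> topspace (mtop M)"
  then obtain \<phi> C where \<phi>: "\<phi> \<in> smooth_functions M" "\<phi> x > 0"
    "compactin (mtop M) C" "\<And>y. y \<in> topspace (mtop M) \<Longrightarrow> y \<notin> C \<Longrightarrow> \<phi> y = 0"
    using smooth_bump[OF M openin_topspace] by metis
  have "openin (mtop M) {y \<in> topspace (mtop M). \<phi> y \<in> {0<..}}"
    by (rule openin_continuous_map_preimage[OF smooth_functions_continuous[OF M \<phi>(1)]]) simp
  moreover have "{y \<in> topspace (mtop M). \<phi> y \<in> {0<..}} \<subseteq> C" using \<phi>(4) by fastforce
  ultimately show "\<exists>U K. openin (mtop M) U \<and> compactin (mtop M) K \<and> x \<in> U \<and> U \<subseteq> K"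
    using \<phi>(2,3) \<open>x \<in> topspace (mtop M)\<close> by blast
qed

section \<open>Products of manifolds\<close>

lemma continuous_map_Euclidean_coord: "continuous_map (Euclidean_space m) euclideanreal (\<lambda>x. x i)"
  unfolding Euclidean_space_def
  by (intro continuous_map_from_subtopology continuous_map_product_projection) simp

lemma prod_chart_eq_join: "prod_chart m \<phi> \<psi> (x, y) = join m (\<phi> x) (\<psi> y)"
  by (simp add: prod_chart_def join_def)

lemma is_chart_prod:
  assumes \<phi>: "is_chart X m U \<phi>" and \<psi>: "is_chart Y n V \<psi>"
  shows "is_chart (prod_topology X Y) (m + n) (U \<times> V) (prod_chart m \<phi> \<psi>)"
proof -
  note d = is_chartD[OF \<phi>] and d' = is_chartD[OF \<psi>]
  let ?P = "prod_chart m \<phi> \<psi>" and ?E = "Euclidean_space (m + n)"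
  let ?XY = "subtopology (prod_topology X Y) (U \<times> V)"
  \<comment> \<open>The two blocks of coordinates, padded with zeros so that they land in the model
    spaces; \<open>join m\<close> recombines them.\<close>
  define low :: "(nat \<Rightarrow> real) \<Rightarrow> nat \<Rightarrow> real" where "low = (\<lambda>w i. if i < m then w i else 0)"
  define high :: "(nat \<Rightarrow> real) \<Rightarrow> nat \<Rightarrow> real" where "high = (\<lambda>w i. if i < n then w (i + m) else 0)"
  have low: "continuous_map ?E (Euclidean_space m) low"
    unfolding low_def continuous_map_componentwise_Euclidean_space
    by (intro allI impI continuous_map_Euclidean_coord)
  have high: "continuous_map ?E (Euclidean_space n) high"
    unfolding high_def continuous_map_componentwise_Euclidean_space
    by (intro allI impI continuous_map_Euclidean_coord)
  have \<phi>0: "\<phi> x i = 0" if "x \<in> U" "i \<ge> m" for x i using openin_Euclidean_spaceD[OF d(2)] that by blast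
  have \<psi>0: "\<psi> y i = 0" if "y \<in> V" "i \<ge> n" for y i using openin_Euclidean_spaceD[OF d'(2)] that by blast
  have lowP: "low (?P (x, y)) = \<phi> x" if "x \<in> U" "y \<in> V" for x y
    using \<phi>0[OF that(1)] by (auto simp: low_def prod_chart_def fun_eq_iff)
  have highP: "high (?P (x, y)) = \<psi> y" if "x \<in> U" "y \<in> V" for x y
    using \<psi>0[OF that(2)] by (auto simp: high_def prod_chart_def fun_eq_iff)
  have joinE: "join m (low w) (high w) = w" if "w \<in> topspace ?E" for w
    using that by (auto simp: low_def high_def join_def fun_eq_iff topspace_Euclidean_space)
  have PE: "?P (x, y) \<in> topspace ?E" if "x \<in> U" "y \<in> V" for x y
    using \<phi>0[OF that(1)] \<psi>0[OF that(2)] by (auto simp: prod_chart_def topspace_Euclidean_space)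
  have Q: "?P ` (U \<times> V) = {w \<in> topspace ?E. low w \<in> \<phi> ` U} \<inter> {w \<in> topspace ?E. high w \<in> \<psi> ` V}"
  proof (intro equalityI subsetI)
    fix w assume w: "w \<in> {w \<in> topspace ?E. low w \<in> \<phi> ` U} \<inter> {w \<in> topspace ?E. high w \<in> \<psi> ` V}"
    then obtain x y where "x \<in> U" "y \<in> V" "low w = \<phi> x" "high w = \<psi> y" by blast
    moreover from this have "w = ?P (x, y)" using joinE[of w] w by (simp add: prod_chart_eq_join)
    ultimately show "w \<in> ?P ` (U \<times> V)" by blast
  qed (use lowP highP PE in auto)
  have oQ: "openin ?E (?P ` (U \<times> V))"
    unfolding Q by (intro openin_Int openin_continuous_map_preimage[OF low d(2)] openin_continuous_map_preimage[OF high d'(2)])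
  define g where "g = (\<lambda>w. (inv_into U \<phi> (low w), inv_into V \<psi> (high w)))"
  let ?Q = "subtopology ?E (?P ` (U \<times> V))"
  have tXY: "topspace ?XY = U \<times> V" using openin_subset[OF d(1)] openin_subset[OF d'(1)] by auto
  have tQ: "topspace ?Q = ?P ` (U \<times> V)" using openin_subset[OF oQ] by auto
  have "homeomorphic_maps ?XY ?Q ?P g"
    unfolding homeomorphic_maps_def
  proof (intro conjI ballI)
    show "g (?P z) = z" if "z \<in> topspace ?XY" for z
    proof -
      have "z \<in> U \<times> V" using that by (simp only: tXY)
      then obtain x y where z: "z = (x, y)" "x \<in> U" "y \<in> V" by blast
      then show ?thesis using lowP highP d(3) d'(3) by (simp add: g_def)
    qed
    show "?P (g w) = w" if "w \<in> topspace ?Q" for w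
    proof -
      have w: "w \<in> topspace ?E" "low w \<in> \<phi> ` U" "high w \<in> \<psi> ` V" using that tQ Q by auto
      then show ?thesis using joinE[OF w(1)] by (simp add: g_def prod_chart_eq_join f_inv_into_f)
    qed
    show "continuous_map ?Q ?XY g"
    proof -
      have "continuous_map ?Q (subtopology (Euclidean_space m) (\<phi> ` U)) low"
        using low Q by (auto simp: continuous_map_in_subtopology continuous_map_from_subtopology)
      from continuous_map_compose[OF this d(5)] have "continuous_map ?Q X (\<lambda>w. inv_into U \<phi> (low w))"
        by (simp add: o_def)
      moreover have "continuous_map ?Q (subtopology (Euclidean_space n) (\<psi> ` V)) high"
        using high Q by (auto simp: continuous_map_in_subtopology continuous_map_from_subtopology)
      from continuous_map_compose[OF this d'(5)] have "continuous_map ?Q Y (\<lambda>w. inv_into V \<psi> (high w))"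
        by (simp add: o_def)
      ultimately have "continuous_map ?Q (prod_topology X Y) g"
        unfolding g_def by (rule continuous_map_pairedI)
      moreover have "g ` topspace ?Q \<subseteq> U \<times> V" using tQ Q by (auto simp: g_def inv_into_into)
      ultimately show ?thesis by (auto simp: continuous_map_in_subtopology)
    qed
    show "continuous_map ?XY ?Q ?P"
    proof -
      have XY: "?XY = prod_topology (subtopology X U) (subtopology Y V)" by (simp add: subtopology_Times)
      have c1: "continuous_map ?XY euclideanreal (\<lambda>z. \<phi> (fst z) i)" for i
        using continuous_map_compose[OF continuous_map_compose[OF continuous_map_fst d(4)] continuous_map_Euclidean_coord]
        by (simp add: XY o_def)
      have c2: "continuous_map ?XY euclideanreal (\<lambda>z. \<psi> (snd z) i)" for i
        using continuous_map_compose[OF continuous_map_compose[OF continuous_map_snd d'(4)] continuous_map_Euclidean_coord]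
        by (simp add: XY o_def)
      have "continuous_map ?XY ?E (\<lambda>z i. if i < m + n then ?P z i else 0)"
        unfolding continuous_map_componentwise_Euclidean_space
      proof (intro allI impI)
        fix i show "continuous_map ?XY euclideanreal (\<lambda>z. ?P z i)"
          using c1 c2 by (cases "i < m") (simp_all add: prod_chart_def case_prod_unfold)
      qed
      then have "continuous_map ?XY ?E ?P"
      proof (rule continuous_map_eq)
        fix z assume "z \<in> topspace ?XY"
        then have "z \<in> U \<times> V" by (simp only: tXY)
        then obtain x y where z: "z = (x, y)" "x \<in> U" "y \<in> V" by blast
        then show "(\<lambda>i. if i < m + n then ?P z i else 0) = ?P z"
          using PE[OF z(2,3)] by (auto simp: topspace_Euclidean_space fun_eq_iff)
      qed
      then show ?thesis using tXY by (auto simp: continuous_map_in_subtopology)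
    qed
  qed
  then have "homeomorphic_map ?XY ?Q ?P" using homeomorphic_maps_map by blast
  moreover have "openin (prod_topology X Y) (U \<times> V)" using d(1) d'(1) by (simp add: openin_prod_Times_iff)
  ultimately show ?thesis using oQ by (simp add: is_chart_def)
qed

text \<open>In charts, \<open>g \<circ> F\<close> is the chart form of \<open>g\<close> after that
  of \<open>F\<close>. The source is asked only for valid charts, which is what
  \<open>is_chart_prod\<close> supplies for \<open>prod_mfd S M\<close>.\<close>

lemma smooth_functions_compose:
  assumes N: "\<And>U \<phi>. (U, \<phi>) \<in> matlas N \<Longrightarrow> is_chart (mtop N) (mdim N) U \<phi>"
    and M: "smooth_manifold M" and F: "smooth_map N M F" and g: "g \<in> smooth_functions M"
  shows "g \<circ> F \<in> smooth_functions N"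
  unfolding smooth_functions_def
proof clarify
  fix U \<phi> assume c: "(U, \<phi>) \<in> matlas N"
  note d = is_chartD[OF N[OF c]]
  have Fc: "continuous_map (mtop N) (mtop M) F" using F by (simp add: smooth_map_def)
  show "smooth_on (mdim N) (\<phi> ` U) (g \<circ> F \<circ> inv_into U \<phi>)"
  proof (rule smooth_on_local[OF d(2)])
    fix q assume "q \<in> \<phi> ` U"
    then obtain y where y: "y \<in> U" "q = \<phi> y" by blast
    then have "y \<in> topspace (mtop N)" using openin_subset[OF d(1)] by blast
    then have "F y \<in> topspace (mtop M)" using Fc by (auto simp: continuous_map_def)
    then obtain V \<psi> where V: "(V, \<psi>) \<in> matlas M" "F y \<in> V" using chart_at[OF M] by blast
    note e = is_chartD[OF charts_of_manifold[OF M V(1)]]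
    let ?Q = "\<phi> ` (U \<inter> F -` V)"
    have "openin (mtop N) {z \<in> topspace (mtop N). F z \<in> V}"
      by (rule openin_continuous_map_preimage[OF Fc e(1)])
    moreover have "U \<inter> {z \<in> topspace (mtop N). F z \<in> V} = U \<inter> F -` V"
      using openin_subset[OF d(1)] by blast
    ultimately have Q: "openin (Euclidean_space (mdim N)) ?Q"
      using is_chart_open_image[OF N[OF c]] by metis
    have "smooth_vec_on (mdim N) (mdim M) ?Q (\<psi> \<circ> F \<circ> inv_into U \<phi>)"
      using F c V(1) unfolding smooth_map_def by fast
    then have "smooth_on (mdim N) ?Q (\<lambda>w. (g \<circ> inv_into V \<psi>) ((\<psi> \<circ> F \<circ> inv_into U \<phi>) w))"
      by (rule smooth_on_compose[OF Q e(2) _ _ smooth_functionsD[OF g V(1)]]) (use d(3) in auto)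
    then have "smooth_on (mdim N) ?Q (g \<circ> F \<circ> inv_into U \<phi>)"
      by (rule smooth_on_cong[OF Q, rotated]) (use d(3) e(3) in auto)
    then show "\<exists>S. openin (Euclidean_space (mdim N)) S \<and> q \<in> S \<and> S \<subseteq> \<phi> ` U \<and>
        smooth_on (mdim N) S (g \<circ> F \<circ> inv_into U \<phi>)"
      using Q y V(2) by (intro exI[of _ ?Q]) auto
  qed
qed

text \<open>In a product chart \<open>h\<close> is a smooth function of the joined coordinates, so
  \<open>PCk_join\<close> applies with the chart of \<open>S\<close> as the continuous parameter.
  One chart of \<open>S\<close> may see only part of the group, whence
  \<open>PCk_local\<close>.\<close>

lemma PCk_of_smooth_on_product:
  assumes S: "smooth_manifold S" and M: "smooth_manifold M"
    and h: "(\<lambda>(a, x). h a x) \<in> smooth_functions (prod_mfd S M)" and c: "(U, \<psi>) \<in> matlas M"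
  shows "PCk (mtop S) (mdim M) k (\<psi> ` U) (\<lambda>a y. h a (inv_into U \<psi> y))"
proof (rule PCk_local)
  fix a assume "a \<in> topspace (mtop S)"
  then obtain A \<xi> where A: "(A, \<xi>) \<in> matlas S" "a \<in> A" using chart_at[OF S] by blast
  note chA = charts_of_manifold[OF S A(1)] and chU = charts_of_manifold[OF M c]
  note d = is_chartD[OF chA] and e = is_chartD[OF chU] and p = is_chartD[OF is_chart_prod[OF chA chU]]
  let ?P = "prod_chart (mdim S) \<xi> \<psi>"
  let ?\<Theta> = "(\<lambda>(a, x). h a x) \<circ> inv_into (A \<times> U) ?P"
  have "(A \<times> U, ?P) \<in> matlas (prod_mfd S M)" using A(1) c by (auto simp: prod_mfd_def)
  from smooth_functionsD[OF h this] have \<Theta>: "Ck_on (mdim S + mdim M) k (?P ` (A \<times> U)) ?\<Theta>"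
    by (simp add: prod_mfd_def smooth_on_def)
  have tA: "topspace (subtopology (mtop S) A) = A" using openin_subset[OF d(1)] by auto
  have "PCk (subtopology (mtop S) A) (mdim M) k (\<psi> ` U) (\<lambda>a y. ?\<Theta> (join (mdim S) (\<xi> a) y))"
  proof (rule PCk_join[OF p(2) e(2) d(4) _ \<Theta>])
    fix a y assume "a \<in> topspace (subtopology (mtop S) A)" "y \<in> \<psi> ` U"
    then show "join (mdim S) (\<xi> a) y \<in> ?P ` (A \<times> U)"
      unfolding tA by (auto simp flip: prod_chart_eq_join)
  qed
  then have "PCk (subtopology (mtop S) A) (mdim M) k (\<psi> ` U) (\<lambda>a y. h a (inv_into U \<psi> y))"
  proof (rule PCk_cong[OF e(2), rotated])
    fix b y assume b: "b \<in> topspace (subtopology (mtop S) A)" and "y \<in> \<psi> ` U"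
    then obtain x where x: "x \<in> U" "y = \<psi> x" by blast
    have "inv_into (A \<times> U) ?P (?P (b, x)) = (b, x)"
      using p(3) x b by (intro inv_into_f_f) (auto simp: tA)
    then show "?\<Theta> (join (mdim S) (\<xi> b) y) = h b (inv_into U \<psi> y)"
      using x e(3) by (simp add: prod_chart_eq_join)
  qed
  then show "\<exists>A. openin (mtop S) A \<and> a \<in> A \<and>
      PCk (subtopology (mtop S) A) (mdim M) k (\<psi> ` U) (\<lambda>a y. h a (inv_into U \<psi> y))"
    using d(1) A(2) by blast
qed


section \<open>Averaging over the group\<close>

lemma invariant_bump:
  fixes G :: "('g, 'z) monoid_scheme" and S :: "'g mfd" and M :: "'a mfd"
  assumes lie: "lie_group G S" and M: "smooth_manifold M"
    and act: "smooth_action G S M \<alpha>" and proper: "proper_action S M \<alpha>"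
    and W: "openin (mtop M) W" "\<And>a x. a \<in> carrier G \<Longrightarrow> x \<in> W \<Longrightarrow> \<alpha> a x \<in> W" and x0: "x0 \<in> W"
  obtains h where "h \<in> smooth_functions M"
    "\<And>x. x \<in> topspace (mtop M) \<Longrightarrow> h x \<ge> 0" "h x0 > 0"
    "\<And>x. x \<in> topspace (mtop M) \<Longrightarrow> x \<notin> W \<Longrightarrow> h x = 0"
    "\<And>b x. b \<in> carrier G \<Longrightarrow> x \<in> topspace (mtop M) \<Longrightarrow> h (\<alpha> b x) = h x"
proof -
  let ?X = "mtop S" and ?Y = "mtop M"
  have S: "smooth_manifold S" and gr: "group G" and tX: "topspace ?X = carrier G"
    using lie by (auto simp: lie_group_def)
  interpret group G by (rule gr)
  interpret act: group_action G "topspace ?Y" \<alpha> using act by (simp add: smooth_action_def)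
  have \<alpha>Y: "\<alpha> a x \<in> topspace ?Y" if "a \<in> carrier G" "x \<in> topspace ?Y" for a x
    using act.element_image that by blast
  have \<alpha>s: "smooth_map (prod_mfd S M) M (\<lambda>(a, x). \<alpha> a x)" using act by (simp add: smooth_action_def)
  interpret lc_group G ?X
  proof
    show "topspace ?X = carrier G" by (rule tX)
    show "Hausdorff_space ?X" using S by (simp add: smooth_manifold_def)
    show "locally_compact_space ?X" by (rule smooth_manifold_locally_compact[OF S])
    show "continuous_map (prod_topology ?X ?X) ?X (\<lambda>(a, b). a \<otimes>\<^bsub>G\<^esub> b)"
      using lie by (simp add: lie_group_def smooth_map_def prod_mfd_def)
    show "continuous_map ?X ?X (\<lambda>a. inv\<^bsub>G\<^esub> a)"
      using lie by (simp add: lie_group_def smooth_map_def)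
  qed
  obtain I :: "('g \<Rightarrow> real) \<Rightarrow> real" where
    Iadd: "\<And>u v. u \<in> Cc ?X \<Longrightarrow> v \<in> Cc ?X \<Longrightarrow> I (\<lambda>x. u x + v x) = I u + I v" and
    Iscale: "\<And>u c. u \<in> Cc ?X \<Longrightarrow> I (\<lambda>x. c * u x) = c * I u" and
    Inn: "\<And>u. u \<in> Cp ?X \<Longrightarrow> I u \<ge> 0" and
    Ipos: "\<And>u x. u \<in> Cp ?X \<Longrightarrow> x \<in> carrier G \<Longrightarrow> u x > 0 \<Longrightarrow> I u > 0" and
    Itr: "\<And>u b. u \<in> Cc ?X \<Longrightarrow> b \<in> carrier G \<Longrightarrow> I (\<lambda>x. u (x \<otimes>\<^bsub>G\<^esub> b)) = I u"
    by (rule Haar_integral_exists) (rule that)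
  interpret I: positive_functional ?X I
    using Hausdorff locally_compact Iadd Iscale Inn by unfold_locales
  obtain \<phi> C where \<phi>: "\<phi> \<in> smooth_functions M" "\<And>y. \<phi> y \<ge> 0" "\<phi> x0 > 0"
    "compactin ?Y C" "C \<subseteq> W" "\<And>y. y \<in> topspace ?Y \<Longrightarrow> y \<notin> C \<Longrightarrow> \<phi> y = 0"
    using smooth_bump[OF M W(1) x0] by blast
  have \<phi>\<alpha>: "(\<lambda>(a, x). \<phi> (\<alpha> a x)) \<in> smooth_functions (prod_mfd S M)"
  proof -
    have "\<phi> \<circ> (\<lambda>(a, x). \<alpha> a x) \<in> smooth_functions (prod_mfd S M)"
    proof (rule smooth_functions_compose[OF _ M \<alpha>s \<phi>(1)])
      show "is_chart (mtop (prod_mfd S M)) (mdim (prod_mfd S M)) U \<psi>"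
        if c: "(U, \<psi>) \<in> matlas (prod_mfd S M)" for U \<psi>
      proof -
        obtain A \<xi> V \<zeta> where "(A, \<xi>) \<in> matlas S" "(V, \<zeta>) \<in> matlas M"
          "U = A \<times> V" "\<psi> = prod_chart (mdim S) \<xi> \<zeta>"
          using c by (auto simp: prod_mfd_def)
        then show ?thesis
          using is_chart_prod[OF charts_of_manifold[OF S] charts_of_manifold[OF M]]
          by (simp add: prod_mfd_def)
      qed
    qed
    then show ?thesis by (simp add: o_def case_prod_unfold)
  qed
  \<comment> \<open>Properness: the pairs \<open>(a, x)\<close> with \<open>x \<in> K'\<close> and
    \<open>\<alpha> a x \<in> C\<close> form a compact set, whose projection to the group is the
    required \<open>K\<close>.\<close>
  have supp: "\<exists>K. compactin ?X K \<and> (\<forall>a\<in>topspace ?X. \<forall>x\<in>K'. a \<notin> K \<longrightarrow> \<phi> (\<alpha> a x) = 0)"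
    if K': "compactin ?Y K'" for K'
  proof -
    let ?P = "\<lambda>(a, x). (x, \<alpha> a x)"
    let ?L = "{p \<in> topspace (prod_topology ?X ?Y). ?P p \<in> K' \<times> C}"
    have "compactin (prod_topology ?Y ?Y) (K' \<times> C)" using K' \<phi>(4) by (simp add: compactin_Times)
    then have "compactin (prod_topology ?X ?Y) ?L"
      using proper compactin_proper_map_preimage unfolding proper_action_def by blast
    then have "compactin ?X (fst ` ?L)" using image_compactin continuous_map_fst by blast
    moreover have "\<phi> (\<alpha> a x) = 0" if "a \<in> topspace ?X" "x \<in> K'" "a \<notin> fst ` ?L" for a x
    proof (rule \<phi>(6))
      have x: "x \<in> topspace ?Y" using K' that(2) compactin_subset_topspace by blast
      then show "\<alpha> a x \<in> topspace ?Y" using \<alpha>Y that(1) tX by simp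
      show "\<alpha> a x \<notin> C"
      proof
        assume "\<alpha> a x \<in> C"
        then have "(a, x) \<in> ?L" using that x by simp
        then show False using that(3) by force
      qed
    qed
    ultimately show ?thesis by blast
  qed
  define u where "u = (\<lambda>x a. \<phi> (\<alpha> a x))"
  have uC: "u x \<in> Cp ?X" if x: "x \<in> topspace ?Y" for x
  proof -
    have "compactin ?Y {x}" using x by simp
    then obtain K where K: "compactin ?X K" "\<forall>a\<in>topspace ?X. \<forall>y\<in>{x}. a \<notin> K \<longrightarrow> \<phi> (\<alpha> a y) = 0"
      using supp by blast
    have "u x \<in> Cc ?X"
    proof (rule CcI[OF _ K(1)])
      have "continuous_map ?X (prod_topology ?X ?Y) (\<lambda>a. (a, x))"
        using x by (intro continuous_map_pairedI) auto
      moreover have "continuous_map (prod_topology ?X ?Y) ?Y (\<lambda>(a, x). \<alpha> a x)"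
        using \<alpha>s by (simp add: smooth_map_def prod_mfd_def)
      ultimately have "continuous_map ?X ?Y ((\<lambda>(a, x). \<alpha> a x) \<circ> (\<lambda>a. (a, x)))"
        by (rule continuous_map_compose)
      from continuous_map_compose[OF this smooth_functions_continuous[OF M \<phi>(1)]]
      show "continuous_map ?X euclideanreal (u x)" by (simp add: o_def u_def)
    qed (use K(2) in \<open>auto simp: u_def\<close>)
    then show ?thesis using \<phi>(2) by (simp add: Cp_def u_def)
  qed
  define h where "h = (\<lambda>x. I (u x))"
  have "h \<in> smooth_functions M"
    unfolding smooth_functions_def
  proof clarify
    fix U \<psi> assume c: "(U, \<psi>) \<in> matlas M"
    note ch = charts_of_manifold[OF M c]
    note d = is_chartD[OF ch]
    have "Ck_on (mdim M) k (\<psi> ` U) (\<lambda>y. I (\<lambda>a. \<phi> (\<alpha> a (inv_into U \<psi> y))))" for k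
    proof (rule I.Ck_on_functional[OF d(2) PCk_of_smooth_on_product[OF S M \<phi>\<alpha> c]])
      fix y assume "y \<in> \<psi> ` U"
      then obtain x where x: "x \<in> U" "y = \<psi> x" by blast
      then have "x \<in> topspace ?Y" using openin_subset[OF d(1)] by blast
      \<comment> \<open>A compact neighbourhood of \<open>x\<close>, so that one \<open>K\<close>
        works for all nearby points.\<close>
      then obtain O' K' where O': "openin ?Y O'" "compactin ?Y K'" "x \<in> O'" "O' \<subseteq> K'"
        using smooth_manifold_locally_compact[OF M] unfolding locally_compact_space_def by metis
      obtain K where K: "compactin ?X K" "\<forall>a\<in>topspace ?X. \<forall>x\<in>K'. a \<notin> K \<longrightarrow> \<phi> (\<alpha> a x) = 0"
        using supp[OF O'(2)] by blast
      have "\<phi> (\<alpha> a (inv_into U \<psi> z)) = 0"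
        if "a \<in> topspace ?X" "z \<in> \<psi> ` (U \<inter> O')" "a \<notin> K" for a z
      proof -
        have "inv_into U \<psi> z \<in> K'" using that(2) d(3) O'(4) by auto
        then show ?thesis using K(2) that(1,3) by blast
      qed
      then show "\<exists>N K. openin (Euclidean_space (mdim M)) N \<and> y \<in> N \<and> N \<subseteq> \<psi> ` U \<and> compactin ?X K \<and>
          (\<forall>a\<in>topspace ?X. \<forall>z\<in>N. a \<notin> K \<longrightarrow> \<phi> (\<alpha> a (inv_into U \<psi> z)) = 0)"
        using is_chart_open_image[OF ch O'(1)] x O'(3) K(1)
        by (intro exI[of _ "\<psi> ` (U \<inter> O')"] exI[of _ K]) auto
    qed
    then show "smooth_on (mdim M) (\<psi> ` U) (h \<circ> inv_into U \<psi>)"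
      by (simp add: smooth_on_def h_def u_def o_def)
  qed
  moreover have "h x \<ge> 0" if "x \<in> topspace ?Y" for x
    using Inn[OF uC[OF that]] by (simp add: h_def)
  \<comment> \<open>At the identity the integrand is \<open>\<phi> x0 > 0\<close>, and
    \<open>I\<close> is strictly positive on such functions.\<close>
  moreover have "h x0 > 0"
  proof -
    have x0Y: "x0 \<in> topspace ?Y" using x0 openin_subset[OF W(1)] by blast
    have "\<alpha> \<one>\<^bsub>G\<^esub> x0 = x0" using act.id_eq_one x0Y by (metis restrict_apply')
    then show ?thesis unfolding h_def
      using Ipos[OF uC[OF x0Y], of "\<one>\<^bsub>G\<^esub>"] \<phi>(3) by (simp add: u_def)
  qed
  moreover have "h x = 0" if x: "x \<in> topspace ?Y" "x \<notin> W" for x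
  proof -
    have "u x a = 0" if a: "a \<in> topspace ?X" for a
      unfolding u_def
    proof (rule \<phi>(6))
      show "\<alpha> a x \<in> topspace ?Y" using \<alpha>Y a x tX by simp
      show "\<alpha> a x \<notin> C"
      proof
        assume "\<alpha> a x \<in> C"
        \<comment> \<open>\<open>W\<close> is invariant, so acting by the inverse would bring
          \<open>x\<close> itself into \<open>W\<close>.\<close>
        then have "\<alpha> (inv\<^bsub>G\<^esub> a) (\<alpha> a x) \<in> W" using W(2) \<phi>(5) a tX by auto
        then show False using act.orbit_sym_aux[of a x] a x tX by simp
      qed
    qed
    then have "I (u x) = I (\<lambda>_. 0)"
      using Cp_Cc[OF uC[OF x(1)]] Cc_zero by (intro I.cong)
    also have "\<dots> = 0" using Iscale[OF Cc_zero, of 0] by simp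
    finally show ?thesis by (simp add: h_def)
  qed
  moreover have "h (\<alpha> b x) = h x" if b: "b \<in> carrier G" and x: "x \<in> topspace ?Y" for b x
  proof -
    \<comment> \<open>Since \<open>\<alpha> a (\<alpha> b x) = \<alpha> (a \<otimes> b) x\<close>,
      moving the point is a right translation of the integrand.\<close>
    have "I (u (\<alpha> b x)) = I (\<lambda>a. u x (a \<otimes>\<^bsub>G\<^esub> b))"
    proof (rule I.cong)
      show "u (\<alpha> b x) \<in> Cc ?X" by (rule Cp_Cc[OF uC[OF \<alpha>Y[OF b x]]])
      show "(\<lambda>a. u x (a \<otimes>\<^bsub>G\<^esub> b)) \<in> Cc ?X" by (rule Cc_translate[OF Cp_Cc[OF uC[OF x]] b])
      show "u (\<alpha> b x) a = u x (a \<otimes>\<^bsub>G\<^esub> b)" if "a \<in> topspace ?X" for a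
        using act.composition_rule[OF x _ b, of a] that tX by (simp add: u_def)
    qed
    also have "\<dots> = I (u x)" using Itr[OF Cp_Cc[OF uC[OF x]] b] .
    finally show ?thesis by (simp add: h_def)
  qed
  ultimately show ?thesis by (rule that)
qed


section \<open>Approximation\<close>

text \<open>The factors \<open>flat 0 (1 - j * h i x)\<close> kill the \<open>j\<close>-th term for all large \<open>j\<close> near any point with
  \<open>h i x > 0\<close>, which makes the family locally finite without any appeal to paracompactness.\<close>

definition cutoff :: "(nat \<Rightarrow> 'a \<Rightarrow> real) \<Rightarrow> nat \<Rightarrow> 'a \<Rightarrow> real" where
  "cutoff h j x = h j x * (\<Prod>i<j. flat 0 (1 + (- real j) * h i x))"

lemma cutoff_locally_finite:
  assumes M: "smooth_manifold M" and h: "\<And>j. h j \<in> smooth_functions M"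
    and x: "x \<in> topspace (mtop M)" "h i x > 0"
  shows "\<exists>W J. openin (mtop M) W \<and> x \<in> W \<and> (\<forall>y\<in>W. \<forall>j\<ge>J. cutoff h j y = 0)"
proof -
  define c where "c = h i x / 2"
  have c: "c > 0" "h i x > c" using x(2) by (auto simp: c_def)
  obtain J where J: "1 / c < real J" using reals_Archimedean2 by blast
  let ?W = "{y \<in> topspace (mtop M). h i y \<in> {c<..}}"
  have "openin (mtop M) ?W"
    by (rule openin_continuous_map_preimage[OF smooth_functions_continuous[OF M h]]) simp
  \<comment> \<open>\<open>Suc i\<close> ensures that the factor with index \<open>i\<close> occurs
    in the product; \<open>J\<close> makes that factor zero.\<close>
  moreover have "cutoff h j y = 0" if y: "y \<in> ?W" and j: "j \<ge> max J (Suc i)" for y j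
  proof -
    have "1 < real J * c" using J c(1) by (simp add: field_simps)
    also have "\<dots> \<le> real j * h i y" using y j c(1) by (intro mult_mono) auto
    finally have "flat 0 (1 + (- real j) * h i y) = 0" by (simp add: flat_def)
    then have "(\<Prod>i<j. flat 0 (1 + (- real j) * h i y)) = 0" using j by (intro prod_zero) auto
    then show ?thesis by (simp add: cutoff_def)
  qed
  ultimately show ?thesis using x(1) c(2) by (intro exI[of _ ?W] exI[of _ "max J (Suc i)"]) auto
qed

lemma smooth_functions_cutoff:
  assumes "\<And>j. h j \<in> smooth_functions M"
  shows "cutoff h j \<in> smooth_functions M"
  unfolding cutoff_def
  by (intro smooth_functions_mult smooth_functions_prod smooth_functions_flat smooth_functions_add
      smooth_functions_const assms)

lemma cutoff_nonneg: "h j x \<ge> 0 \<Longrightarrow> cutoff h j x \<ge> 0"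
  unfolding cutoff_def by (intro mult_nonneg_nonneg prod_nonneg flat_0_nonneg)

text \<open>At the first index with \<open>h j x > 0\<close> all factors are
  \<open>flat 0 1\<close>, because the earlier functions vanish at \<open>x\<close>.\<close>

lemma cutoff_pos:
  assumes "\<And>j. h j x \<ge> 0" "h i x > 0"
  obtains j where "cutoff h j x > 0"
proof -
  define j where "j = (LEAST j. h j x > 0)"
  have j: "h j x > 0" unfolding j_def using assms(2) by (rule LeastI)
  have "h i x = 0" if "i < j" for i
    using not_less_Least[of i "\<lambda>j. h j x > 0"] that assms(1)[of i] by (simp add: j_def)
  then have "(\<Prod>i<j. flat 0 (1 + (- real j) * h i x)) > 0"
    by (intro prod_pos) (auto simp: flat_0_pos_iff)
  then have "cutoff h j x > 0" using j unfolding cutoff_def by (intro mult_pos_pos)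
  then show ?thesis by (rule that)
qed

text \<open>On the manifold, \<open>g x\<close> is a convex combination of centres
  \<open>c j\<close> with \<open>h j x > 0\<close>, all in the ball of radius
  \<open>\<epsilon>\<close> about \<open>F x\<close>.\<close>

lemma smooth_approximation_from_bumps:
  fixes F :: "'a \<Rightarrow> real ^ 'n" and c :: "nat \<Rightarrow> real ^ 'n"
  assumes M: "smooth_manifold M" and h: "\<And>j. h j \<in> smooth_functions M"
    and h0: "\<And>j x. x \<in> topspace (mtop M) \<Longrightarrow> h j x \<ge> 0"
    and cover: "\<And>x. x \<in> topspace (mtop M) \<Longrightarrow> \<exists>i. h i x > 0"
    and close: "\<And>j x. x \<in> topspace (mtop M) \<Longrightarrow> h j x > 0 \<Longrightarrow> norm (c j - F x) < \<epsilon>"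
    and g_def: "g = (\<lambda>x. \<chi> k. (\<Sum>j. cutoff h j x * c j $ k) * inverse (\<Sum>j. cutoff h j x))"
  shows "\<And>k. (\<lambda>x. g x $ k) \<in> smooth_functions M"
    and "\<And>x. x \<in> topspace (mtop M) \<Longrightarrow> norm (g x - F x) < \<epsilon>"
proof -
  have fin: "\<exists>W J. openin (mtop M) W \<and> x \<in> W \<and> (\<forall>y\<in>W. \<forall>j\<ge>J. cutoff h j y = 0)"
    if x: "x \<in> topspace (mtop M)" for x
  proof -
    obtain i where "h i x > 0" using cover[OF x] by blast
    from cutoff_locally_finite[of M h x i, OF M h x this] show ?thesis .
  qed
  have main: "\<exists>J. (\<forall>j\<ge>J. cutoff h j x = 0) \<and> (\<Sum>j<J. cutoff h j x) > 0"
    if x: "x \<in> topspace (mtop M)" for x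
  proof -
    obtain J where J: "\<forall>j\<ge>J. cutoff h j x = 0" using fin[OF x] by blast
    obtain i where "h i x > 0" using cover[OF x] by blast
    then obtain j where j: "cutoff h j x > 0" using cutoff_pos[of h x i] h0[OF x] by blast
    then have "j < J" using J by (metis less_irrefl not_le)
    then have "(\<Sum>j<J. cutoff h j x) > 0"
      using j cutoff_nonneg[of h _ x] h0[OF x] by (intro sum_pos2[of _ j]) auto
    then show ?thesis using J by blast
  qed
  have suminf: "(\<Sum>j. cutoff h j x * a j) = (\<Sum>j<J. cutoff h j x * a j)"
    if "\<forall>j\<ge>J. cutoff h j x = 0" for x J and a :: "nat \<Rightarrow> real"
    using that by (intro suminf_finite) auto
  have suminf1: "(\<Sum>j. cutoff h j x) = (\<Sum>j<J. cutoff h j x)"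
    if "\<forall>j\<ge>J. cutoff h j x = 0" for x J
    using suminf[OF that, of "\<lambda>_. 1"] by simp
  show "(\<lambda>x. g x $ k) \<in> smooth_functions M" for k
    unfolding g_def vec_lambda_beta
  proof (intro smooth_functions_mult smooth_functions_inverse[OF M])
    show "(\<lambda>x. \<Sum>j. cutoff h j x) \<in> smooth_functions M"
      using smooth_functions_suminf[OF M, of "cutoff h"] smooth_functions_cutoff[of h, OF h] fin by blast
    show "(\<lambda>x. \<Sum>j. cutoff h j x * c j $ k) \<in> smooth_functions M"
    proof (rule smooth_functions_suminf[OF M])
      show "(\<lambda>x. cutoff h j x * c j $ k) \<in> smooth_functions M" for j
        by (intro smooth_functions_mult smooth_functions_cutoff h smooth_functions_const)
      show "\<exists>W J. openin (mtop M) W \<and> x \<in> W \<and> (\<forall>y\<in>W. \<forall>j\<ge>J. cutoff h j y * c j $ k = 0)"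
        if "x \<in> topspace (mtop M)" for x
        using fin[OF that] by (elim ex_forward) simp
    qed
    show "(\<Sum>j. cutoff h j x) \<noteq> 0" if "x \<in> topspace (mtop M)" for x
      using main[OF that] suminf1 by fastforce
  qed
  show "norm (g x - F x) < \<epsilon>" if x: "x \<in> topspace (mtop M)" for x
  proof -
    obtain J where J: "\<forall>j\<ge>J. cutoff h j x = 0" "(\<Sum>j<J. cutoff h j x) > 0" using main[OF x] by blast
    define s where "s = (\<Sum>j<J. cutoff h j x)"
    have s: "s > 0" using J(2) by (simp add: s_def)
    have n0: "0 \<le> cutoff h j x" for j by (intro cutoff_nonneg h0[OF x])
    have "s *\<^sub>R g x = (\<Sum>j<J. cutoff h j x *\<^sub>R c j)"
      using s by (simp add: vec_eq_iff g_def suminf[OF J(1)] suminf1[OF J(1)] flip: s_def)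
    then have "s *\<^sub>R (g x - F x) = (\<Sum>j<J. cutoff h j x *\<^sub>R (c j - F x))"
      by (simp add: scaleR_diff_right sum_subtractf s_def flip: scaleR_left.sum)
    then have "s * norm (g x - F x) = norm (\<Sum>j<J. cutoff h j x *\<^sub>R (c j - F x))"
      using s by (metis abs_of_pos norm_scaleR)
    also have "\<dots> \<le> (\<Sum>j<J. cutoff h j x * norm (c j - F x))"
      using n0 by (intro sum_norm_le) simp
    also have "\<dots> < (\<Sum>j<J. cutoff h j x * \<epsilon>)"
    proof (rule sum_strict_mono_ex1)
      have le: "cutoff h j x * norm (c j - F x) < cutoff h j x * \<epsilon>" if "cutoff h j x \<noteq> 0" for j
      proof -
        have "h j x > 0" using that h0[OF x, of j] by (auto simp: cutoff_def less_le)
        then show ?thesis using close[OF x] that n0[of j] by (intro mult_strict_left_mono) auto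
      qed
      show "\<forall>j\<in>{..<J}. cutoff h j x * norm (c j - F x) \<le> cutoff h j x * \<epsilon>"
        using le by (metis less_imp_le mult_zero_left order_refl)
      \<comment> \<open>The strict bound needs one nonzero weight, as vanishing terms give only
        equality.\<close>
      have "\<exists>j<J. cutoff h j x \<noteq> 0" using J(2) by (metis less_irrefl lessThan_iff sum.neutral)
      then show "\<exists>j\<in>{..<J}. cutoff h j x * norm (c j - F x) < cutoff h j x * \<epsilon>"
        using le by blast
    qed simp
    also have "\<dots> = s * \<epsilon>" by (simp add: s_def sum_distrib_right)
    finally show ?thesis using s by simp
  qed
qed

section \<open>Homotopy, invariant approximation and descent to the orbit space\<close>

lemma homotopic_with_straight_line:
  fixes f g :: "'a \<Rightarrow> 'b::real_normed_vector"
  assumes "continuous_map X euclidean f" "continuous_map X euclidean g"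
  shows "homotopic_with (\<lambda>_. True) X euclidean f g"
  unfolding homotopic_with_def
proof (intro exI[of _ "\<lambda>(t, x). (1 - t) *\<^sub>R f x + t *\<^sub>R g x"] conjI ballI allI)
  let ?Z = "prod_topology (top_of_set {0..1::real}) X"
  have "continuous_map ?Z euclidean (\<lambda>z. f (snd z))" "continuous_map ?Z euclidean (\<lambda>z. g (snd z))"
    using continuous_map_compose[OF continuous_map_snd] assms by (auto simp: o_def)
  moreover have "continuous_map ?Z euclideanreal fst"
    by (meson continuous_map_fst continuous_map_in_subtopology)
  ultimately show "continuous_map ?Z euclidean (\<lambda>(t, x). (1 - t) *\<^sub>R f x + t *\<^sub>R g x)"
    unfolding continuous_map_atin limitin_canonical_iff case_prod_unfold
    by (intro ballI tendsto_add tendsto_scaleR tendsto_diff tendsto_const) auto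
qed auto

lemma smooth_invariant_approximation:
  fixes G :: "('g, 'z) monoid_scheme" and S :: "'g mfd" and M :: "'a mfd" and F :: "'a \<Rightarrow> real ^ 'n"
  assumes lie: "lie_group G S" and M: "smooth_manifold M"
    and act: "smooth_action G S M \<alpha>" and proper: "proper_action S M \<alpha>"
    and F: "continuous_map (mtop M) euclidean F"
      "\<And>a x. a \<in> carrier G \<Longrightarrow> x \<in> topspace (mtop M) \<Longrightarrow> F (\<alpha> a x) = F x"
    and "\<epsilon> > 0"
  obtains g where "\<And>k. (\<lambda>x. g x $ k) \<in> smooth_functions M"
    "\<And>x. x \<in> topspace (mtop M) \<Longrightarrow> norm (g x - F x) < \<epsilon>"
    "\<And>a x. a \<in> carrier G \<Longrightarrow> x \<in> topspace (mtop M) \<Longrightarrow> g (\<alpha> a x) = g x"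
proof -
  let ?Y = "mtop M"
  interpret act: group_action G "topspace ?Y" \<alpha> using act by (simp add: smooth_action_def)
  \<comment> \<open>Invariant because \<open>F\<close> is constant on orbits; on it \<open>F\<close>
    stays within \<open>\<epsilon>\<close> of its value at the centre.\<close>
  define W where "W = (\<lambda>x. {y \<in> topspace ?Y. F y \<in> ball (F x) \<epsilon>})"
  have Wo: "openin ?Y (W x)" for x
    unfolding W_def by (rule openin_continuous_map_preimage[OF F(1)]) simp
  have Wi: "\<alpha> a y \<in> W x" if "a \<in> carrier G" "y \<in> W x" for a x y
  proof -
    have y: "y \<in> topspace ?Y" "F y \<in> ball (F x) \<epsilon>" using that(2) by (auto simp: W_def)
    then show ?thesis
      using F(2)[OF that(1) y(1)] act.element_image[OF that(1) y(1) refl] by (simp add: W_def)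
  qed
  have "\<forall>x\<in>topspace ?Y. \<exists>h. h \<in> smooth_functions M \<and> (\<forall>y\<in>topspace ?Y. h y \<ge> 0) \<and> h x > 0 \<and>
      (\<forall>y\<in>topspace ?Y. y \<notin> W x \<longrightarrow> h y = 0) \<and>
      (\<forall>b\<in>carrier G. \<forall>y\<in>topspace ?Y. h (\<alpha> b y) = h y)"
  proof
    fix x assume "x \<in> topspace ?Y"
    then have "x \<in> W x" using \<open>\<epsilon> > 0\<close> by (simp add: W_def)
    from invariant_bump[OF lie M act proper Wo Wi this]
    show "\<exists>h. h \<in> smooth_functions M \<and> (\<forall>y\<in>topspace ?Y. h y \<ge> 0) \<and> h x > 0 \<and>
      (\<forall>y\<in>topspace ?Y. y \<notin> W x \<longrightarrow> h y = 0) \<and>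
      (\<forall>b\<in>carrier G. \<forall>y\<in>topspace ?Y. h (\<alpha> b y) = h y)" by metis
  qed
  from bchoice[OF this] obtain H where H': "\<forall>x\<in>topspace ?Y. H x \<in> smooth_functions M \<and>
      (\<forall>y\<in>topspace ?Y. H x y \<ge> 0) \<and> H x x > 0 \<and> (\<forall>y\<in>topspace ?Y. y \<notin> W x \<longrightarrow> H x y = 0) \<and>
      (\<forall>b\<in>carrier G. \<forall>y\<in>topspace ?Y. H x (\<alpha> b y) = H x y)" ..
  have H: "H x \<in> smooth_functions M" "y \<in> topspace ?Y \<Longrightarrow> H x y \<ge> 0" "H x x > 0"
    "y \<in> topspace ?Y \<Longrightarrow> y \<notin> W x \<Longrightarrow> H x y = 0"
    "y \<in> topspace ?Y \<Longrightarrow> b \<in> carrier G \<Longrightarrow> H x (\<alpha> b y) = H x y"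
    if "x \<in> topspace ?Y" for x y b
    using H' that by blast+
  let ?O = "\<lambda>x. {y \<in> topspace ?Y. H x y \<in> {0<..}}"
  have "openin ?Y (?O x)" if "x \<in> topspace ?Y" for x
    by (rule openin_continuous_map_preimage[OF smooth_functions_continuous[OF M H(1)[OF that]]]) simp
  moreover have "\<Union>(?O ` topspace ?Y) = topspace ?Y" using H(3) by auto
  \<comment> \<open>Second countability yields a countable subcover by sets on which some
    \<open>H x\<close> is positive, hence a sequence of functions.\<close>
  moreover have "Lindelof_space ?Y"
    using M second_countable_imp_Lindelof_space unfolding smooth_manifold_def by blast
  ultimately have "\<exists>\<V>. countable \<V> \<and> \<V> \<subseteq> ?O ` topspace ?Y \<and> \<Union>\<V> = topspace ?Y"
    unfolding Lindelof_space_def by (metis (no_types, lifting) imageE)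
  then obtain D where D: "countable D" "D \<subseteq> topspace ?Y" "\<Union>(?O ` D) = topspace ?Y"
    by (metis (no_types, lifting) countable_subset_image)
  obtain x :: "nat \<Rightarrow> 'a" and h :: "nat \<Rightarrow> 'a \<Rightarrow> real" where
    h: "\<And>j. h j \<in> smooth_functions M"
      "\<And>j y. y \<in> topspace ?Y \<Longrightarrow> h j y \<ge> 0"
      "\<And>j y. y \<in> topspace ?Y \<Longrightarrow> h j y > 0 \<Longrightarrow> y \<in> W (x j)"
      "\<And>j y b. y \<in> topspace ?Y \<Longrightarrow> b \<in> carrier G \<Longrightarrow> h j (\<alpha> b y) = h j y"
      "\<And>y. y \<in> topspace ?Y \<Longrightarrow> \<exists>j. h j y > 0"
  proof (cases "D = {}")
    \<comment> \<open>The empty manifold has no centres to enumerate; the pointwise claims are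
      vacuous and zero functions serve.\<close>
    case True
    then have "topspace ?Y = {}" using D(3) by simp
    then show ?thesis
      by (intro that[of "\<lambda>_ _. 0" "\<lambda>_. undefined"]) (simp_all add: smooth_functions_const)
  next
    case False
    \<comment> \<open>An enumeration with repetitions if \<open>D\<close> is finite; a repeated
      function merely occurs several times in the sums.\<close>
    define x where "x = from_nat_into D"
    have xY: "x j \<in> topspace ?Y" for j using from_nat_into[OF False] D(2) by (auto simp: x_def)
    show ?thesis
    proof (rule that[of "\<lambda>j. H (x j)" x])
      show "\<exists>j. H (x j) y > 0" if y: "y \<in> topspace ?Y" for y
      proof -
        have "y \<in> \<Union>(?O ` D)" using D(3) y by simp
        then obtain p where p: "p \<in> D" "H p y > 0" by auto
        then show ?thesis using from_nat_into_surj[OF D(1) p(1)] by (auto simp: x_def)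
      qed
      show "y \<in> W (x j)" if "y \<in> topspace ?Y" "H (x j) y > 0" for j y
        using H(4)[OF xY that(1)] that(2) by fastforce
    qed (use H xY in auto)
  qed
  define g where "g = (\<lambda>y. \<chi> k. (\<Sum>j. cutoff h j y * F (x j) $ k) * inverse (\<Sum>j. cutoff h j y))"
  have close: "norm (F (x j) - F y) < \<epsilon>" if "y \<in> topspace ?Y" "h j y > 0" for j y
    using h(3)[OF that] by (simp add: W_def dist_norm)
  show ?thesis
  proof
    show "(\<lambda>x. g x $ k) \<in> smooth_functions M" for k
      by (rule smooth_approximation_from_bumps(1)[OF M _ _ _ _ g_def]) (fact h(1,2,5) close)+
    show "norm (g y - F y) < \<epsilon>" if "y \<in> topspace ?Y" for y 
      by (rule smooth_approximation_from_bumps(2)[OF M _ _ _ _ g_def]) (fact h(1,2,5) close that)+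
    show "g (\<alpha> a y) = g y" if "a \<in> carrier G" "y \<in> topspace ?Y" for a y
      using h(4)[OF that(2,1)] by (simp add: g_def cutoff_def)
  qed
qed

theorem theorem4p8:
  fixes G :: "('g, 'z) monoid_scheme" and S :: "'g mfd"
    and M :: "'a mfd" and \<alpha> :: "'g \<Rightarrow> 'a \<Rightarrow> 'a"
    and f :: "'a set \<Rightarrow> real ^ 'n" and \<epsilon> :: real
  assumes "lie_group G S"
    and "smooth_manifold M"
    and "smooth_action G S M \<alpha>"
    and "proper_action S M \<alpha>"
    and "continuous_map (orbit_space G M \<alpha>) euclidean f"
    and "\<epsilon> > 0"
  shows "\<exists>g \<in> orbit_smooth_vec_functions G M \<alpha>.
           (\<forall>y \<in> topspace (orbit_space G M \<alpha>). norm (g y - f y) < \<epsilon>) \<and>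
           homotopic_with (\<lambda>_. True) (orbit_space G M \<alpha>) euclidean g f"
proof -
  let ?Y = "mtop M"
  interpret act: group_action G "topspace ?Y" \<alpha> using assms(3) by (simp add: smooth_action_def)
  interpret group G using act.group_hom group_hom.axioms(1) by blast
  have orbit_eq: "orbit G \<alpha> (\<alpha> a x) = orbit G \<alpha> x" if "a \<in> carrier G" "x \<in> topspace ?Y" for a x
  proof (intro equalityI subsetI)
    fix z assume "z \<in> orbit G \<alpha> (\<alpha> a x)"
    then obtain b where "b \<in> carrier G" "z = \<alpha> b (\<alpha> a x)" by (auto simp: orbit_def)
    then have "b \<otimes>\<^bsub>G\<^esub> a \<in> carrier G" "z = \<alpha> (b \<otimes>\<^bsub>G\<^esub> a) x"
      using act.composition_rule[OF that(2) _ that(1)] that(1) by auto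
    then show "z \<in> orbit G \<alpha> x" by (auto simp: orbit_def)
  next
    fix z assume "z \<in> orbit G \<alpha> x"
    then obtain b where b: "b \<in> carrier G" "z = \<alpha> b x" by (auto simp: orbit_def)
    have "\<alpha> b x = \<alpha> (b \<otimes>\<^bsub>G\<^esub> inv\<^bsub>G\<^esub> a \<otimes>\<^bsub>G\<^esub> a) x" using b(1) that(1) by (simp add: m_assoc)
    also have "\<dots> = \<alpha> (b \<otimes>\<^bsub>G\<^esub> inv\<^bsub>G\<^esub> a) (\<alpha> a x)"
      using b(1) that by (intro act.composition_rule) auto
    finally have "z = \<alpha> (b \<otimes>\<^bsub>G\<^esub> inv\<^bsub>G\<^esub> a) (\<alpha> a x)" using b(2) by simp
    moreover have "b \<otimes>\<^bsub>G\<^esub> inv\<^bsub>G\<^esub> a \<in> carrier G" using b(1) that(1) by simp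
    ultimately show "z \<in> orbit G \<alpha> (\<alpha> a x)" unfolding orbit_def by blast
  qed
  have "continuous_map ?Y euclidean (f \<circ> orbit G \<alpha>)"
    using quotient_imp_continuous_map[OF quotient_map_orbit] assms(5) by (rule continuous_map_compose)
  then obtain g where g: "\<And>k. (\<lambda>x. g x $ k) \<in> smooth_functions M"
    "\<And>x. x \<in> topspace ?Y \<Longrightarrow> norm (g x - (f \<circ> orbit G \<alpha>) x) < \<epsilon>"
    "\<And>a x. a \<in> carrier G \<Longrightarrow> x \<in> topspace ?Y \<Longrightarrow> g (\<alpha> a x) = g x"
    using smooth_invariant_approximation[OF assms(1-4), of "f \<circ> orbit G \<alpha>" \<epsilon>] orbit_eq assms(6)
    by auto
  \<comment> \<open>Invariance of \<open>g\<close> makes the choice of a representative of the orbit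
    immaterial.\<close>
  define g' where "g' = (\<lambda>y. g (SOME x. x \<in> topspace ?Y \<and> orbit G \<alpha> x = y))"
  have g': "g' (orbit G \<alpha> x) = g x" if x: "x \<in> topspace ?Y" for x
  proof -
    define z where "z = (SOME z. z \<in> topspace ?Y \<and> orbit G \<alpha> z = orbit G \<alpha> x)"
    have "\<exists>z. z \<in> topspace ?Y \<and> orbit G \<alpha> z = orbit G \<alpha> x" using x by blast
    then have z: "z \<in> topspace ?Y" "orbit G \<alpha> z = orbit G \<alpha> x"
      unfolding z_def by (metis (mono_tags, lifting) someI_ex)+
    then have "x \<in> orbit G \<alpha> z" using act.orbit_refl x by simp
    then obtain a where "a \<in> carrier G" "x = \<alpha> a z" by (auto simp: orbit_def)
    then have "g x = g z" using g(3) z(1) by simp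
    then show ?thesis by (simp add: g'_def z_def)
  qed
  have "g' \<in> orbit_smooth_vec_functions G M \<alpha>"
    unfolding orbit_smooth_vec_functions_def orbit_smooth_functions_def
  proof (intro CollectI allI)
    fix k
    show "(\<lambda>y. g' y $ k) \<circ> orbit G \<alpha> \<in> smooth_functions M"
      by (rule smooth_functions_cong[OF assms(2) g(1)[of k]]) (simp add: g')
  qed
  moreover have "\<forall>y\<in>topspace (orbit_space G M \<alpha>). norm (g' y - f y) < \<epsilon>"
    using g(2) g' by (auto simp: orbits_def)
  \<comment> \<open>Membership in the smooth structure is a condition on \<open>M\<close>;
    continuity for the quotient topology, which the homotopy requires, descends through the quotient
    map.\<close>
  moreover have "continuous_map (orbit_space G M \<alpha>) euclidean g'"
  proof (rule continuous_compose_quotient_map[OF quotient_map_orbit])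
    have "continuous_map ?Y euclidean g"
      unfolding continuous_map_atin limitin_canonical_iff
    proof (intro ballI vec_tendstoI)
      show "((\<lambda>x. g x $ k) \<longlongrightarrow> g y $ k) (atin ?Y y)" if "y \<in> topspace ?Y" for y k
        using smooth_functions_continuous[OF assms(2) g(1)[of k]] that
        unfolding continuous_map_atin limitin_canonical_iff by blast
    qed
    then show "continuous_map ?Y euclidean (g' \<circ> orbit G \<alpha>)"
      by (rule continuous_map_eq) (simp add: g')
  qed
  then have "homotopic_with (\<lambda>_. True) (orbit_space G M \<alpha>) euclidean g' f"
    using assms(5) by (rule homotopic_with_straight_line)
  ultimately show ?thesis by blast
qed

end
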